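(* Let $N\ge1$, and assume $1+b-a>0$ and $b\le\frac{N-2}{2}$. For $v\in C_0^\infty(\mathbb{R}^N)$ we have $$\int_{\mathbb{R}^N}|\nabla v|^2\,d\mu\ge C_{PI}(a,b,N)\inf_{c\in\mathbb{R}}\int_{\mathbb{R}^N}|v-c|^2\,d\nu .$$ Here the optimal constant is $C_{PI}(a,b,N)=\min\{C_1,D_1\}$. If $C_{PI}(a,b,N)=C_1$, then equality happens with $v(x)=a_0+a_1|x|^{1+b-a}$. Otherwise, if $C_{PI}(a,b,N)=D_1$, then equality occurs at $v(x)=c+|x|^{\frac{D_1}{2}-1}\mathbf{d}\cdot x$, where $c\in\mathbb{R}$, $\mathbf{d}\in\mathbb{R}^N$. Moreover, if $C_1<D_1$, we have $$\int_{\mathbb{R}^N}|\nabla v|^2d\mu-C_1\inf_{c\in\mathbb{R}}\int_{\mathbb{R}^N}|v-c|^2d\nu\ge\min\left\{\tfrac12,1-\tfrac{C_1}{D_1}\right\}\inf_{d\in\mathbb{R}}\int_{\mathbb{R}^N}\left|\nabla\left(v-d|x|^{1+b-a}\right)\right|^2d\mu$$ and $$\int_{\mathbb{R}^N}|\nabla v|^2d\mu-C_1\inf_{c\in\mathbb{R}}\int_{\mathbb{R}^N}|v-c|^2d\nu\ge\min\{C_1,D_1-C_1\}\inf_{c,d\in\mathbb{R}}\int_{\mathbb{R}^N}\left|v-c-d|x|^{1+b-a}\right|^2d\nu.$$ If $C_1>D_1$, then $$\int_{\mathbb{R}^N}|\nabla v|^2d\mu-D_1\inf_{c\in\mathbb{R}}\int_{\mathbb{R}^N}|v-c|^2d\nu\ge\min\{C_1-D_1,D_2-D_1\}\inf_{c\in\mathbb{R},\mathbf{d}\in\mathbb{R}^N}\int_{\mathbb{R}^N}\left|v-c-|x|^{\frac{D_1}{2}-1}\mathbf{d}\cdot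 x\right|^2d\nu$$ and $$\int_{\mathbb{R}^N}|\nabla v|^2d\mu-D_1\inf_{c\in\mathbb{R}}\int_{\mathbb{R}^N}|v-c|^2d\nu\ge\min\left\{1-\tfrac{D_1}{C_1},1-\tfrac{D_1}{D_2}\right\}\inf_{c\in\mathbb{R},\mathbf{d}\in\mathbb{R}^N}\int_{\mathbb{R}^N}\left|\nabla\left(v-c-|x|^{\frac{D_1}{2}-1}\mathbf{d}\cdot x\right)\right|^2d\mu.$$ If $C_1=D_1$, then $$\int_{\mathbb{R}^N}|\nabla v|^2d\mu-D_1\inf_{c\in\mathbb{R}}\int_{\mathbb{R}^N}|v-c|^2d\nu\ge\min\{D_1,D_2-D_1\}\inf_{c,d\in\mathbb{R},\mathbf{d}\in\mathbb{R}^N}\int_{\mathbb{R}^N}\left|v-c-d|x|^{1+b-a}-|x|^{\frac{D_1}{2}-1}\mathbf{d}\cdot x\right|^2d\nu$$ and $$\int_{\mathbb{R}^N}|\nabla v|^2d\mu-D_1\inf_{c\in\mathbb{R}}\int_{\mathbb{R}^N}|v-c|^2d\nu\ge\min\left\{\tfrac12,1-\tfrac{D_1}{D_2}\right\}\inf_{c,d\in\mathbb{R},\mathbf{d}\in\mathbb{R}^N}\int_{\mathbb{R}^N}\left|\nabla\left(v-c-d|x|^{1+b-a}-|x|^{\frac{D_1}{2}-1}\mathbf{d}\cdot x\right)\right|^2d\mu.$$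
   Context: Here $a,b\in\mathbb{R}$, functions are real-valued, and $$d\mu=\frac{e^{-\frac{2|x|^{1+b-a}}{1+b-a}}}{|x|^{2b}}dx,\qquad d\nu=\frac{e^{-\frac{2|x|^{1+b-a}}{1+b-a}}}{|x|^{1+b+a}}dx\quad\text{on }\mathbb{R}^N,$$ $$C_1=2(1+b-a),\qquad D_1=\sqrt{(N-2-2b)^2+4(N-1)}-(N-2-2b),\qquad D_2=\sqrt{(N-2-2b)^2+8N}-(N-2-2b).$$ The functions giving equality are understood in the natural weighted function space (all integrals finite), not necessarily compactly supported. The scalar $d\in\mathbb{R}$ and the vector $\mathbf{d}\in\mathbb{R}^N$ are independent parameters. *)

theory Defs
  imports "HOL-Analysis.Analysis"
begin

text \<open>
  The space of dimension \<open>N\<close> is \<^typ>\<open>real ^ 'n\<close> with \<open>N = CARD('n)\<close>. A weight is given by its Lebesgue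
  density. Division by zero makes both densities vanish at the origin, which is a null set.
\<close>

definition mu :: "real \<Rightarrow> real \<Rightarrow> (real ^ 'n) measure" where
  "mu a b = density lborel
     (\<lambda>x. ennreal (exp (- (2 * norm x powr (1 + b - a) / (1 + b - a))) / norm x powr (2 * b)))"

definition nu :: "real \<Rightarrow> real \<Rightarrow> (real ^ 'n) measure" where
  "nu a b = density lborel
     (\<lambda>x. ennreal (exp (- (2 * norm x powr (1 + b - a) / (1 + b - a))) / norm x powr (1 + b + a)))"

definition C1 :: "real \<Rightarrow> real \<Rightarrow> real" where
  "C1 a b = 2 * (1 + b - a)"

definition D1 :: "nat \<Rightarrow> real \<Rightarrow> real" where
  "D1 N b = sqrt ((real N - 2 - 2 * b)\<^sup>2 + 4 * (real N - 1)) - (real N - 2 - 2 * b)"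

definition D2 :: "nat \<Rightarrow> real \<Rightarrow> real" where
  "D2 N b = sqrt ((real N - 2 - 2 * b)\<^sup>2 + 8 * real N) - (real N - 2 - 2 * b)"

text \<open>
  The gradient is the vector of partial derivatives. At a point of non-differentiability its value
  is unspecified; for the functions considered here this concerns at most the origin.
\<close>

definition grad :: "(real ^ 'n \<Rightarrow> real) \<Rightarrow> real ^ 'n \<Rightarrow> real ^ 'n" where
  "grad f x = (\<chi> i. frechet_derivative f (at x) (axis i 1))"

primrec Ck :: "nat \<Rightarrow> (real ^ 'n \<Rightarrow> real) \<Rightarrow> bool" where
  "Ck 0 f \<longleftrightarrow> continuous_on UNIV f"
| "Ck (Suc k) f \<longleftrightarrow> (\<forall>x. f differentiable (at x)) \<and>
     (\<forall>h. Ck k (\<lambda>x. frechet_derivative f (at x) h))"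

definition test_functions :: "(real ^ 'n \<Rightarrow> real) set" where
  "test_functions = {v. (\<forall>k. Ck k v) \<and> compact (closure {x. v x \<noteq> 0})}"

definition energy :: "real \<Rightarrow> real \<Rightarrow> (real ^ 'n \<Rightarrow> real) \<Rightarrow> real" where
  "energy a b w = (\<integral>x. (norm (grad w x))\<^sup>2 \<partial>mu a b)"

definition sqint :: "real \<Rightarrow> real \<Rightarrow> (real ^ 'n \<Rightarrow> real) \<Rightarrow> real" where
  "sqint a b w = (\<integral>x. \<bar>w x\<bar>\<^sup>2 \<partial>nu a b)"

definition poincare :: "'n::finite itself \<Rightarrow> real \<Rightarrow> real \<Rightarrow> real \<Rightarrow> bool" where
  "poincare _ a b C \<longleftrightarrow> (\<forall>v \<in> (test_functions :: (real ^ 'n::finite \<Rightarrow> real) set).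
     energy a b v \<ge> C * (INF c. sqint a b (\<lambda>x. v x - c)))"

definition optimal_poincare_constant :: "'n::finite itself \<Rightarrow> real \<Rightarrow> real \<Rightarrow> real \<Rightarrow> bool" where
  "optimal_poincare_constant T a b C \<longleftrightarrow>
     poincare T a b C \<and> (\<forall>C'. poincare T a b C' \<longrightarrow> C' \<le> C)"

text \<open>
  The natural space for the functions attaining equality, which are neither compactly supported nor
  in general differentiable at the origin. The integrability conditions exclude the default value 0
  of a divergent Bochner integral.
\<close>

definition weighted_space :: "real \<Rightarrow> real \<Rightarrow> (real ^ 'n \<Rightarrow> real) set" where
  "weighted_space a b = {v. (\<forall>x. x \<noteq> 0 \<longrightarrow> v differentiable (at x)) \<and>
     integrable (mu a b) (\<lambda>x. (norm (grad v x))\<^sup>2) \<and>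
     (\<forall>c. integrable (nu a b) (\<lambda>x. \<bar>v x - c\<bar>\<^sup>2))}"

definition attains_equality :: "real \<Rightarrow> real \<Rightarrow> real \<Rightarrow> (real ^ 'n \<Rightarrow> real) \<Rightarrow> bool" where
  "attains_equality a b C v \<longleftrightarrow> v \<in> weighted_space a b \<and>
     energy a b v = C * (INF c. sqint a b (\<lambda>x. v x - c))"

end

theory Submission
  imports Defs
begin

text \<open>
  Put \<open>s = 1 + b - a\<close> and \<open>\<gamma> = N - 2 - 2 b\<close>. For a harmonic homogeneous polynomial \<open>h\<close> of degree \<open>k\<close>
  let \<open>D\<^sub>k / 2\<close> be the nonnegative root \<open>m\<close> of \<open>m\<^sup>2 + \<gamma> m = k (k + N - 2)\<close>. The operator \<open>L\<close> with
  \<open>\<integral> \<nabla>f \<bullet> \<nabla>\<phi> d\<mu> = \<integral> f L\<phi> d\<nu>\<close> acts triangularly on the functions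
  \<open>\<psi>\<^sub>j = |x| powr (D\<^sub>k / 2 - k + s j) h(x)\<close>: it maps \<open>\<psi>\<^sub>j\<close> to \<open>(D\<^sub>k + j C\<^sub>1) \<psi>\<^sub>j\<close> minus a multiple of \<open>\<psi>\<^sub>j\<^sub>-\<^sub>1\<close>.
  Hence their span is spanned by eigenfunctions with eigenvalues \<open>D\<^sub>k + j C\<^sub>1\<close>. The span is dense in \<open>L\<^sup>2(\<nu>)\<close>,
  and Bessel's inequality for the energy form gives
  \<open>\<integral> |\<nabla>w|\<^sup>2 d\<mu> \<ge> \<lambda> \<integral> w\<^sup>2 d\<nu>\<close> whenever \<open>w\<close> is orthogonal to all \<open>\<psi>\<^sub>j\<close> with \<open>D\<^sub>k + j C\<^sub>1 < \<lambda>\<close>.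
  All inequalities of the theorem result from splitting off the components of \<open>v\<close> in the one or two lowest
  eigenspaces. Sharpness follows by approximating \<open>|x| powr s\<close> and \<open>|x| powr (\<beta> - 1) (e \<bullet> x)\<close>, \<open>\<beta> > D\<^sub>1 / 2\<close>,
  by test functions; the detour through \<open>\<beta>\<close> is needed for \<open>N = 1\<close> and \<open>\<gamma> = 0\<close>, where \<open>\<beta> = D\<^sub>1 / 2 = 0\<close> gives the
  sign function.
\<close>

section \<open>Harmonic decomposition of polynomials\<close>

text \<open>The main obstacle is the origin: the eigenfunctions are powers of |x| times harmonic
  polynomials, in general not differentiable at 0, and for \<gamma> = 0 the weight is critical
  there. Everything is therefore expressed by two bilinear forms on functions regular off the
  origin; no self-adjoint extension or compact resolvent enters, and approximants are always finite
  sums of eigenfunctions. Density is delicate because the natural variable is |x| powr s while the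
  leading exponents D_k / 2 of different degrees are unrelated; a radial factor has to absorb the
  mismatch. The numbers D_k + j C_1 explain all constants. Besides the 0 of the constants, the
  lowest are C_1 (k = 0, j = 1) and D_1 (k = 1, j = 0). If C_1 < D_1, what follows is at least min{2
  C_1, D_1}, which gives min{C_1, D_1 - C_1} as absolute and min{1/2, 1 - C_1/D_1} as relative gap.
  If C_1 > D_1, the bound is min{C_1, D_2}; if C_1 = D_1, it is min{2 D_1, D_2}.\<close>

lemma GDERIV_grad:
  fixes f :: "real ^ 'n \<Rightarrow> real"
  assumes "f differentiable (at x)"
  shows "GDERIV f x :> grad f x"
proof -
  let ?f' = "frechet_derivative f (at x)"
  have d: "(f has_derivative ?f') (at x)"
    using assms frechet_derivative_works by blast
  then interpret linear ?f' by (rule has_derivative_linear)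
  have "?f' h = h \<bullet> grad f x" for h
  proof -
    have "?f' h = ?f' (\<Sum>i\<in>UNIV. h $ i *\<^sub>R axis i 1)"
      by (simp add: basis_expansion flip: scalar_mult_eq_scaleR)
    also have "\<dots> = h \<bullet> grad f x"
      by (simp add: sum scale inner_vec_def grad_def)
    finally show ?thesis .
  qed
  then have "?f' = (\<lambda>h. h \<bullet> grad f x)" by (rule ext)
  with d show ?thesis by (simp add: gderiv_def)
qed

text \<open>Product and chain rules are available for \<open>GDERIV\<close>. Together with
  \<open>GDERIV_grad\<close>, this lets the componentwise \<open>grad\<close> be computed by them:
  derive a \<open>GDERIV\<close> fact, then read off its vector.\<close>

lemma GDERIV_D:
  fixes f :: "real ^ 'n \<Rightarrow> real"
  assumes "GDERIV f x :> D"
  shows "f differentiable (at x)" "grad f x = D"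
proof -
  have d: "(f has_derivative (\<lambda>h. h \<bullet> D)) (at x)" using assms by (simp add: gderiv_def)
  then show "f differentiable (at x)" by (auto simp: differentiable_def)
  show "grad f x = D"
    using frechet_derivative_at[OF d]
    by (simp add: grad_def vec_eq_iff inner_axis' flip: fun_cong[OF frechet_derivative_at[OF d]])
qed

lemma GDERIV_inner_left: "GDERIV (\<lambda>x. e \<bullet> x) x :> e"
  unfolding gderiv_def
  by (auto intro!: derivative_eq_intros simp: inner_commute)

lemma GDERIV_cong_open:
  assumes "GDERIV f x :> D" "open S" "x \<in> S" "\<And>y. y \<in> S \<Longrightarrow> f y = g y"
  shows "GDERIV g x :> D"
  using assms has_derivative_transform_within_open[of f _ x UNIV S g]
  unfolding gderiv_def by blast

lemma GDERIV_cmult: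
  assumes "GDERIV f x :> D"
  shows "GDERIV (\<lambda>x. c * f x) x :> c *\<^sub>R D"
  using GDERIV_mult[OF GDERIV_const[of c] assms] by simp

lemma GDERIV_sqnorm: "GDERIV (\<lambda>x. (norm x)\<^sup>2) x :> 2 *\<^sub>R x"
  unfolding gderiv_def power2_norm_eq_inner
  by (auto intro!: derivative_eq_intros simp: inner_commute)

lemma sum_square_component: "(\<Sum>i\<in>UNIV. x $ i * x $ i) = (norm (x :: real ^ 'n))\<^sup>2"
  by (simp add: power2_norm_eq_inner inner_vec_def)

text \<open>Homogeneous polynomials are generated by multiplication with linear forms rather than
  described by coefficients, so that facts on gradients and growth follow by rule induction. The
  zero function belongs to every degree, which keeps truncated degrees such as \<open>k - 1\<close>
  correct when a derivative vanishes.\<close>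

inductive hom :: "nat \<Rightarrow> (real ^ 'n \<Rightarrow> real) \<Rightarrow> bool" where
  hom_const: "hom 0 (\<lambda>x. c)"
| hom_zero: "hom k (\<lambda>x. 0)"
| hom_lin: "hom k f \<Longrightarrow> hom (Suc k) (\<lambda>x. (e \<bullet> x) * f x)"
| hom_add: "hom k f \<Longrightarrow> hom k g \<Longrightarrow> hom k (\<lambda>x. f x + g x)"

lemma hom_linear: "hom 1 (\<lambda>x. e \<bullet> x)"
  using hom_lin[OF hom_const[of 1], of e] by simp

lemma hom_mult:
  assumes "hom k f" "hom l g"
  shows "hom (k + l) (\<lambda>x. f x * g x)"
  using assms(1)
proof (induction rule: hom.induct)
  case (hom_const c)
  show ?case using assms(2)
  proof (induction rule: hom.induct)
    case (hom_const d) show ?case using hom.hom_const[of "c * d"] by simp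
  next
    case (hom_zero k) show ?case using hom.hom_zero by simp
  next
    case (hom_lin k f e) then show ?case using hom.hom_lin[of k "\<lambda>x. c * f x" e]
      by (simp add: mult.left_commute)
  next
    case (hom_add k f g) then show ?case using hom.hom_add by (simp add: distrib_left)
  qed
next
  case (hom_zero k) show ?case using hom.hom_zero by simp
next
  case (hom_lin k f e) then show ?case using hom.hom_lin[of "k + l" "\<lambda>x. f x * g x" e]
    by (simp add: mult.assoc)
next
  case (hom_add k f g) then show ?case using hom.hom_add by (simp add: distrib_right)
qed

lemma hom_cmult: "hom k f \<Longrightarrow> hom k (\<lambda>x. c * f x)"
  using hom_mult[OF hom_const] by force

lemma hom_diff: "hom k f \<Longrightarrow> hom k g \<Longrightarrow> hom k (\<lambda>x. f x - g x)"
  using hom_add[OF _ hom_cmult[of k g "-1"]] by simp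

lemma hom_sum: "(\<And>i. i \<in> I \<Longrightarrow> hom k (f i)) \<Longrightarrow> hom k (\<lambda>x. \<Sum>i\<in>I. f i x)"
  by (induction I rule: infinite_finite_induct) (auto intro: hom_zero hom_add)

lemma hom_sqnorm: "hom 2 (\<lambda>x :: real ^ 'n. (norm x)\<^sup>2)"
proof -
  have "hom 2 (\<lambda>x :: real ^ 'n. \<Sum>i\<in>UNIV. (axis i 1 \<bullet> x) * (axis i 1 \<bullet> x))"
    using hom_mult[OF hom_linear hom_linear] by (intro hom_sum) (simp add: numeral_2_eq_2)
  then show ?thesis by (simp add: inner_axis' sum_square_component)
qed

lemma hom_0D: "hom 0 f \<Longrightarrow> \<exists>c. f = (\<lambda>x. c)"
  by (induction "0 :: nat" f rule: hom.induct) auto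

lemma hom_differentiable: "hom k f \<Longrightarrow> f differentiable (at x)"
  by (induction rule: hom.induct) auto

lemmas hom_GDERIV = GDERIV_grad[OF hom_differentiable]

lemma hom_continuous_on: "hom k f \<Longrightarrow> continuous_on S f"
  by (metis continuous_at_imp_continuous_on differentiable_imp_continuous_within hom_differentiable)

lemma grad_add:
  fixes f g :: "real ^ 'n \<Rightarrow> real"
  shows "f differentiable (at x) \<Longrightarrow> g differentiable (at x) \<Longrightarrow>
    grad (\<lambda>x. f x + g x) x = grad f x + grad g x"
  by (intro GDERIV_D(2) GDERIV_add GDERIV_grad)

lemma grad_diff:
  fixes f g :: "real ^ 'n \<Rightarrow> real"
  shows "f differentiable (at x) \<Longrightarrow> g differentiable (at x) \<Longrightarrow>
    grad (\<lambda>x. f x - g x) x = grad f x - grad g x"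
  by (intro GDERIV_D(2) GDERIV_diff GDERIV_grad)

lemma grad_mult:
  fixes f g :: "real ^ 'n \<Rightarrow> real"
  shows "f differentiable (at x) \<Longrightarrow> g differentiable (at x) \<Longrightarrow>
    grad (\<lambda>x. f x * g x) x = f x *\<^sub>R grad g x + g x *\<^sub>R grad f x"
  by (intro GDERIV_D(2) GDERIV_mult GDERIV_grad)

lemma grad_cmult:
  fixes f :: "real ^ 'n \<Rightarrow> real"
  shows "f differentiable (at x) \<Longrightarrow> grad (\<lambda>x. c * f x) x = c *\<^sub>R grad f x"
  by (intro GDERIV_D(2) GDERIV_cmult GDERIV_grad)

lemma grad_const [simp]: "grad (\<lambda>x. c) x = 0"
  by (intro GDERIV_D(2) GDERIV_const)

lemma grad_linear: "grad (\<lambda>x. e \<bullet> x) x = e"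
  by (intro GDERIV_D(2) GDERIV_inner_left)

lemma hom_grad: "hom k f \<Longrightarrow> hom (k - 1) (\<lambda>x. grad f x $ i)"
proof (induction rule: hom.induct)
  case (hom_const c) show ?case using hom_zero by simp
next
  case (hom_zero k) show ?case using hom.hom_zero by simp
next
  case (hom_lin k f e)
  have eq: "(\<lambda>x. grad (\<lambda>x. (e \<bullet> x) * f x) x $ i) = (\<lambda>x. (e \<bullet> x) * grad f x $ i + e $ i * f x)"
    using GDERIV_D(2)[OF GDERIV_mult[OF GDERIV_inner_left hom_GDERIV[OF hom_lin.hyps]], of e]
    by (simp add: mult.commute)
  \<comment> \<open>\<open>Suc (k - 1) = k\<close> fails for \<open>k = 0\<close>; there
    \<open>f\<close> is constant and the product vanishes.\<close>
  have "hom k (\<lambda>x. (e \<bullet> x) * grad f x $ i)"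
  proof (cases k)
    case 0
    then obtain c where "f = (\<lambda>x. c)" using hom_0D hom_lin.hyps by blast
    then show ?thesis by (simp add: hom.hom_zero)
  next
    case (Suc l)
    then show ?thesis using hom.hom_lin[OF hom_lin.IH] by simp
  qed
  with hom_cmult[OF hom_lin.hyps] show ?case unfolding eq by (simp add: hom_add)
next
  case (hom_add k f g)
  then show ?case by (simp add: grad_add hom_differentiable hom.hom_add)
qed

lemma hom_Euler: "hom k f \<Longrightarrow> x \<bullet> grad f x = k * f x"
proof (induction rule: hom.induct)
  case (hom_lin k f e)
  have "grad (\<lambda>x. (e \<bullet> x) * f x) x = (e \<bullet> x) *\<^sub>R grad f x + f x *\<^sub>R e"
    by (intro GDERIV_D(2) GDERIV_mult GDERIV_inner_left hom_GDERIV[OF hom_lin.hyps])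
  then show ?case using hom_lin.IH by (simp add: inner_add_right inner_commute[of x e] algebra_simps)
next
  case (hom_add k f g)
  then show ?case by (simp add: grad_add hom_differentiable inner_add_right algebra_simps)
qed auto

lemma hom_bound: "hom k f \<Longrightarrow> \<exists>C\<ge>0. \<forall>x. \<bar>f x\<bar> \<le> C * norm x ^ k"
proof (induction rule: hom.induct)
  case (hom_const c) show ?case by (auto intro: exI[of _ "\<bar>c\<bar>"])
next
  case (hom_zero k) show ?case by (auto intro: exI[of _ "0"])
next
  case (hom_lin k f e)
  then obtain C where C: "C \<ge> 0" "\<And>x. \<bar>f x\<bar> \<le> C * norm x ^ k" by auto
  have "\<bar>(e \<bullet> x) * f x\<bar> \<le> (norm e * C) * norm x ^ Suc k" for x
  proof -
    have "\<bar>(e \<bullet> x) * f x\<bar> \<le> (norm e * norm x) * (C * norm x ^ k)"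
      unfolding abs_mult by (intro mult_mono Cauchy_Schwarz_ineq2 C) auto
    then show ?thesis by (simp add: algebra_simps)
  qed
  then show ?case using C(1) by (intro exI[of _ "norm e * C"]) auto
next
  case (hom_add k f g)
  then obtain C D where C: "C \<ge> 0" "\<And>x. \<bar>f x\<bar> \<le> C * norm x ^ k"
    and D: "D \<ge> 0" "\<And>x. \<bar>g x\<bar> \<le> D * norm x ^ k" by auto
  then show ?case
    by (intro exI[of _ "C + D"]) (auto simp: distrib_right intro: order_trans[OF abs_triangle_ineq] add_mono)
qed

definition lap :: "(real ^ 'n \<Rightarrow> real) \<Rightarrow> real ^ 'n \<Rightarrow> real" where
  "lap f x = (\<Sum>i\<in>UNIV. grad (\<lambda>y. grad f y $ i) x $ i)"

definition harm :: "nat \<Rightarrow> (real ^ 'n \<Rightarrow> real) \<Rightarrow> bool" where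
  "harm k h \<longleftrightarrow> hom k h \<and> (\<forall>x. lap h x = 0)"

lemma lap_add: "hom k f \<Longrightarrow> hom k g \<Longrightarrow> lap (\<lambda>x. f x + g x) x = lap f x + lap g x"
  unfolding lap_def
  by (simp add: grad_add hom_differentiable hom_differentiable[OF hom_grad] sum.distrib)

lemma lap_cmult: "hom k f \<Longrightarrow> lap (\<lambda>x. c * f x) x = c * lap f x"
  unfolding lap_def
  by (simp add: grad_cmult hom_differentiable hom_differentiable[OF hom_grad] sum_distrib_left)

lemma lap_diff: "hom k f \<Longrightarrow> hom k g \<Longrightarrow> lap (\<lambda>x. f x - g x) x = lap f x - lap g x"
  unfolding lap_def
  by (simp add: grad_diff hom_differentiable hom_differentiable[OF hom_grad] sum_subtractf)

lemma hom_lap: "hom k f \<Longrightarrow> hom (k - 2) (lap f)"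
proof -
  assume "hom k f"
  then have "hom (k - 1 - 1) (\<lambda>x. grad (\<lambda>y. grad f y $ i) x $ i)" for i by (intro hom_grad)
  moreover have "k - 1 - 1 = k - 2" by simp
  ultimately show ?thesis unfolding lap_def[abs_def] by (intro hom_sum) (simp only:)
qed

lemma lap_zero_low: "hom k f \<Longrightarrow> k < 2 \<Longrightarrow> lap f x = 0"
proof -
  assume f: "hom k f" "k < 2"
  have "hom 0 (\<lambda>y. grad f y $ i)" for i
  proof -
    have "k - 1 = 0" using f(2) by simp
    then show ?thesis using hom_grad[OF f(1), of i] by (simp only:)
  qed
  then have "\<exists>c. (\<lambda>y. grad f y $ i) = (\<lambda>y. c)" for i using hom_0D by blast
  then obtain c where "\<And>i. (\<lambda>y. grad f y $ i) = (\<lambda>y. c i)" by metis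
  then show ?thesis by (simp add: lap_def)
qed

lemma harm_low: "hom k f \<Longrightarrow> k < 2 \<Longrightarrow> harm k f"
  by (simp add: harm_def lap_zero_low)

lemma harm_cmult: "harm k h \<Longrightarrow> harm k (\<lambda>x. c * h x)"
  by (auto simp: harm_def hom_cmult lap_cmult)

lemma hom_sqnorm_mult: "hom k f \<Longrightarrow> hom (k + 2) (\<lambda>x. (norm x)\<^sup>2 * f x)"
  using hom_mult[OF hom_sqnorm] by (simp add: add.commute)

lemma grad_sqnorm_mult:
  "hom k f \<Longrightarrow> grad (\<lambda>x. (norm x)\<^sup>2 * f x) x = (norm x)\<^sup>2 *\<^sub>R grad f x + (2 * f x) *\<^sub>R x"
  using GDERIV_D(2)[OF GDERIV_mult[OF GDERIV_sqnorm hom_GDERIV]] by (simp add: mult.commute)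

text \<open>The Laplacian of |x|^2 contributes 2 N f, and the mixed term is 4 x . grad f, which
  Euler's identity turns into 4 k f.\<close>

lemma lap_sqnorm_mult:
  fixes f :: "real ^ 'n \<Rightarrow> real"
  assumes f: "hom k f"
  shows "lap (\<lambda>x. (norm x)\<^sup>2 * f x) x = (2 * CARD('n) + 4 * k) * f x + (norm x)\<^sup>2 * lap f x"
proof -
  have *: "grad (\<lambda>y. grad (\<lambda>x. (norm x)\<^sup>2 * f x) y $ i) x $ i =
    (norm x)\<^sup>2 * grad (\<lambda>y. grad f y $ i) x $ i + 4 * (x $ i * grad f x $ i) + 2 * f x" for i
  proof -
    have F: "(\<lambda>y. grad (\<lambda>x. (norm x)\<^sup>2 * f x) y $ i) =
      (\<lambda>y. (norm y)\<^sup>2 * grad f y $ i + (2 * f y) * (axis i 1 \<bullet> y))"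
      unfolding grad_sqnorm_mult[OF f] by (simp add: inner_axis')
    have "grad (\<lambda>y. (norm y)\<^sup>2 * grad f y $ i + (2 * f y) * (axis i 1 \<bullet> y)) x =
      (((norm x)\<^sup>2 *\<^sub>R grad (\<lambda>y. grad f y $ i) x + (grad f x $ i) *\<^sub>R (2 *\<^sub>R x)) +
      ((2 * f x) *\<^sub>R axis i 1 + (axis i 1 \<bullet> x) *\<^sub>R (2 *\<^sub>R grad f x)))"
      by (intro GDERIV_D(2) GDERIV_add GDERIV_mult GDERIV_sqnorm hom_GDERIV[OF hom_grad[OF f]] GDERIV_cmult
          GDERIV_inner_left hom_GDERIV[OF f])
    then show ?thesis unfolding F by (simp add: inner_axis' algebra_simps)
  qed
  have "lap (\<lambda>x. (norm x)\<^sup>2 * f x) x = (\<Sum>i\<in>UNIV. (norm x)\<^sup>2 * grad (\<lambda>y. grad f y $ i) x $ i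
      + 4 * (x $ i * grad f x $ i) + 2 * f x)"
    unfolding lap_def * ..
  also have "\<dots> = (norm x)\<^sup>2 * lap f x + 4 * (x \<bullet> grad f x) + 2 * CARD('n) * f x"
    unfolding lap_def inner_vec_def sum.distrib inner_real_def by (simp add: sum_distrib_left)
  finally show ?thesis unfolding hom_Euler[OF f] by (simp add: algebra_simps)
qed

text \<open>Multiplication by |x|^2 followed by the Laplacian acts on |x|^(2 j) h as a scalar.
  Iterating \<open>lap_sqnorm_mult\<close> adds up positive scalars, since h itself is harmonic;
  positivity allows dividing by \<open>c\<close> later. Homogeneity is carried along because that
  identity applies to functions of known degree.\<close>

lemma lap_even_power_mult:
  fixes h :: "real ^ 'n \<Rightarrow> real"
  assumes h: "harm l h"
  shows "hom (2 * j + l) (\<lambda>x. (norm x) ^ (2 * j) * h x) \<and>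
    (\<exists>c>0. \<forall>x. lap (\<lambda>x. (norm x) ^ (2 * Suc j) * h x) x = c * ((norm x) ^ (2 * j) * h x))"
proof (induction j)
  case 0
  have h': "hom l h" using h by (simp add: harm_def)
  moreover have "lap (\<lambda>x. (norm x) ^ (2 * Suc 0) * h x) x = real (2 * CARD('n) + 4 * l) * ((norm x) ^ (2 * 0) * h x)" for x
    using lap_sqnorm_mult[OF h', of x] h by (simp add: harm_def)
  moreover have "real (2 * CARD('n) + 4 * l) > 0" by (simp add: add_pos_nonneg)
  ultimately show ?case
    unfolding mult_0_right power_0 mult_1_left add_0
    by (intro conjI exI[of _ "real (2 * CARD('n) + 4 * l)"] allI)
next
  case (Suc j)
  from Suc have hj: "hom (2 * j + l) (\<lambda>x. (norm x) ^ (2 * j) * h x)" by (rule conjunct1)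
  from Suc have "\<exists>c>0. \<forall>x. lap (\<lambda>x. (norm x) ^ (2 * Suc j) * h x) x = c * ((norm x) ^ (2 * j) * h x)"
    by (rule conjunct2)
  then obtain c where c0: "c > 0" and c': "\<forall>x. lap (\<lambda>x. (norm x) ^ (2 * Suc j) * h x) x = c * ((norm x) ^ (2 * j) * h x)"
    by (elim exE conjE)
  have c: "lap (\<lambda>x. (norm x) ^ (2 * Suc j) * h x) x = c * ((norm x) ^ (2 * j) * h x)" for x
    by (rule spec[OF c'])
  have eq: "(norm x) ^ (2 * Suc i) * h x = (norm x)\<^sup>2 * ((norm x) ^ (2 * i) * h x)" for i x
    by (simp add: power2_eq_square)
  have hom': "hom (2 * Suc j + l) (\<lambda>x. (norm x) ^ (2 * Suc j) * h x)"
    using hom_sqnorm_mult[OF hj] unfolding eq by (simp add: add.commute add.left_commute)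
  have "lap (\<lambda>x. (norm x) ^ (2 * Suc (Suc j)) * h x) x =
    (real (2 * CARD('n) + 4 * (2 * Suc j + l)) + c) * ((norm x) ^ (2 * Suc j) * h x)" for x
  proof -
    have "lap (\<lambda>x. (norm x) ^ (2 * Suc (Suc j)) * h x) x =
      real (2 * CARD('n) + 4 * (2 * Suc j + l)) * ((norm x) ^ (2 * Suc j) * h x) +
      (norm x)\<^sup>2 * (c * ((norm x) ^ (2 * j) * h x))"
      unfolding eq[of _ "Suc j"] lap_sqnorm_mult[OF hom'] c ..
    also have "(norm x)\<^sup>2 * (c * ((norm x) ^ (2 * j) * h x)) = c * ((norm x) ^ (2 * Suc j) * h x)"
      unfolding eq[of x j] by (rule mult.left_commute)
    finally show ?thesis by (simp only: distrib_right)
  qed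
  moreover have "real (2 * CARD('n) + 4 * (2 * Suc j + l)) + c > 0" using c0 by (intro add_nonneg_pos) auto
  ultimately show ?case by (intro conjI exI[of _ "real (2 * CARD('n) + 4 * (2 * Suc j + l)) + c"] allI hom')
qed

inductive harmonic_sum :: "nat \<Rightarrow> (real ^ 'n \<Rightarrow> real) \<Rightarrow> bool" where
  harmonic_sum_zero: "harmonic_sum k (\<lambda>x. 0)"
| harmonic_sum_base: "harm l h \<Longrightarrow> harmonic_sum (2 * j + l) (\<lambda>x. norm x ^ (2 * j) * h x)"
| harmonic_sum_add: "harmonic_sum k f \<Longrightarrow> harmonic_sum k g \<Longrightarrow> harmonic_sum k (\<lambda>x. f x + g x)"

text \<open>Each generator |x|^(2 j) h is, up to the nonzero constant of
  \<open>lap_even_power_mult\<close>, the Laplacian of |x|^(2 j + 2) h; linearity does the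
  rest.\<close>

lemma lap_surj_harmonic_sum:
  "harmonic_sum k f \<Longrightarrow> \<exists>q. harmonic_sum (k + 2) q \<and> hom (k + 2) q \<and> (\<forall>x. lap q x = f x)"
proof (induction rule: harmonic_sum.induct)
  case (harmonic_sum_zero k)
  show ?case
    by (intro exI[of _ "\<lambda>x. 0"]) (auto simp: lap_def harmonic_sum.harmonic_sum_zero hom_zero)
next
  case (harmonic_sum_base l h j)
  obtain c where c: "c > 0" "\<And>x. lap (\<lambda>x. (norm x) ^ (2 * Suc j) * h x) x = c * ((norm x) ^ (2 * j) * h x)"
    using lap_even_power_mult[OF harmonic_sum_base] by blast
  let ?q = "\<lambda>x. (1 / c) * ((norm x) ^ (2 * Suc j) * h x)"
  have hq: "hom (2 * Suc j + l) (\<lambda>x. (norm x) ^ (2 * Suc j) * h x)"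
    using lap_even_power_mult[OF harmonic_sum_base] by blast
  then have "hom (2 * Suc j + l) ?q" by (rule hom_cmult)
  then have "hom (2 * j + l + 2) ?q" by (simp add: add.commute add.left_commute)
  moreover have "\<forall>x. lap ?q x = (norm x) ^ (2 * j) * h x"
    using lap_cmult[OF hq, of "1 / c"] c by simp
  moreover have "harmonic_sum (2 * j + l + 2) ?q"
    using harmonic_sum.harmonic_sum_base[OF harm_cmult[OF harmonic_sum_base, of "1 / c"], of "Suc j"]
    by (simp add: add.commute add.left_commute mult.left_commute)
  ultimately show ?case by (intro exI[of _ ?q] conjI)
next
  case (harmonic_sum_add k f g)
  then obtain p q where p: "harmonic_sum (k + 2) p" "hom (k + 2) p" "\<forall>x. lap p x = f x"
    and q: "harmonic_sum (k + 2) q" "hom (k + 2) q" "\<forall>x. lap q x = g x" by blast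
  have "lap (\<lambda>x. p x + q x) x = f x + g x" for x
    using lap_add[OF p(2) q(2)] p(3) q(3) by simp
  then show ?case
    by (intro exI[of _ "\<lambda>x. p x + q x"] conjI allI harmonic_sum.harmonic_sum_add hom_add p(1,2) q(1,2))
qed

text \<open>Strong induction on the degree: \<open>lap f\<close> has degree k - 2, hence is the
  Laplacian of a harmonic sum q of degree k, and f - q is harmonic. Surjectivity of the Laplacian
  replaces the usual orthogonality argument.\<close>

lemma hom_imp_harmonic_sum: "hom k f \<Longrightarrow> harmonic_sum k f"
proof (induction k arbitrary: f rule: less_induct)
  case (less k)
  have base: "harm k f \<Longrightarrow> harmonic_sum k f" for f
    using harmonic_sum_base[of k f 0] by simp
  show ?case
  proof (cases "k < 2")
    case True
    then show ?thesis using base harm_low less.prems by blast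
  next
    case False
    then have "harmonic_sum (k - 2) (lap f)" using less hom_lap by force
    moreover have "k - 2 + 2 = k" using False by simp
    ultimately obtain q where q: "harmonic_sum k q" "hom k q" "\<And>x. lap q x = lap f x"
      using lap_surj_harmonic_sum[of "k - 2" "lap f"] by auto
    have "harm k (\<lambda>x. f x - q x)"
      using q less.prems by (auto simp: harm_def hom_diff lap_diff)
    from harmonic_sum_add[OF q(1) base[OF this]] show ?thesis by simp
  qed
qed

inductive graded :: "(real ^ 'n \<Rightarrow> real) \<Rightarrow> bool" where
  graded_hom: "hom k f \<Longrightarrow> graded f"
| graded_add: "graded f \<Longrightarrow> graded g \<Longrightarrow> graded (\<lambda>x. f x + g x)"

lemma graded_mult:
  assumes "graded f" "graded g"
  shows "graded (\<lambda>x. f x * g x)"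
  using assms(1)
proof (induction rule: graded.induct)
  case f: (graded_hom k f)
  show ?case using assms(2)
  proof (induction rule: graded.induct)
    case (graded_hom l g)
    show ?case by (rule graded.graded_hom[OF hom_mult[OF f graded_hom]])
  next
    case (graded_add g h)
    then show ?case using graded.graded_add by (simp add: distrib_left)
  qed
next
  case (graded_add f h)
  then show ?case using graded.graded_add by (simp add: distrib_right)
qed

text \<open>Stone-Weierstrass delivers a \<open>real_polynomial_function\<close>; this leads from
  there to homogeneous parts, and through \<open>hom_imp_harmonic_sum\<close> to harmonic
  polynomials.\<close>

lemma real_polynomial_function_imp_graded:
  fixes p :: "real ^ 'n \<Rightarrow> real"
  assumes "real_polynomial_function p"
  shows "graded p"
  using assms
proof (induction rule: real_polynomial_function.induct)
  case (linear f)
  interpret bounded_linear f by (rule linear)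
  have "f x = (\<chi> i. f (axis i 1)) \<bullet> x" for x
  proof -
    have "f x = f (\<Sum>i\<in>UNIV. x $ i *\<^sub>R axis i 1)"
      by (simp add: basis_expansion flip: scalar_mult_eq_scaleR)
    also have "\<dots> = (\<Sum>i\<in>UNIV. x $ i * f (axis i 1))"
      by (simp add: sum scale)
    finally show ?thesis by (simp add: inner_vec_def mult.commute)
  qed
  then have "f = (\<lambda>x. (\<chi> i. f (axis i 1)) \<bullet> x)" by (rule ext)
  then show ?case using graded_hom[OF hom_linear] by metis
qed (auto intro: graded_hom hom_const graded_add graded_mult)

section \<open>Integrability of the weights\<close>

lemma ennreal_term_le_suminf: "(f :: nat \<Rightarrow> ennreal) n \<le> suminf f"
  using sum_le_suminf[of f "{n}"] by simp

lemma powr_nat_power: "0 < x \<Longrightarrow> (x powr a) ^ n = x powr (a * real n)" for x a :: real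
  by (simp add: powr_powr flip: powr_realpow)

text \<open>Dyadic comparison in place of polar coordinates: on the shell 2^(-n-1) < |x| <= 2^(-n)
  the power is at most 2^(-(n+1) p), because p <= 0. Enlarging the shell to a ball of volume
  proportional to 2^(-n N) gives a geometric series of ratio 2^(-(p+N)) < 1.\<close>

lemma nn_integral_norm_powr_cball:
  fixes p :: real
  assumes p: "p \<le> 0" "0 < p + DIM('a::euclidean_space)"
  shows "(\<integral>\<^sup>+x. ennreal (norm x powr p) * indicator (cball (0 :: 'a) 1) x \<partial>lborel) < \<infinity>"
proof -
  let ?N = "DIM('a)" and ?V = "unit_ball_vol (DIM('a))"
  let ?c = "\<lambda>n :: nat. 2 powr (- (real n + 1) * p)" and ?B = "\<lambda>n :: nat. cball (0 :: 'a) (2 powr (- real n))"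
  have le: "(\<integral>\<^sup>+x. ennreal (norm x powr p) * indicator (cball (0 :: 'a) 1) x \<partial>lborel)
    \<le> (\<integral>\<^sup>+x. (\<Sum>n. ennreal (?c n) * indicator (?B n) x) \<partial>lborel)"
  proof (rule nn_integral_mono)
    fix x :: 'a
    show "ennreal (norm x powr p) * indicator (cball 0 1) x \<le> (\<Sum>n. ennreal (?c n) * indicator (?B n) x)"
    proof (cases "x = 0 \<or> norm x > 1")
      case True
      then have "ennreal (norm x powr p) * indicator (cball (0 :: 'a) 1) x = 0" by (auto simp: indicator_def)
      then show ?thesis by (simp only: zero_le)
    next
      case False
      then have x: "0 < norm x" "norm x \<le> 1" by auto
      define n where "n = nat \<lfloor>- log 2 (norm x)\<rfloor>"
      have "0 \<le> - log 2 (norm x)" using x by (simp add: log_le_zero_cancel_iff)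
      then have n: "real n \<le> - log 2 (norm x)" "- log 2 (norm x) < real n + 1"
        unfolding n_def by linarith+
      have r: "norm x = 2 powr (log 2 (norm x))" using x by simp
      have 1: "norm x \<le> 2 powr (- real n)" by (subst r) (use n in \<open>simp only: powr_le_cancel_iff\<close>)
      have "norm x powr p = 2 powr (log 2 (norm x) * p)" by (subst r) (simp only: powr_powr)
      also have "\<dots> \<le> ?c n"
        using n p by (intro powr_mono mult_right_mono_neg) auto
      finally have "ennreal (norm x powr p) * indicator (cball 0 1) x \<le> ennreal (?c n) * indicator (?B n) x"
        using 1 x by (simp add: ennreal_leI)
      also have "\<dots> \<le> (\<Sum>n. ennreal (?c n) * indicator (?B n) x)"
        by (rule ennreal_term_le_suminf[of "\<lambda>n. ennreal (?c n) * indicator (?B n) x"])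
      finally show ?thesis .
    qed
  qed
  have eq1: "(\<integral>\<^sup>+x. (\<Sum>n. ennreal (?c n) * indicator (?B n) x) \<partial>lborel) = (\<Sum>n. (\<integral>\<^sup>+x. ennreal (?c n) * indicator (?B n) x \<partial>lborel))"
    by (intro nn_integral_suminf borel_measurable_times_ennreal borel_measurable_const borel_measurable_indicator) simp
  have eq2: "(\<Sum>n. (\<integral>\<^sup>+x. ennreal (?c n) * indicator (?B n) x \<partial>lborel)) = (\<Sum>n. ennreal (?c n) * emeasure lborel (?B n))"
    by (intro suminf_cong nn_integral_cmult_indicator) simp
  have eq3: "(\<Sum>n. ennreal (?c n) * emeasure lborel (?B n)) = (\<Sum>n. ennreal (?V * 2 powr (- p) * (2 powr (- (p + ?N))) ^ n))"
  proof (intro suminf_cong)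
    fix n :: nat
    have "?c n * (?V * (2 powr (- real n)) ^ ?N) = ?V * 2 powr (- p) * (2 powr (- (p + ?N))) ^ n"
    proof -
      have "- (real n + 1) * p + - real n * real ?N = - p + - (p + real ?N) * real n"
        by (simp add: algebra_simps)
      then have "?c n * (2 powr (- real n)) ^ ?N = 2 powr (- p) * (2 powr (- (p + ?N))) ^ n"
        unfolding powr_nat_power[OF zero_less_numeral] by (simp only: powr_add[symmetric])
      then show ?thesis by (simp only: mult.left_commute[of _ ?V] mult.assoc)
    qed
    then show "ennreal (?c n) * emeasure lborel (?B n) = ennreal (?V * 2 powr (- p) * (2 powr (- (p + ?N))) ^ n)"
      by (simp only: emeasure_cball powr_ge_zero ennreal_mult'[symmetric])
  qed
  have "(\<Sum>n. ennreal (?V * 2 powr (- p) * (2 powr (- (p + ?N))) ^ n)) < \<infinity>"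
  proof -
    have "2 powr (- (p + ?N)) < (1 :: real)" using p by (simp add: powr_less_one)
    then have "summable (\<lambda>n. ?V * 2 powr (- p) * (2 powr (- (p + ?N))) ^ n)"
      by (intro summable_mult summable_geometric) simp
    then have "(\<Sum>n. ennreal (?V * 2 powr (- p) * (2 powr (- (p + ?N))) ^ n)) \<noteq> top"
      by (intro ennreal_suminf_neq_top) auto
    then show ?thesis by (simp add: less_top)
  qed
  with le show ?thesis unfolding eq1 eq2 eq3 by (rule order.strict_trans1)
qed

text \<open>The same comparison with shells 2^n <= |x| < 2^(n+1). The exponent -N - 1 is one
  convenient integrable power, for which the series has ratio 1/2; exponential decay reduces every
  other growth to it.\<close>

lemma nn_integral_norm_powr_outside:
  "(\<integral>\<^sup>+x. ennreal (norm x powr (- real DIM('a) - 1)) * indicator (- cball (0 :: 'a::euclidean_space) 1) x \<partial>lborel) < \<infinity>"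
proof -
  let ?N = "DIM('a)" and ?V = "unit_ball_vol (DIM('a))"
  let ?p = "- real DIM('a) - 1"
  let ?c = "\<lambda>n :: nat. 2 powr (real n * ?p)" and ?B = "\<lambda>n :: nat. cball (0 :: 'a) (2 powr (real n + 1))"
  have le: "(\<integral>\<^sup>+x. ennreal (norm x powr ?p) * indicator (- cball (0 :: 'a) 1) x \<partial>lborel)
    \<le> (\<integral>\<^sup>+x. (\<Sum>n. ennreal (?c n) * indicator (?B n) x) \<partial>lborel)"
  proof (rule nn_integral_mono)
    fix x :: 'a
    show "ennreal (norm x powr ?p) * indicator (- cball 0 1) x \<le> (\<Sum>n. ennreal (?c n) * indicator (?B n) x)"
    proof (cases "norm x \<le> 1")
      case True
      then have "ennreal (norm x powr ?p) * indicator (- cball (0 :: 'a) 1) x = 0" by (auto simp: indicator_def)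
      then show ?thesis by (simp only: zero_le)
    next
      case False
      then have x: "1 < norm x" by auto
      define n where "n = nat \<lfloor>log 2 (norm x)\<rfloor>"
      have "0 \<le> log 2 (norm x)" using x by (subst zero_le_log_cancel_iff) auto
      then have n: "real n \<le> log 2 (norm x)" "log 2 (norm x) < real n + 1"
        unfolding n_def by linarith+
      have r: "norm x = 2 powr (log 2 (norm x))" using x by (intro powr_log_cancel[symmetric]) auto
      have 1: "norm x \<le> 2 powr (real n + 1)" by (subst r) (use n in \<open>simp only: powr_le_cancel_iff\<close>)
      have "norm x powr ?p = 2 powr (log 2 (norm x) * ?p)" by (subst r) (simp only: powr_powr)
      also have "\<dots> \<le> ?c n"
        using n by (intro powr_mono mult_right_mono_neg) auto
      finally have "ennreal (norm x powr ?p) * indicator (- cball 0 1) x \<le> ennreal (?c n) * indicator (?B n) x"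
        using 1 x by (simp add: ennreal_leI)
      also have "\<dots> \<le> (\<Sum>n. ennreal (?c n) * indicator (?B n) x)"
        by (rule ennreal_term_le_suminf[of "\<lambda>n. ennreal (?c n) * indicator (?B n) x"])
      finally show ?thesis .
    qed
  qed
  have eq1: "(\<integral>\<^sup>+x. (\<Sum>n. ennreal (?c n) * indicator (?B n) x) \<partial>lborel) = (\<Sum>n. (\<integral>\<^sup>+x. ennreal (?c n) * indicator (?B n) x \<partial>lborel))"
    by (intro nn_integral_suminf borel_measurable_times_ennreal borel_measurable_const borel_measurable_indicator) simp
  have eq2: "(\<Sum>n. (\<integral>\<^sup>+x. ennreal (?c n) * indicator (?B n) x \<partial>lborel)) = (\<Sum>n. ennreal (?c n) * emeasure lborel (?B n))"
    by (intro suminf_cong nn_integral_cmult_indicator) simp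
  have eq3: "(\<Sum>n. ennreal (?c n) * emeasure lborel (?B n)) = (\<Sum>n. ennreal (?V * 2 ^ ?N * (1 / 2) ^ n))"
  proof (intro suminf_cong)
    fix n :: nat
    have "?c n * (2 powr (real n + 1)) ^ ?N = 2 powr (real ?N - real n)"
      unfolding powr_nat_power[OF zero_less_numeral] powr_add[symmetric] by (simp add: algebra_simps)
    also have "\<dots> = 2 ^ ?N * (1 / 2) ^ n"
      by (simp add: powr_diff powr_realpow power_one_over)
    finally have "?c n * (?V * (2 powr (real n + 1)) ^ ?N) = ?V * 2 ^ ?N * (1 / 2) ^ n"
      by (simp add: mult_ac)
    then show "ennreal (?c n) * emeasure lborel (?B n) = ennreal (?V * 2 ^ ?N * (1 / 2) ^ n)"
      by (simp only: emeasure_cball powr_ge_zero ennreal_mult'[symmetric])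
  qed
  have "(\<Sum>n. ennreal (?V * 2 ^ ?N * (1 / 2) ^ n)) < \<infinity>"
  proof -
    have "summable (\<lambda>n. ?V * 2 ^ ?N * (1 / 2 :: real) ^ n)"
      by (intro summable_mult summable_geometric) simp
    then have "(\<Sum>n. ennreal (?V * 2 ^ ?N * (1 / 2) ^ n)) \<noteq> top"
      by (intro ennreal_suminf_neq_top) auto
    then show ?thesis by (simp add: less_top)
  qed
  with le show ?thesis unfolding eq1 eq2 eq3 by (rule order.strict_trans1)
qed

lemma power_le_fact_exp:
  assumes "(0 :: real) \<le> y"
  shows "y ^ m \<le> fact m * exp y"
proof -
  have "(\<Sum>n\<in>{m}. y ^ n /\<^sub>R fact n) \<le> (\<Sum>n. y ^ n /\<^sub>R fact n)"
    using assms by (intro sum_le_suminf summable_exp_generic) auto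
  then show ?thesis by (simp add: exp_def divide_simps mult.commute)
qed

text \<open>With \<open>m\<close> so large that q <= s m, the power is at most (r powr s)^m for r >=
  1, and a single term of the exponential series controls that.\<close>

lemma powr_exp_bounded:
  fixes q c s :: real
  assumes "c > 0" "s > 0"
  shows "\<exists>K>0. \<forall>r\<ge>1. r powr q * exp (- c * r powr s) \<le> K"
proof -
  define m where "m = nat \<lceil>q / s\<rceil>"
  have "q / s \<le> real m" unfolding m_def by linarith
  then have m: "q \<le> s * real m" using assms by (simp add: field_simps)
  have "r powr q * exp (- c * r powr s) \<le> fact m / c ^ m" if r: "r \<ge> 1" for r
  proof -
    have "r powr q \<le> r powr (s * real m)" using m r by (intro powr_mono) auto
    also have "\<dots> = (r powr s) ^ m" using r by (simp add: powr_powr flip: powr_realpow)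
    also have "c ^ m * (r powr s) ^ m \<le> fact m * exp (c * r powr s)"
      using power_le_fact_exp[of "c * r powr s" m] assms by (simp add: power_mult_distrib)
    then have "(r powr s) ^ m \<le> fact m / c ^ m * exp (c * r powr s)" using assms by (simp add: field_simps)
    finally show ?thesis by (simp add: exp_minus field_simps)
  qed
  then show ?thesis using assms by (intro exI[of _ "fact m / c ^ m"]) auto
qed

text \<open>The integrability test behind the finiteness claims for powers: an exponent above -N at
  the origin, and polynomial growth against exp (- c |x| powr s) at infinity. The majorant is glued
  from the two dyadic integrals along the unit sphere.\<close>

lemma integrable_powr_exp_bound:
  fixes g :: "'a::euclidean_space \<Rightarrow> real" and p c s C :: real
  assumes [measurable]: "g \<in> borel_measurable borel"
    and p: "0 < p + DIM('a)" and c: "c > 0" and s: "s > 0"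
    and bound: "\<And>x. x \<noteq> 0 \<Longrightarrow> \<bar>g x\<bar> \<le> C * norm x powr p * (1 + norm x) ^ n * exp (- c * norm x powr s)"
  shows "integrable lborel g"
proof -
  \<comment> \<open>\<open>nn_integral_norm_powr_cball\<close> takes a nonpositive exponent; for |x|
    <= 1, replacing a positive p by 0 only enlarges the power.\<close>
  define p0 where "p0 = min p 0"
  define G :: "'a \<Rightarrow> ennreal" where
    "G x = ennreal (norm x powr p0) * indicator (cball 0 1) x +
      ennreal (norm x powr (- real DIM('a) - 1)) * indicator (- cball 0 1) x" for x
  have m: "(\<lambda>x :: 'a. ennreal (norm x powr p0) * indicator (cball 0 1) x) \<in> borel_measurable lborel"
    "(\<lambda>x :: 'a. ennreal (norm x powr (- real DIM('a) - 1)) * indicator (- cball 0 1) x) \<in> borel_measurable lborel"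
    by (intro borel_measurable_times_ennreal borel_measurable_indicator; simp)+
  have [measurable]: "G \<in> borel_measurable lborel"
    unfolding G_def[abs_def] by (intro borel_measurable_add m)
  have p0: "p0 \<le> 0" "0 < p0 + DIM('a)" using p by (auto simp: p0_def min_def)
  have G_fin: "(\<integral>\<^sup>+x. G x \<partial>lborel) < \<infinity>"
    unfolding G_def nn_integral_add[OF m]
    using nn_integral_norm_powr_cball[OF p0] nn_integral_norm_powr_outside[where 'a = 'a]
    by (simp only: ennreal_add_less_top infinity_ennreal_def)
  \<comment> \<open>The exponent is p + n from the growth of g plus N + 1, so that exactly
    |x|^(-N-1) remains outside the ball.\<close>
  obtain K where K: "K > 0" "\<And>r. r \<ge> 1 \<Longrightarrow> r powr (p + n + DIM('a) + 1) * exp (- c * r powr s) \<le> K"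
    using powr_exp_bounded[OF c s] by blast
  define D where "D = \<bar>C\<bar> * 2 ^ n * (1 + K)"
  have "ennreal \<bar>g x\<bar> \<le> ennreal D * G x" if x: "x \<noteq> 0" for x
  proof -
    define r where "r = norm x"
    have r: "r > 0" using x by (simp add: r_def)
    have b: "\<bar>g x\<bar> \<le> \<bar>C\<bar> * (r powr p * (1 + r) ^ n * exp (- c * r powr s))"
      using order_trans[OF bound[OF x]] by (simp add: r_def mult_right_mono mult.assoc)
    show ?thesis
    proof (cases "r \<le> 1")
      case True
      have "r powr p * (1 + r) ^ n * exp (- c * r powr s) \<le> r powr p0 * 2 ^ n * (1 + K)"
      proof (intro mult_mono)
        show "r powr p \<le> r powr p0" using True r by (intro powr_mono') (auto simp: p0_def)
        show "(1 + r) ^ n \<le> 2 ^ n" using True r by (intro power_mono) auto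
        have "exp (- c * r powr s) \<le> 1" using c by simp
        then show "exp (- c * r powr s) \<le> 1 + K" using K(1) by linarith
      qed (use r in simp_all)
      then have "\<bar>g x\<bar> \<le> \<bar>C\<bar> * (r powr p0 * 2 ^ n * (1 + K))"
        by (intro order_trans[OF b mult_left_mono]) auto
      then have "\<bar>g x\<bar> \<le> D * r powr p0" unfolding D_def by (simp only: mult_ac)
      then show ?thesis using True K(1) by (simp add: G_def r_def[symmetric] ennreal_mult[symmetric] ennreal_leI D_def)
    next
      case False
      have "r powr p * (1 + r) ^ n * exp (- c * r powr s) \<le> r powr p * (2 * r) ^ n * exp (- c * r powr s)"
        using False by (intro mult_mono power_mono) auto
      also have "\<dots> = 2 ^ n * (r powr (p + n + DIM('a) + 1) * exp (- c * r powr s)) * r powr (- real DIM('a) - 1)"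
      proof -
        have "r powr (p + n + DIM('a) + 1) * r powr (- real DIM('a) - 1) = r powr p * r powr n"
          unfolding powr_add[symmetric] by simp
        then have "r powr (p + n + DIM('a) + 1) * r powr (- real DIM('a) - 1) = r powr p * r ^ n"
          using r by (simp add: powr_realpow)
        then show ?thesis by (simp add: power_mult_distrib mult_ac)
      qed
      also have "\<dots> \<le> 2 ^ n * (1 + K) * r powr (- real DIM('a) - 1)"
        using False K(2)[of r] K(1) by (intro mult_right_mono mult_left_mono) auto
      finally have "\<bar>g x\<bar> \<le> \<bar>C\<bar> * (2 ^ n * (1 + K) * r powr (- real DIM('a) - 1))"
        by (intro order_trans[OF b mult_left_mono]) auto
      then have "\<bar>g x\<bar> \<le> D * r powr (- real DIM('a) - 1)" unfolding D_def by (simp only: mult_ac)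
      then show ?thesis using False K(1) by (simp add: G_def r_def[symmetric] ennreal_mult[symmetric] ennreal_leI D_def)
    qed
  qed
  then have ae: "AE x in lborel. ennreal \<bar>g x\<bar> \<le> ennreal D * G x"
    using AE_lborel_singleton[of 0] by (auto elim: eventually_mono)
  have "(\<integral>\<^sup>+x. ennreal (norm (g x)) \<partial>lborel) \<le> (\<integral>\<^sup>+x. ennreal D * G x \<partial>lborel)"
    using ae by (intro nn_integral_mono_AE) simp
  also have "\<dots> = ennreal D * (\<integral>\<^sup>+x. G x \<partial>lborel)" by (rule nn_integral_cmult) measurable
  also have "\<dots> < \<infinity>" using G_fin by (simp add: ennreal_mult_less_top)
  finally show ?thesis by (intro integrableI_bounded) auto
qed

text \<open>Both densities, and what arises from them by multiplication with powers of |x|, have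
  this shape: \<open>mu\<close> is p = -2 b and \<open>nu\<close> is p = s - 2 - 2 b. As 0 powr p =
  0, the weight is 0 at the origin for every p.\<close>

definition wt :: "real \<Rightarrow> real \<Rightarrow> real ^ 'n \<Rightarrow> real" where
  "wt s p x = exp (- (2 / s) * norm x powr s) * norm x powr p"

lemma wt_nonneg [simp]: "0 \<le> wt s p x" by (simp add: wt_def)

lemma wt_pos: "x \<noteq> 0 \<Longrightarrow> 0 < wt s p x" by (simp add: wt_def)

lemma wt_zero [simp]: "wt s p 0 = 0" by (simp add: wt_def)

lemma wt_measurable [measurable]: "wt s p \<in> borel_measurable borel"
  unfolding wt_def[abs_def] by measurable

lemma wt_mult_powr: "wt s p x * norm x powr q = wt s (p + q) x"
  by (simp add: wt_def powr_add)

lemma wt_mult_power: "wt s p x * norm x ^ k = wt s (p + k) x"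
  by (cases "x = 0") (auto simp: wt_def powr_add powr_realpow)

lemma continuous_on_wt: "continuous_on (- {0}) (wt s p)"
  unfolding wt_def[abs_def] by (intro continuous_intros) auto

lemma GDERIV_norm_powr:
  fixes x :: "real ^ 'n"
  assumes "x \<noteq> 0"
  shows "GDERIV (\<lambda>x. norm x powr p) x :> (p * norm x powr (p - 2)) *\<^sub>R x"
proof -
  have "GDERIV (\<lambda>x. norm x powr p) x :> (p * norm x powr (p - 1)) *\<^sub>R sgn x"
    using assms by (intro GDERIV_DERIV_compose[OF GDERIV_norm] has_real_derivative_powr) auto
  moreover have "norm x powr (p - 1) / norm x = norm x powr (p - 2)"
    using assms powr_diff[of "norm x" "p - 1" 1] by simp
  ultimately show ?thesis by (simp add: sgn_div_norm divide_inverse mult.assoc)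
qed

lemma GDERIV_wt:
  fixes x :: "real ^ 'n"
  assumes "x \<noteq> 0" "s \<noteq> 0"
  shows "GDERIV (wt s p) x :> (p * wt s (p - 2) x - 2 * wt s (p + s - 2) x) *\<^sub>R x"
proof -
  let ?e = "exp (- (2 / s) * norm x powr s)"
  have "GDERIV (\<lambda>x. exp (- (2 / s) * norm x powr s)) x :> ?e *\<^sub>R (- (2 / s)) *\<^sub>R (s * norm x powr (s - 2)) *\<^sub>R x"
    by (intro GDERIV_DERIV_compose[OF GDERIV_cmult[OF GDERIV_norm_powr]] assms DERIV_exp)
  from GDERIV_mult[OF this GDERIV_norm_powr[OF assms(1)], of p]
  have "GDERIV (wt s p) x :> ?e *\<^sub>R (p * norm x powr (p - 2)) *\<^sub>R x +
     norm x powr p *\<^sub>R ?e *\<^sub>R (- (2 / s)) *\<^sub>R (s * norm x powr (s - 2)) *\<^sub>R x"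
    by (simp add: wt_def[abs_def])
  moreover have "\<dots> = (p * wt s (p - 2) x - 2 * wt s (p + s - 2) x) *\<^sub>R x"
  proof -
    have "norm x powr p * norm x powr (s - 2) = norm x powr (p + s - 2)"
      by (simp add: powr_add[symmetric] algebra_simps)
    then show ?thesis using assms(2) by (simp add: wt_def algebra_simps flip: scaleR_add_left scaleR_diff_left)
  qed
  ultimately show ?thesis by simp
qed

lemma mu_eq: "mu a b = density lborel (wt (1 + b - a) (- 2 * b))"
  by (simp add: mu_def wt_def[abs_def] powr_minus_divide)

lemma nu_eq: "(nu a b :: (real ^ 'n) measure) = density lborel (wt (1 + b - a) (- 1 - b - a))"
proof -
  have "norm x powr (- 1 - b - a) = 1 / norm x powr (1 + b + a)" for x :: "real ^ 'n"
    using powr_minus_divide[of "norm x" "1 + b + a"] by (simp add: algebra_simps)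
  then have "exp (- (2 * norm x powr (1 + b - a) / (1 + b - a))) / norm x powr (1 + b + a) =
    wt (1 + b - a) (- 1 - b - a) x" for x :: "real ^ 'n"
    unfolding wt_def by simp
  then show ?thesis unfolding nu_def by simp
qed

section \<open>Weighted forms and integration by parts\<close>

text \<open>Nothing is required at 0, where weights and eigenfunctions may be singular and where
  \<open>grad\<close> may be an unspecified value.\<close>

definition C1_off :: "(real ^ 'n \<Rightarrow> real) \<Rightarrow> bool" where
  "C1_off f \<longleftrightarrow> (\<forall>x. x \<noteq> 0 \<longrightarrow> f differentiable (at x)) \<and> continuous_on (- {0}) (grad f)"

lemma C1_offD: "C1_off f \<Longrightarrow> x \<noteq> 0 \<Longrightarrow> f differentiable (at x)" "C1_off f \<Longrightarrow> continuous_on (- {0}) (grad f)"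
  by (auto simp: C1_off_def)

lemma C1_off_GDERIV: "C1_off f \<Longrightarrow> x \<noteq> 0 \<Longrightarrow> GDERIV f x :> grad f x"
  by (intro GDERIV_grad C1_offD)

lemma C1_off_continuous: "C1_off f \<Longrightarrow> continuous_on (- {0}) f"
  by (auto simp: C1_off_def intro!: continuous_at_imp_continuous_on differentiable_imp_continuous_within)

lemma C1_offI:
  assumes "\<And>x. x \<noteq> 0 \<Longrightarrow> GDERIV f x :> D x" "continuous_on (- {0}) D"
  shows "C1_off f"
  unfolding C1_off_def
proof (intro conjI allI impI)
  show "f differentiable (at x)" if "x \<noteq> 0" for x using GDERIV_D(1)[OF assms(1)[OF that]] .
  have "continuous_on (- {0}) D \<longleftrightarrow> continuous_on (- {0}) (grad f)"
    using GDERIV_D(2)[OF assms(1)] by (intro continuous_on_cong) auto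
  with assms(2) show "continuous_on (- {0}) (grad f)" by simp
qed

lemma C1_off_mult:
  assumes "C1_off f" "C1_off g"
  shows "C1_off (\<lambda>x. f x * g x)"
  by (rule C1_offI[where D = "\<lambda>x. f x *\<^sub>R grad g x + g x *\<^sub>R grad f x"])
    (intro GDERIV_mult C1_off_GDERIV assms, assumption+,
     intro continuous_intros C1_off_continuous C1_offD(2) assms)

lemma C1_off_add:
  assumes "C1_off f" "C1_off g"
  shows "C1_off (\<lambda>x. f x + g x)"
  by (rule C1_offI[where D = "\<lambda>x. grad f x + grad g x"])
    (intro GDERIV_add C1_off_GDERIV assms, assumption+,
     intro continuous_intros C1_offD(2) assms)

lemma C1_off_const: "C1_off (\<lambda>x. c)"
  by (rule C1_offI[where D = "\<lambda>x. 0"]) (rule GDERIV_const, rule continuous_on_const)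

lemma C1_off_hom:
  assumes "hom k h"
  shows "C1_off h"
proof (rule C1_offI[where D = "grad h"])
  show "GDERIV h x :> grad h x" for x by (rule hom_GDERIV[OF assms])
  show "continuous_on (- {0}) (grad h)"
    unfolding continuous_on_componentwise[of _ "grad h"]
    by (intro ballI) (auto simp: Basis_vec_def inner_axis intro: hom_continuous_on[OF hom_grad[OF assms]])
qed

lemma C1_off_wt: "s \<noteq> 0 \<Longrightarrow> C1_off (wt s p)"
  by (rule C1_offI[OF GDERIV_wt]) (auto intro!: continuous_intros continuous_on_wt)

lemma C1_off_norm_powr: "C1_off (\<lambda>x. norm x powr p)"
  by (rule C1_offI[OF GDERIV_norm_powr]) (auto intro!: continuous_intros)

text \<open>One exceptional point does not affect Borel measurability, so an unspecified value of
  \<open>grad f\<close> at 0 is harmless.\<close>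

lemma C1_off_measurable:
  assumes "C1_off f"
  shows "f \<in> borel_measurable borel" "grad f \<in> borel_measurable borel"
  using assms borel_measurable_continuous_countable_exceptions[of "{0}"] C1_off_continuous C1_offD(2)
  by (metis countable_empty countable_insert)+

lemma integral_translate:
  fixes u :: "'a::euclidean_space \<Rightarrow> real"
  assumes "u \<in> borel_measurable borel"
  shows "(\<integral>x. u (h + x) \<partial>lborel) = (\<integral>x. u x \<partial>lborel)"
proof -
  have "(\<integral>x. u x \<partial>lborel) = (\<integral>x. u x \<partial>(distr lborel borel ((+) h)))" by (simp only: lborel_distr_plus)
  also have "\<dots> = (\<integral>x. u (h + x) \<partial>lborel)" using assms by (intro integral_distr) auto
  finally show ?thesis by simp
qed

lemma difference_quotient_limit:
  fixes u :: "real ^ 'n \<Rightarrow> real"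
  assumes "u differentiable (at x)"
  shows "(\<lambda>n. real (Suc n) * (u ((1 / real (Suc n)) *\<^sub>R e + x) - u x)) \<longlonglongrightarrow> e \<bullet> grad u x"
proof -
  have "(u has_derivative (\<lambda>h. h \<bullet> grad u x)) (at x)"
    using GDERIV_grad[OF assms] by (simp add: gderiv_def)
  then have "(u has_derivative (\<lambda>h. h \<bullet> grad u x)) (at ((\<lambda>t. t *\<^sub>R e + x) 0))" by simp
  moreover have "((\<lambda>t. t *\<^sub>R e + x) has_derivative (\<lambda>t. t *\<^sub>R e)) (at 0)"
    by (auto intro!: derivative_eq_intros)
  ultimately have "((\<lambda>t. u (t *\<^sub>R e + x)) has_derivative (\<lambda>t. (t *\<^sub>R e) \<bullet> grad u x)) (at 0)"
    by (rule has_derivative_compose[rotated])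
  then have "((\<lambda>t. u (t *\<^sub>R e + x)) has_real_derivative (e \<bullet> grad u x)) (at 0)"
    by (simp add: has_field_derivative_def mult.commute[of _ "e \<bullet> grad u x"] mult_commute_abs)
  then have lim: "((\<lambda>t. (u (t *\<^sub>R e + x) - u x) / t) \<longlongrightarrow> e \<bullet> grad u x) (at 0)"
    by (simp add: DERIV_def)
  have "filterlim (\<lambda>n. 1 / real (Suc n)) (at 0) sequentially"
    using LIMSEQ_inverse_real_of_nat by (auto simp: filterlim_at inverse_eq_divide)
  from filterlim_compose[OF lim this] show ?thesis by (simp add: mult.commute)
qed

lemma integrable_bounded_support:
  fixes u :: "'a::euclidean_space \<Rightarrow> real"
  assumes "u \<in> borel_measurable borel" "\<And>x. \<bar>u x\<bar> \<le> M" "\<And>x. norm x > R \<Longrightarrow> u x = 0"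
  shows "integrable lborel u"
proof (rule Bochner_Integration.integrable_bound)
  have "emeasure lborel (cball (0 :: 'a) R) < \<infinity>" by (rule emeasure_lborel_cball_finite)
  then show "integrable lborel (\<lambda>x :: 'a. M * indicator (cball 0 R) x)"
    by (intro integrable_mult_right integrable_real_indicator) auto
  show "AE x in lborel. norm (u x) \<le> norm (M * indicator (cball 0 R) x)"
  proof (rule AE_I2)
    fix x :: 'a
    show "norm (u x) \<le> norm (M * indicator (cball 0 R) x)"
      using assms(2)[of x] assms(3)[of x] by (cases "norm x > R") (auto simp: indicator_def)
  qed
qed (use assms in simp)

text \<open>Vanishing near 0 makes u continuously differentiable on the whole space. Its difference
  quotients integrate to 0 by translation invariance and are bounded by the Lipschitz constant on a
  fixed ball, so dominated convergence applies. This serves as the divergence theorem.\<close>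

lemma integral_partial_zero:
  fixes u :: "real ^ 'n \<Rightarrow> real"
  assumes C1: "C1_off u" and \<delta>: "0 < \<delta>"
    and supp: "\<And>x. norm x < \<delta> \<or> norm x > R \<Longrightarrow> u x = 0"
  shows "integrable lborel (\<lambda>x. grad u x $ i)" "(\<integral>x. grad u x $ i \<partial>lborel) = 0"
proof -
  define S where "S = {x :: real ^ 'n. norm x < \<delta> \<or> norm x > R}"
  have "open S" unfolding S_def by (intro open_Collect_disj open_Collect_less continuous_intros)
  have G0: "GDERIV u x :> 0" if "x \<in> S" for x
    by (rule GDERIV_cong_open[OF GDERIV_const[of 0] \<open>open S\<close> that]) (simp add: supp S_def)
  have G: "GDERIV u x :> grad u x" for x
  proof (cases "x = 0")
    case True
    then have "x \<in> S" using \<delta> by (simp add: S_def)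
    then have "GDERIV u x :> 0" by (rule G0)
    moreover from this have "grad u x = 0" by (rule GDERIV_D(2))
    ultimately show ?thesis by (simp only:)
  qed (rule C1_off_GDERIV[OF C1])
  have S0: "grad u x = 0" if "x \<in> S" for x using GDERIV_D(2)[OF G0[OF that]] .
  have cont: "continuous_on UNIV (grad u)"
  proof -
    have "continuous_on S (grad u) \<longleftrightarrow> continuous_on S (\<lambda>x. 0 :: real ^ 'n)"
      using S0 by (intro continuous_on_cong) auto
    then have "continuous_on S (grad u)" by simp
    then have "continuous_on (S \<union> - {0}) (grad u)"
      using C1_offD(2)[OF C1] \<open>open S\<close> by (intro continuous_on_open_Un) auto
    moreover have "S \<union> - {0} = UNIV" using \<delta> by (auto simp: S_def)
    ultimately show ?thesis by simp
  qed
  have "compact (grad u ` cball 0 R)"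
    using cont by (intro compact_continuous_image continuous_on_subset[OF cont]) auto
  then obtain M0 where M0: "\<And>x. x \<in> cball 0 R \<Longrightarrow> norm (grad u x) \<le> M0"
    using compact_imp_bounded bounded_iff by (metis image_eqI)
  define M where "M = max M0 0"
  have M: "norm (grad u x) \<le> M" for x
  proof (cases "norm x > R")
    case True
    then show ?thesis using S0[of x] by (simp add: S_def M_def)
  next
    case False
    then show ?thesis using M0[of x] by (simp add: M_def le_max_iff_disj)
  qed
  have lip: "\<bar>u y - u x\<bar> \<le> M * norm (y - x)" for x y
  proof -
    have "norm (u y - u x) \<le> M * norm (y - x)"
    proof (rule differentiable_bound[of UNIV u "\<lambda>x h. h \<bullet> grad u x"])
      show "(u has_derivative (\<lambda>h. h \<bullet> grad u x)) (at x within UNIV)" for x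
        using G[of x] by (simp add: gderiv_def)
      show "onorm (\<lambda>h. h \<bullet> grad u x) \<le> M" for x
      proof (rule onorm_bound)
        show "norm (h \<bullet> grad u x) \<le> M * norm h" for h
          using order_trans[OF Cauchy_Schwarz_ineq2[of h "grad u x"] mult_left_mono[OF M[of x] norm_ge_zero[of h]]]
          by (simp add: mult.commute)
      qed (simp add: M_def)
    qed auto
    then show ?thesis by simp
  qed
  have meas: "u \<in> borel_measurable borel" "grad u \<in> borel_measurable borel"
    using C1_off_measurable[OF C1] .
  define e :: "real ^ 'n" where "e = axis i 1"
  have ne: "norm e = 1" by (simp add: e_def)
  define D where "D n x = real (Suc n) * (u ((1 / real (Suc n)) *\<^sub>R e + x) - u x)" for n x
  have Dm: "D n \<in> borel_measurable borel" for n
    unfolding D_def[abs_def] using meas(1) by measurable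
  have Db: "\<bar>D n x\<bar> \<le> M" for n x
  proof -
    have "\<bar>u ((1 / real (Suc n)) *\<^sub>R e + x) - u x\<bar> \<le> M * (1 / real (Suc n))"
      using lip[of "(1 / real (Suc n)) *\<^sub>R e + x" x] ne by simp
    then have "real (Suc n) * \<bar>u ((1 / real (Suc n)) *\<^sub>R e + x) - u x\<bar> \<le> real (Suc n) * (M * (1 / real (Suc n)))"
      by (intro mult_left_mono) auto
    then show ?thesis by (simp add: D_def abs_mult del: of_nat_Suc)
  qed
  \<comment> \<open>The shift has length at most 1, hence the enlarged radius R + 1.\<close>
  have Ds: "D n x = 0" if "norm x > R + 1" for n x
  proof -
    have "norm x - norm ((1 / real (Suc n)) *\<^sub>R e) \<le> norm ((1 / real (Suc n)) *\<^sub>R e + x)"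
      using norm_diff_ineq[of x "(1 / real (Suc n)) *\<^sub>R e"] by (simp add: add.commute)
    moreover have "norm ((1 / real (Suc n)) *\<^sub>R e) \<le> 1" using ne by simp
    ultimately have "norm ((1 / real (Suc n)) *\<^sub>R e + x) > R" using that by linarith
    then show ?thesis using supp that by (simp add: D_def)
  qed
  have lim: "(\<lambda>n. D n x) \<longlonglongrightarrow> grad u x $ i" for x
    using difference_quotient_limit[OF GDERIV_D(1)[OF G[of x]], of e]
    by (simp add: D_def e_def inner_axis')
  have u_int: "integrable lborel u"
  proof (rule integrable_bounded_support[OF meas(1), where R = R and M = "M * (2 * \<bar>R\<bar> + 1)"])
    \<comment> \<open>A point where u vanishes; the Lipschitz estimate from there bounds u on the
      ball.\<close>
    obtain x0 :: "real ^ 'n" where x0: "norm x0 = \<bar>R\<bar> + 1" using vector_choose_size[of "\<bar>R\<bar> + 1"] by auto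
    show "\<bar>u x\<bar> \<le> M * (2 * \<bar>R\<bar> + 1)" for x
    proof (cases "norm x > R")
      case True
      then show ?thesis using supp by (simp add: M_def)
    next
      case False
      have "u x0 = 0" using x0 by (intro supp) linarith
      then have "\<bar>u x\<bar> \<le> M * norm (x - x0)" using lip[of x x0] by simp
      also have "norm (x - x0) \<le> 2 * \<bar>R\<bar> + 1" using norm_triangle_ineq4[of x x0] x0 False by linarith
      then have "M * norm (x - x0) \<le> M * (2 * \<bar>R\<bar> + 1)" by (intro mult_left_mono) (auto simp: M_def)
      finally show ?thesis .
    qed
  qed (simp add: supp)
  have D0: "(\<integral>x. D n x \<partial>lborel) = 0" for n
  proof -
    have "integrable lborel (\<lambda>x. u ((1 / real (Suc n)) *\<^sub>R e + x))"
      using u_int integrable_distr_eq[of "(+) ((1 / real (Suc n)) *\<^sub>R e)" lborel borel u] meas(1)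
      by (simp add: lborel_distr_plus)
    then show ?thesis
      unfolding D_def using u_int integral_translate[OF meas(1)] by simp
  qed
  define W where "W x = M * indicator (cball 0 (R + 1)) x" for x :: "real ^ 'n"
  have W_int: "integrable lborel W"
    unfolding W_def[abs_def]
    by (intro integrable_bounded_support[where M = M and R = "R + 1"]) (auto simp: indicator_def M_def)
  have dom: "norm (D n x) \<le> W x" for n x
    using Db[of n x] Ds[of x n] by (cases "norm x > R + 1") (auto simp: W_def indicator_def)
  have "(\<lambda>x. axis i 1 \<bullet> grad u x) \<in> borel_measurable borel" using meas(2) by measurable
  then have gm: "(\<lambda>x. grad u x $ i) \<in> borel_measurable lborel" by (simp add: inner_axis')
  have Dm': "D n \<in> borel_measurable lborel" for n using Dm by simp
  have l1: "(\<lambda>n. \<integral>x. D n x \<partial>lborel) \<longlonglongrightarrow> (\<integral>x. grad u x $ i \<partial>lborel)"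
    and l2: "integrable lborel (\<lambda>x. grad u x $ i)"
    using integral_dominated_convergence[OF gm Dm' W_int AE_I2[OF lim] AE_I2[OF dom]]
      integrable_dominated_convergence[OF gm Dm' W_int AE_I2[OF lim] AE_I2[OF dom]] by auto
  show "integrable lborel (\<lambda>x. grad u x $ i)" by (rule l2)
  show "(\<integral>x. grad u x $ i \<partial>lborel) = 0"
    using LIMSEQ_unique[OF l1] D0 by simp
qed

section \<open>Setting: the two measures, their forms and the admissible functions\<close>

locale ckn =
  fixes a b s \<gamma> :: real and T :: "'n::finite itself"
  assumes s_eq: "s = 1 + b - a" and \<gamma>_eq: "\<gamma> = real CARD('n) - 2 - 2 * b"
    and s_pos: "0 < s" and \<gamma>_nonneg: "0 \<le> \<gamma>"
begin

lemma mu_wt: "(mu a b :: (real ^ 'n) measure) = density lborel (wt s (- 2 * b))"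
  by (simp only: mu_eq s_eq)

lemma nu_wt: "(nu a b :: (real ^ 'n) measure) = density lborel (wt s (s - 2 - 2 * b))"
proof -
  have "s - 2 - 2 * b = - 1 - b - a" by (simp add: s_eq)
  then show ?thesis by (simp only: nu_eq s_eq)
qed

lemma integral_mu:
  fixes f :: "real ^ 'n \<Rightarrow> real"
  assumes "f \<in> borel_measurable borel"
  shows "(\<integral>x. f x \<partial>mu a b) = (\<integral>x. wt s (- 2 * b) x * f x \<partial>lborel)"
    "integrable (mu a b) f \<longleftrightarrow> integrable lborel (\<lambda>x. wt s (- 2 * b) x * f x)"
  unfolding mu_wt using assms by (simp_all add: integral_density integrable_density)

lemma integral_nu:
  fixes f :: "real ^ 'n \<Rightarrow> real"
  assumes "f \<in> borel_measurable borel"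
  shows "(\<integral>x. f x \<partial>nu a b) = (\<integral>x. wt s (s - 2 - 2 * b) x * f x \<partial>lborel)"
    "integrable (nu a b) f \<longleftrightarrow> integrable lborel (\<lambda>x. wt s (s - 2 - 2 * b) x * f x)"
  unfolding nu_wt using assms by (simp_all add: integral_density integrable_density)

lemma sets_space_mu_nu [simp]:
  "sets (mu a b :: (real ^ 'n) measure) = sets borel" "sets (nu a b :: (real ^ 'n) measure) = sets borel"
  "space (mu a b :: (real ^ 'n) measure) = UNIV" "space (nu a b :: (real ^ 'n) measure) = UNIV"
  by (simp_all add: mu_wt nu_wt)

lemma measurable_mu_nu [simp]:
  "borel_measurable (mu a b :: (real ^ 'n) measure) = borel_measurable borel"
  "borel_measurable (nu a b :: (real ^ 'n) measure) = borel_measurable borel"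
  by (auto intro!: measurable_cong_sets)

lemma AE_mu_nu_nonzero:
  "AE x in (mu a b :: (real ^ 'n) measure). x \<noteq> 0" "AE x in (nu a b :: (real ^ 'n) measure). x \<noteq> 0"
proof -
  have "AE x in density lborel (wt s p). (x :: real ^ 'n) \<noteq> 0" for p
    using AE_lborel_singleton[of "0 :: real ^ 'n"]
    by (subst AE_density) (auto elim: eventually_mono)
  then show "AE x in (mu a b :: (real ^ 'n) measure). x \<noteq> 0" "AE x in (nu a b :: (real ^ 'n) measure). x \<noteq> 0"
    by (simp_all only: mu_wt nu_wt)
qed

lemma integrable_wt:
  fixes g :: "real ^ 'n \<Rightarrow> real" and p q C :: real
  assumes [measurable]: "g \<in> borel_measurable borel"
    and pq: "0 < p + q + CARD('n)"
    and bound: "\<And>x. x \<noteq> 0 \<Longrightarrow> \<bar>g x\<bar> \<le> C * norm x powr q * (1 + norm x) ^ n"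
  shows "integrable lborel (\<lambda>x. wt s p x * g x)"
proof (rule integrable_powr_exp_bound[where p = "p + q" and c = "2 / s" and s = s and C = C and n = n])
  fix x :: "real ^ 'n"
  assume x: "x \<noteq> 0"
  have "\<bar>wt s p x * g x\<bar> = wt s p x * \<bar>g x\<bar>" by (simp add: abs_mult)
  also have "\<dots> \<le> wt s p x * (C * norm x powr q * (1 + norm x) ^ n)"
    by (intro mult_left_mono bound x) simp
  also have "\<dots> = C * norm x powr (p + q) * (1 + norm x) ^ n * exp (- (2 / s) * norm x powr s)"
    by (simp add: wt_def powr_add)
  finally show "\<bar>wt s p x * g x\<bar> \<le> C * norm x powr (p + q) * (1 + norm x) ^ n * exp (- (2 / s) * norm x powr s)" .
qed (use pq s_pos in auto)

text \<open>In the exponent count at the origin, -2 b + N is \<gamma> + 2 for \<open>mu\<close>, and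
  s - 2 - 2 b + N is \<gamma> + s for \<open>nu\<close>. With \<gamma> >= 0, bounded functions are
  therefore integrable for both measures.\<close>

lemma integrable_muI:
  fixes g :: "real ^ 'n \<Rightarrow> real" and q C :: real
  assumes "g \<in> borel_measurable borel" "0 < \<gamma> + 2 + q"
    and "\<And>x. x \<noteq> 0 \<Longrightarrow> \<bar>g x\<bar> \<le> C * norm x powr q * (1 + norm x) ^ n"
  shows "integrable (mu a b) g"
  using integrable_wt[OF assms(1) _ assms(3), of "- 2 * b"] assms(2) by (simp add: integral_mu(2)[OF assms(1)] \<gamma>_eq)

lemma integrable_nuI:
  fixes g :: "real ^ 'n \<Rightarrow> real" and q C :: real
  assumes "g \<in> borel_measurable borel" "0 < \<gamma> + s + q"
    and "\<And>x. x \<noteq> 0 \<Longrightarrow> \<bar>g x\<bar> \<le> C * norm x powr q * (1 + norm x) ^ n"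
  shows "integrable (nu a b) g"
  using integrable_wt[OF assms(1) _ assms(3), of "s - 2 - 2 * b"] assms(2) by (simp add: integral_nu(2)[OF assms(1)] \<gamma>_eq)

text \<open>
  A class of functions on which both forms are finite and integration by parts is valid. It contains the
  test functions and the eigenfunctions, which need not be differentiable at the origin.
\<close>

definition G :: "(real ^ 'n \<Rightarrow> real) set" where
  "G = {f. C1_off f \<and> (\<exists>C n. \<forall>x. x \<noteq> 0 \<longrightarrow> \<bar>f x\<bar> \<le> C * (1 + norm x) ^ n) \<and>
     integrable (mu a b) (\<lambda>x. (norm (grad f x))\<^sup>2)}"

text \<open>\<open>B\<close> is the Dirichlet form of \<open>mu\<close> and \<open>I\<close> the
  inner product of L2(\<open>nu\<close>), taken on functions rather than on classes; both are
  bilinear on \<open>G\<close>, where all the integrals exist.\<close>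

definition B :: "(real ^ 'n \<Rightarrow> real) \<Rightarrow> (real ^ 'n \<Rightarrow> real) \<Rightarrow> real" where
  "B f g = (\<integral>x. grad f x \<bullet> grad g x \<partial>mu a b)"

definition I :: "(real ^ 'n \<Rightarrow> real) \<Rightarrow> (real ^ 'n \<Rightarrow> real) \<Rightarrow> real" where
  "I f g = (\<integral>x. f x * g x \<partial>nu a b)"

lemma energy_eq_B: "energy a b f = B f f"
  by (simp add: energy_def B_def power2_norm_eq_inner)

lemma sqint_eq_I: "sqint a b f = I f f"
  by (simp add: sqint_def I_def power2_eq_square)

lemma G_C1: "f \<in> G \<Longrightarrow> C1_off f" by (simp add: G_def)

lemma G_bound:
  assumes "f \<in> G"
  obtains C n where "C \<ge> 0" "\<And>x. x \<noteq> 0 \<Longrightarrow> \<bar>f x\<bar> \<le> C * (1 + norm x) ^ n"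
proof -
  obtain C n where C: "\<And>x. x \<noteq> 0 \<Longrightarrow> \<bar>f x\<bar> \<le> C * (1 + norm x) ^ n" using assms by (auto simp: G_def)
  have "\<bar>f x\<bar> \<le> \<bar>C\<bar> * (1 + norm x) ^ n" if "x \<noteq> 0" for x
    using order_trans[OF C[OF that] mult_right_mono[OF abs_ge_self]] by simp
  then show ?thesis by (intro that[of "\<bar>C\<bar>" n]) auto
qed

lemma G_measurable:
  assumes "f \<in> G"
  shows "f \<in> borel_measurable borel" "grad f \<in> borel_measurable borel"
  using C1_off_measurable[OF G_C1[OF assms]] .

lemma G_integrable_B:
  assumes f: "f \<in> G" and g: "g \<in> G"
  shows "integrable (mu a b) (\<lambda>x. grad f x \<bullet> grad g x)"
proof (rule Bochner_Integration.integrable_bound)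
  show "integrable (mu a b) (\<lambda>x. (norm (grad f x))\<^sup>2 + (norm (grad g x))\<^sup>2)"
    using f g by (intro Bochner_Integration.integrable_add) (simp_all add: G_def)
  show "(\<lambda>x. grad f x \<bullet> grad g x) \<in> borel_measurable (mu a b)"
    using G_measurable(2)[OF f] G_measurable(2)[OF g] by simp
  show "AE x in mu a b. norm (grad f x \<bullet> grad g x) \<le> norm ((norm (grad f x))\<^sup>2 + (norm (grad g x))\<^sup>2)"
  proof (rule AE_I2)
    fix x
    have "\<bar>grad f x \<bullet> grad g x\<bar> \<le> norm (grad f x) * norm (grad g x)" by (rule Cauchy_Schwarz_ineq2)
    also have "\<dots> \<le> (norm (grad f x))\<^sup>2 + (norm (grad g x))\<^sup>2"
    proof -
      have "0 \<le> norm (grad f x) * norm (grad g x)" by simp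
      then show ?thesis using sum_squares_bound[of "norm (grad f x)" "norm (grad g x)"] by linarith
    qed
    finally show "norm (grad f x \<bullet> grad g x) \<le> norm ((norm (grad f x))\<^sup>2 + (norm (grad g x))\<^sup>2)" by simp
  qed
qed

lemma G_integrable_I:
  assumes f: "f \<in> G" and g: "g \<in> G"
  shows "integrable (nu a b) (\<lambda>x. f x * g x)"
proof -
  obtain C n where C: "C \<ge> 0" "\<And>x. x \<noteq> 0 \<Longrightarrow> \<bar>f x\<bar> \<le> C * (1 + norm x) ^ n" using G_bound[OF f] by blast
  obtain D m where D: "D \<ge> 0" "\<And>x. x \<noteq> 0 \<Longrightarrow> \<bar>g x\<bar> \<le> D * (1 + norm x) ^ m" using G_bound[OF g] by blast
  show ?thesis
  proof (rule integrable_nuI[where q = 0 and C = "C * D" and n = "n + m"])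
    show "(\<lambda>x. f x * g x) \<in> borel_measurable borel"
      using G_measurable(1)[OF f] G_measurable(1)[OF g] by simp
    show "0 < \<gamma> + s + 0" using s_pos \<gamma>_nonneg by simp
    show "\<bar>f x * g x\<bar> \<le> C * D * norm x powr 0 * (1 + norm x) ^ (n + m)" if "x \<noteq> 0" for x
    proof -
      have "\<bar>f x * g x\<bar> \<le> (C * (1 + norm x) ^ n) * (D * (1 + norm x) ^ m)"
        unfolding abs_mult using C D that by (intro mult_mono) auto
      then show ?thesis using that by (simp add: power_add mult_ac)
    qed
  qed
qed

lemma G_add:
  assumes f: "f \<in> G" and g: "g \<in> G"
  shows "(\<lambda>x. f x + g x) \<in> G"
proof -
  obtain C n where C: "C \<ge> 0" "\<And>x. x \<noteq> 0 \<Longrightarrow> \<bar>f x\<bar> \<le> C * (1 + norm x) ^ n" using G_bound[OF f] by blast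
  obtain D m where D: "D \<ge> 0" "\<And>x. x \<noteq> 0 \<Longrightarrow> \<bar>g x\<bar> \<le> D * (1 + norm x) ^ m" using G_bound[OF g] by blast
  have b: "\<bar>f x + g x\<bar> \<le> (C + D) * (1 + norm x) ^ (n + m)" if "x \<noteq> 0" for x
  proof -
    have "\<bar>f x + g x\<bar> \<le> C * (1 + norm x) ^ n + D * (1 + norm x) ^ m"
      using C(2)[OF that] D(2)[OF that] abs_triangle_ineq[of "f x" "g x"] by linarith
    also have "\<dots> \<le> C * (1 + norm x) ^ (n + m) + D * (1 + norm x) ^ (n + m)"
      using C(1) D(1) by (intro add_mono mult_left_mono power_increasing) auto
    finally show ?thesis by (simp add: distrib_right)
  qed
  have C1: "C1_off (\<lambda>x. f x + g x)" by (intro C1_off_add G_C1 f g)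
  have gr: "grad (\<lambda>x. f x + g x) x = grad f x + grad g x" if "x \<noteq> 0" for x
    using C1_offD(1)[OF G_C1[OF f] that] C1_offD(1)[OF G_C1[OF g] that] by (rule grad_add)
  have "integrable (mu a b) (\<lambda>x. (grad f x \<bullet> grad f x + grad g x \<bullet> grad g x) + 2 * (grad f x \<bullet> grad g x))"
    by (intro Bochner_Integration.integrable_add integrable_mult_right G_integrable_B f g)
  then have "integrable (mu a b) (\<lambda>x. (norm (grad f x + grad g x))\<^sup>2)"
    by (simp add: power2_norm_eq_inner inner_add_left inner_add_right inner_commute algebra_simps)
  moreover have "integrable (mu a b) (\<lambda>x. (norm (grad f x + grad g x))\<^sup>2) \<longleftrightarrow>
    integrable (mu a b) (\<lambda>x. (norm (grad (\<lambda>x. f x + g x) x))\<^sup>2)"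
  proof (rule integrable_cong_AE)
    show "AE x in mu a b. (norm (grad f x + grad g x))\<^sup>2 = (norm (grad (\<lambda>x. f x + g x) x))\<^sup>2"
      using AE_mu_nu_nonzero(1) by (rule eventually_mono) (simp add: gr)
  qed (use G_measurable(2)[OF f] G_measurable(2)[OF g] C1_off_measurable(2)[OF C1] in simp_all)
  ultimately show ?thesis using C1 b unfolding G_def by blast
qed

lemma G_cmult:
  assumes f: "f \<in> G"
  shows "(\<lambda>x. c * f x) \<in> G"
proof -
  obtain C n where C: "C \<ge> 0" "\<And>x. x \<noteq> 0 \<Longrightarrow> \<bar>f x\<bar> \<le> C * (1 + norm x) ^ n" using G_bound[OF f] by blast
  have b: "\<bar>c * f x\<bar> \<le> (\<bar>c\<bar> * C) * (1 + norm x) ^ n" if "x \<noteq> 0" for x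
    using mult_left_mono[OF C(2)[OF that] abs_ge_zero[of c]] by (simp add: abs_mult)
  have C1: "C1_off (\<lambda>x. c * f x)" by (intro C1_off_mult C1_off_const G_C1 f)
  have gr: "grad (\<lambda>x. c * f x) x = c *\<^sub>R grad f x" if "x \<noteq> 0" for x
    using C1_offD(1)[OF G_C1[OF f] that] by (rule grad_cmult)
  have "integrable (mu a b) (\<lambda>x. c\<^sup>2 * (norm (grad f x))\<^sup>2)"
    using f by (intro integrable_mult_right) (simp add: G_def)
  moreover have "integrable (mu a b) (\<lambda>x. c\<^sup>2 * (norm (grad f x))\<^sup>2) \<longleftrightarrow>
    integrable (mu a b) (\<lambda>x. (norm (grad (\<lambda>x. c * f x) x))\<^sup>2)"
  proof (rule integrable_cong_AE)
    show "AE x in mu a b. c\<^sup>2 * (norm (grad f x))\<^sup>2 = (norm (grad (\<lambda>x. c * f x) x))\<^sup>2"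
      using AE_mu_nu_nonzero(1) by (rule eventually_mono) (simp add: gr power_mult_distrib)
  qed (use G_measurable(2)[OF f] C1_off_measurable(2)[OF C1] in simp_all)
  ultimately show ?thesis using C1 b unfolding G_def by blast
qed

lemma G_const: "(\<lambda>x. c) \<in> G"
proof -
  have "\<exists>C n. \<forall>x :: real ^ 'n. x \<noteq> 0 \<longrightarrow> \<bar>c\<bar> \<le> C * (1 + norm x) ^ n"
    by (intro exI[of _ "\<bar>c\<bar>"] exI[of _ "0 :: nat"]) simp
  then show ?thesis unfolding G_def by (simp add: C1_off_const)
qed

lemma G_diff: "f \<in> G \<Longrightarrow> g \<in> G \<Longrightarrow> (\<lambda>x. f x - g x) \<in> G"
  using G_add[OF _ G_cmult[of g "-1"]] by simp

lemma G_sum: "(\<And>i. i \<in> J \<Longrightarrow> f i \<in> G) \<Longrightarrow> (\<lambda>x. \<Sum>i\<in>J. f i x) \<in> G"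
proof (induction J rule: infinite_finite_induct)
  case (insert i J)
  then show ?case using G_add[of "f i" "\<lambda>x. \<Sum>i\<in>J. f i x"] by simp
qed (simp_all add: G_const)

lemma I_commute: "I f g = I g f" by (simp add: I_def mult.commute)
lemma B_commute: "B f g = B g f" by (simp add: B_def inner_commute)

lemma I_add: "f \<in> G \<Longrightarrow> g \<in> G \<Longrightarrow> h \<in> G \<Longrightarrow> I (\<lambda>x. f x + g x) h = I f h + I g h"
  unfolding I_def distrib_right by (intro Bochner_Integration.integral_add G_integrable_I)

lemma I_cmult: "I (\<lambda>x. c * f x) h = c * I f h"
  unfolding I_def mult.assoc by (rule integral_mult_right_zero)

lemma I_diff: "f \<in> G \<Longrightarrow> g \<in> G \<Longrightarrow> h \<in> G \<Longrightarrow> I (\<lambda>x. f x - g x) h = I f h - I g h"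
  unfolding I_def left_diff_distrib by (intro Bochner_Integration.integral_diff G_integrable_I)

lemma I_sum:
  assumes "\<And>i. i \<in> J \<Longrightarrow> f i \<in> G" "h \<in> G"
  shows "I (\<lambda>x. \<Sum>i\<in>J. f i x) h = (\<Sum>i\<in>J. I (f i) h)"
  unfolding I_def sum_distrib_right using assms by (intro Bochner_Integration.integral_sum G_integrable_I)

lemma I_nonneg: "0 \<le> I f f"
  unfolding I_def by (rule integral_nonneg_AE) simp

lemma B_nonneg: "0 \<le> B f f"
  unfolding B_def by (rule integral_nonneg_AE) simp

lemma B_add:
  assumes f: "f \<in> G" and g: "g \<in> G" and h: "h \<in> G"
  shows "B (\<lambda>x. f x + g x) h = B f h + B g h"
proof -
  have "B (\<lambda>x. f x + g x) h = (\<integral>x. grad f x \<bullet> grad h x + grad g x \<bullet> grad h x \<partial>mu a b)"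
    unfolding B_def
  proof (rule integral_cong_AE)
    show "AE x in mu a b. grad (\<lambda>x. f x + g x) x \<bullet> grad h x = grad f x \<bullet> grad h x + grad g x \<bullet> grad h x"
      using AE_mu_nu_nonzero(1)
    proof (rule eventually_mono)
      fix x :: "real ^ 'n" assume "x \<noteq> 0"
      from grad_add[OF C1_offD(1)[OF G_C1[OF f] this] C1_offD(1)[OF G_C1[OF g] this]]
      show "grad (\<lambda>x. f x + g x) x \<bullet> grad h x = grad f x \<bullet> grad h x + grad g x \<bullet> grad h x"
        by (simp add: inner_add_left)
    qed
  qed (use G_measurable(2)[OF f] G_measurable(2)[OF g] G_measurable(2)[OF h] G_measurable(2)[OF G_add[OF f g]] in simp_all)
  also have "\<dots> = B f h + B g h"
    unfolding B_def by (intro Bochner_Integration.integral_add G_integrable_B f g h)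
  finally show ?thesis .
qed

lemma B_cmult:
  assumes f: "f \<in> G" and h: "h \<in> G"
  shows "B (\<lambda>x. c * f x) h = c * B f h"
proof -
  have "B (\<lambda>x. c * f x) h = (\<integral>x. c * (grad f x \<bullet> grad h x) \<partial>mu a b)"
    unfolding B_def
  proof (rule integral_cong_AE)
    show "AE x in mu a b. grad (\<lambda>x. c * f x) x \<bullet> grad h x = c * (grad f x \<bullet> grad h x)"
      using AE_mu_nu_nonzero(1)
    proof (rule eventually_mono)
      fix x :: "real ^ 'n" assume "x \<noteq> 0"
      from grad_cmult[OF C1_offD(1)[OF G_C1[OF f] this]]
      show "grad (\<lambda>x. c * f x) x \<bullet> grad h x = c * (grad f x \<bullet> grad h x)" by simp
    qed
  qed (use G_measurable(2)[OF f] G_measurable(2)[OF h] G_measurable(2)[OF G_cmult[OF f]] in simp_all)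
  then show ?thesis unfolding B_def by simp
qed

lemma B_diff: "f \<in> G \<Longrightarrow> g \<in> G \<Longrightarrow> h \<in> G \<Longrightarrow> B (\<lambda>x. f x - g x) h = B f h - B g h"
  using B_add[OF _ G_cmult[of g "-1"], of f h] B_cmult[of g h "-1"] by simp

lemma B_const: "B (\<lambda>x. c) h = 0"
  by (simp add: B_def)

lemma B_sum:
  assumes "\<And>i. i \<in> J \<Longrightarrow> f i \<in> G" "h \<in> G"
  shows "B (\<lambda>x. \<Sum>i\<in>J. f i x) h = (\<Sum>i\<in>J. B (f i) h)"
  using assms(1)
proof (induction J rule: infinite_finite_induct)
  case (insert i J)
  then show ?case using B_add[OF _ G_sum[of J f] assms(2), of "f i"] by simp
qed (simp_all add: B_const)

end

section \<open>Logarithmic cutoffs and powers times homogeneous polynomials\<close>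

lemma DERIV_max0_square: "((\<lambda>z. (max 0 z)\<^sup>2) has_real_derivative 2 * max 0 z) (at z)" for z :: real
proof -
  have "(\<lambda>w. ((max 0 w)\<^sup>2 - (max 0 z)\<^sup>2) / (w - z) - 2 * max 0 z) \<midarrow>z\<rightarrow> 0"
  proof (rule Lim_null_comparison)
    show "\<forall>\<^sub>F w in at z. norm (((max 0 w)\<^sup>2 - (max 0 z)\<^sup>2) / (w - z) - 2 * max 0 z) \<le> \<bar>w - z\<bar>"
      unfolding eventually_at_filter
    proof (intro always_eventually allI impI)
      fix w :: real
      assume w: "w \<noteq> z"
      \<comment> \<open>The remainder is quadratic: it equals (w - z)^2 for two nonnegative
        arguments and never exceeds this otherwise.\<close>
      have "\<bar>((max 0 w)\<^sup>2 - (max 0 z)\<^sup>2) - 2 * max 0 z * (w - z)\<bar> \<le> (w - z)\<^sup>2"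
      proof (cases "0 \<le> w"; cases "0 \<le> z")
        assume wz: "0 \<le> w" "\<not> 0 \<le> z"
        then have "w\<^sup>2 \<le> (w - z)\<^sup>2" by (intro power_mono) auto
        then show ?thesis using wz by (simp add: max_def)
      next
        assume wz: "\<not> 0 \<le> w" "0 \<le> z"
        have "\<bar>- z\<^sup>2 - 2 * z * (w - z)\<bar> = \<bar>z * z - 2 * z * w\<bar>"
          by (simp add: power2_eq_square algebra_simps)
        also have "\<dots> = z * z - 2 * z * w"
        proof (rule abs_of_nonneg)
          have "z * w \<le> 0" using wz by (intro mult_nonneg_nonpos) auto
          then show "0 \<le> z * z - 2 * z * w" using zero_le_square[of z] by linarith
        qed
        also have "\<dots> \<le> (w - z)\<^sup>2" by (simp add: power2_eq_square algebra_simps)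
        finally show ?thesis using wz by (simp add: max_def)
      next
        assume wz: "0 \<le> w" "0 \<le> z"
        have "w\<^sup>2 - z\<^sup>2 - 2 * z * (w - z) = (w - z)\<^sup>2" by (simp add: power2_eq_square algebra_simps)
        then show ?thesis using wz by (simp add: max_def)
      next
        assume "\<not> 0 \<le> w" "\<not> 0 \<le> z"
        then show ?thesis by (simp add: max_def)
      qed
      then have "\<bar>((max 0 w)\<^sup>2 - (max 0 z)\<^sup>2) - 2 * max 0 z * (w - z)\<bar> / \<bar>w - z\<bar> \<le> (w - z)\<^sup>2 / \<bar>w - z\<bar>"
        by (intro divide_right_mono) auto
      moreover have "(w - z)\<^sup>2 = \<bar>w - z\<bar> * \<bar>w - z\<bar>" by (simp add: power2_eq_square)
      then have "(w - z)\<^sup>2 / \<bar>w - z\<bar> = \<bar>w - z\<bar>"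
        using w nonzero_mult_div_cancel_right[of "\<bar>w - z\<bar>" "\<bar>w - z\<bar>"] by (simp only:)
      moreover have "((max 0 w)\<^sup>2 - (max 0 z)\<^sup>2) / (w - z) - 2 * max 0 z =
        (((max 0 w)\<^sup>2 - (max 0 z)\<^sup>2) - 2 * max 0 z * (w - z)) / (w - z)"
        using w by (simp add: divide_simps)
      ultimately show "norm (((max 0 w)\<^sup>2 - (max 0 z)\<^sup>2) / (w - z) - 2 * max 0 z) \<le> \<bar>w - z\<bar>"
        by (simp add: abs_divide)
    qed
    show "(\<lambda>w. \<bar>w - z\<bar>) \<midarrow>z\<rightarrow> 0" by (auto intro!: tendsto_eq_intros)
  qed
  then show ?thesis unfolding has_field_derivative_iff by (rule LIM_zero_cancel)
qed

text \<open>
  Composed with \<open>ln |x| / n\<close>, this gives cutoffs near 0 and infinity whose gradient is \<open>O(1 / (n |x|))\<close>, just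
  good enough for the critical weight \<open>\<gamma> = 0\<close>.
\<close>

definition bump :: "real \<Rightarrow> real" where "bump y = (max 0 (1 - y\<^sup>2))\<^sup>2"
definition bump' :: "real \<Rightarrow> real" where "bump' y = - 4 * y * max 0 (1 - y\<^sup>2)"

lemma DERIV_bump: "(bump has_real_derivative bump' y) (at y)"
proof -
  have "((\<lambda>y. 1 - y\<^sup>2) has_real_derivative - 2 * y) (at y)"
    by (auto intro!: derivative_eq_intros)
  from DERIV_chain2[OF DERIV_max0_square this] show ?thesis
    by (simp add: bump_def[abs_def] bump'_def mult_ac)
qed

lemma bump_bounds: "0 \<le> bump y" "bump y \<le> 1" "\<bar>bump' y\<bar> \<le> 4" "1 \<le> \<bar>y\<bar> \<Longrightarrow> bump y = 0" "bump 0 = 1"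
proof -
  have m: "0 \<le> max 0 (1 - y\<^sup>2)" "max 0 (1 - y\<^sup>2) \<le> 1" by auto
  show "0 \<le> bump y" by (simp add: bump_def)
  show "bump y \<le> 1" using m by (simp add: bump_def power_le_one)
  show z: "bump y = 0" if "1 \<le> \<bar>y\<bar>" for y
    using that abs_square_le_1[of y] one_le_power[OF that, of 2] by (simp add: bump_def)
  show "\<bar>bump' y\<bar> \<le> 4"
  proof (cases "1 \<le> \<bar>y\<bar>")
    case True
    then have "bump y = 0" by (rule z)
    then show ?thesis by (simp add: bump_def bump'_def)
  next
    case False
    have "\<bar>y\<bar> * max 0 (1 - y\<^sup>2) \<le> 1 * 1" using False m by (intro mult_mono) auto
    then show ?thesis using m by (simp add: bump'_def abs_mult)
  qed
  show "bump 0 = 1" by (simp add: bump_def)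
qed

lemma continuous_bump': "continuous_on S bump'"
  unfolding bump'_def[abs_def] by (intro continuous_intros)

definition psi :: "real \<Rightarrow> (real ^ 'n \<Rightarrow> real) \<Rightarrow> real ^ 'n \<Rightarrow> real" where
  "psi \<alpha> h x = norm x powr \<alpha> * h x"

lemma C1_off_psi: "hom k h \<Longrightarrow> C1_off (psi \<alpha> h)"
  unfolding psi_def[abs_def] by (intro C1_off_mult C1_off_norm_powr C1_off_hom)

lemma grad_psi:
  assumes "hom k h" "x \<noteq> 0"
  shows "grad (psi \<alpha> h) x = norm x powr \<alpha> *\<^sub>R grad h x + (\<alpha> * norm x powr (\<alpha> - 2) * h x) *\<^sub>R x"
  using GDERIV_D(2)[OF GDERIV_mult[OF GDERIV_norm_powr[OF assms(2), of \<alpha>] hom_GDERIV[OF assms(1)]]]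
  by (simp add: psi_def[abs_def] mult_ac)

lemma grad_psi_Euler:
  assumes "hom k h" "x \<noteq> 0"
  shows "x \<bullet> grad (psi \<alpha> h) x = (\<alpha> + k) * psi \<alpha> h x"
proof -
  have "norm x powr (\<alpha> - 2) * (x \<bullet> x) = norm x powr \<alpha>"
    using assms(2) by (simp add: powr_diff dot_square_norm powr_numeral)
  then have "\<alpha> * norm x powr (\<alpha> - 2) * h x * (x \<bullet> x) = \<alpha> * h x * norm x powr \<alpha>"
    by (simp add: mult_ac)
  then show ?thesis
    by (simp add: grad_psi[OF assms] inner_add_right hom_Euler[OF assms(1)] psi_def algebra_simps)
qed

lemma psi_bound:
  fixes h :: "real ^ 'n \<Rightarrow> real"
  assumes "hom k h"
  obtains C where "C \<ge> 0" "\<And>x. x \<noteq> 0 \<Longrightarrow> \<bar>psi \<alpha> h x\<bar> \<le> C * norm x powr (\<alpha> + k)"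
proof -
  obtain C where C: "C \<ge> 0" "\<And>x. \<bar>h x\<bar> \<le> C * norm x ^ k" using hom_bound[OF assms] by auto
  have "\<bar>psi \<alpha> h x\<bar> \<le> C * norm x powr (\<alpha> + k)" if "x \<noteq> 0" for x
  proof -
    have "\<bar>psi \<alpha> h x\<bar> = norm x powr \<alpha> * \<bar>h x\<bar>" by (simp add: psi_def abs_mult)
    also have "\<dots> \<le> norm x powr \<alpha> * (C * norm x ^ k)" using C(2) by (intro mult_left_mono) auto
    also have "\<dots> = C * norm x powr (\<alpha> + k)" using that by (simp add: powr_add powr_realpow)
    finally show ?thesis .
  qed
  with C(1) show ?thesis by (rule that)
qed

lemma hom_grad_bound:
  fixes h :: "real ^ 'n \<Rightarrow> real"
  assumes "hom k h"
  obtains C where "C \<ge> 0" "\<And>x. x \<noteq> 0 \<Longrightarrow> norm (grad h x) \<le> C * norm x powr (real k - 1)"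
proof (cases "k = 0")
  case True
  then obtain c where "h = (\<lambda>x. c)" using hom_0D assms by blast
  then show ?thesis by (intro that[of 0]) auto
next
  case False
  have "\<exists>C\<ge>0. \<forall>x. \<bar>grad h x $ i\<bar> \<le> C * norm x ^ (k - 1)" for i
    by (rule hom_bound[OF hom_grad[OF assms]])
  then obtain C where C: "\<And>i. C i \<ge> 0" "\<And>i x. \<bar>grad h x $ i\<bar> \<le> C i * norm x ^ (k - 1)" by metis
  have "norm (grad h x) \<le> (\<Sum>i\<in>UNIV. C i) * norm x powr (real k - 1)" if "x \<noteq> 0" for x
  proof -
    have "norm (grad h x) \<le> (\<Sum>i\<in>UNIV. \<bar>grad h x $ i\<bar>)" by (rule norm_le_l1_cart)
    also have "\<dots> \<le> (\<Sum>i\<in>UNIV. C i * norm x ^ (k - 1))" using C(2) by (intro sum_mono)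
    also have "\<dots> = (\<Sum>i\<in>UNIV. C i) * norm x ^ (k - 1)" by (simp add: sum_distrib_right)
    also have "norm x ^ (k - 1) = norm x powr (real k - 1)"
      using that False by (simp add: powr_realpow[symmetric] of_nat_diff)
    finally show ?thesis .
  qed
  then show ?thesis using C(1) by (intro that[of "\<Sum>i\<in>UNIV. C i"]) (auto intro: sum_nonneg)
qed

lemma grad_psi_bound:
  fixes h :: "real ^ 'n \<Rightarrow> real"
  assumes "hom k h"
  obtains C where "C \<ge> 0" "\<And>x. x \<noteq> 0 \<Longrightarrow> norm (grad (psi \<alpha> h) x) \<le> C * norm x powr (\<alpha> + k - 1)"
proof -
  obtain C where C: "C \<ge> 0" "\<And>x. x \<noteq> 0 \<Longrightarrow> norm (grad h x) \<le> C * norm x powr (real k - 1)"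
    using hom_grad_bound[OF assms] by blast
  obtain D where D: "D \<ge> 0" "\<And>x. \<bar>h x\<bar> \<le> D * norm x ^ k" using hom_bound[OF assms] by auto
  have "norm (grad (psi \<alpha> h) x) \<le> (C + \<bar>\<alpha>\<bar> * D) * norm x powr (\<alpha> + k - 1)" if x: "x \<noteq> 0" for x
  proof -
    have "norm (grad (psi \<alpha> h) x) \<le> norm x powr \<alpha> * norm (grad h x) + \<bar>\<alpha>\<bar> * norm x powr (\<alpha> - 2) * \<bar>h x\<bar> * norm x"
      unfolding grad_psi[OF assms x] by (rule order_trans[OF norm_triangle_ineq]) (simp add: abs_mult)
    also have "\<dots> \<le> norm x powr \<alpha> * (C * norm x powr (real k - 1)) + \<bar>\<alpha>\<bar> * norm x powr (\<alpha> - 2) * (D * norm x ^ k) * norm x"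
      using C(2)[OF x] D(2)[of x] by (intro add_mono mult_left_mono mult_right_mono) auto
    also have "norm x powr \<alpha> * (C * norm x powr (real k - 1)) = C * norm x powr (\<alpha> + k - 1)"
      by (simp add: powr_add[symmetric] algebra_simps)
    also have "\<bar>\<alpha>\<bar> * norm x powr (\<alpha> - 2) * (D * norm x ^ k) * norm x = \<bar>\<alpha>\<bar> * D * norm x powr (\<alpha> + k - 1)"
    proof -
      have "norm x powr (\<alpha> - 2) * norm x ^ k * norm x = norm x powr (\<alpha> - 2) * norm x powr real k * norm x powr 1"
        using x by (simp add: powr_realpow)
      also have "\<dots> = norm x powr (\<alpha> + k - 1)"
        unfolding powr_add[symmetric] by (simp add: algebra_simps)
      finally show ?thesis by (simp add: mult_ac)
    qed
    finally show ?thesis by (simp add: distrib_right)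
  qed
  then show ?thesis using C(1) D(1) by (intro that[of "C + \<bar>\<alpha>\<bar> * D"]) auto
qed

lemma psi_cmult: "psi \<alpha> (\<lambda>x. c * f x) = (\<lambda>x. c * psi \<alpha> f x)"
  by (simp add: psi_def fun_eq_iff)

section \<open>Integration by parts against powers times harmonic polynomials\<close>

context ckn
begin

text \<open>The gradient is O(|x|^(m-1)) with m = \<alpha> + k, so its square is integrable at the
  origin once \<gamma> + 2 m > 0; as \<gamma> may be 0, this is where m > 0 enters.\<close>

lemma psi_G:
  fixes h :: "real ^ 'n \<Rightarrow> real" and \<alpha> :: real
  assumes h: "hom k h" and m: "0 < \<alpha> + k"
  shows "psi \<alpha> h \<in> G"
proof -
  obtain C where C: "C \<ge> 0" "\<And>x. x \<noteq> 0 \<Longrightarrow> \<bar>psi \<alpha> h x\<bar> \<le> C * norm x powr (\<alpha> + k)"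
    using psi_bound[OF h, of \<alpha>] by blast
  obtain D where D: "D \<ge> 0" "\<And>x. x \<noteq> 0 \<Longrightarrow> norm (grad (psi \<alpha> h) x) \<le> D * norm x powr (\<alpha> + k - 1)"
    using grad_psi_bound[OF h, of \<alpha>] by blast
  define n where "n = nat \<lceil>\<alpha> + k\<rceil>"
  have n: "\<alpha> + k \<le> real n" unfolding n_def by linarith
  have 1: "\<bar>psi \<alpha> h x\<bar> \<le> C * (1 + norm x) ^ n" if "x \<noteq> 0" for x
  proof -
    have "norm x powr (\<alpha> + k) \<le> (1 + norm x) powr (\<alpha> + k)" using m by (intro powr_mono2) auto
    also have "\<dots> \<le> (1 + norm x) powr real n" using n by (intro powr_mono) auto
    also have "\<dots> = (1 + norm x) ^ n" by (intro powr_realpow) (simp add: add_pos_nonneg)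
    finally show ?thesis using C that by (meson mult_left_mono order_trans)
  qed
  have meas: "(\<lambda>x. (norm (grad (psi \<alpha> h) x))\<^sup>2) \<in> borel_measurable borel"
    using C1_off_measurable(2)[OF C1_off_psi[OF h, of \<alpha>]] by measurable
  have 2: "integrable (mu a b) (\<lambda>x. (norm (grad (psi \<alpha> h) x))\<^sup>2)"
  proof (rule integrable_muI[OF meas, where q = "2 * (\<alpha> + k - 1)" and C = "D\<^sup>2" and n = 0])
    show "0 < \<gamma> + 2 + 2 * (\<alpha> + k - 1)" using m \<gamma>_nonneg by simp
    show "\<bar>(norm (grad (psi \<alpha> h) x))\<^sup>2\<bar> \<le> D\<^sup>2 * norm x powr (2 * (\<alpha> + k - 1)) * (1 + norm x) ^ 0"
      if "x \<noteq> 0" for x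
    proof -
      have "(norm (grad (psi \<alpha> h) x))\<^sup>2 \<le> (D * norm x powr (\<alpha> + k - 1))\<^sup>2"
        using D(2)[OF that] by (intro power_mono) auto
      also have "\<dots> = D\<^sup>2 * norm x powr (2 * (\<alpha> + k - 1))"
        using powr_nat_power[of "norm x" "\<alpha> + k - 1" 2] that by (simp add: power_mult_distrib mult.commute)
      finally show ?thesis by simp
    qed
  qed
  show ?thesis unfolding G_def using C1_off_psi[OF h, of \<alpha>] 1 2 by blast
qed

text \<open>The field is \<open>wt s (- 2 * b)\<close> times the gradient of
  \<open>psi \<alpha> h\<close>, multiplied out into weights and polynomials. Harmonicity of h
  removes the term with \<open>lap h\<close>. The coefficient m^2 + \<gamma> m - k (k + N - 2) is
  the indicial polynomial at the origin, whose nonnegative root will be \<open>mk k\<close>.\<close>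

lemma divergence_formula:
  fixes h :: "real ^ 'n \<Rightarrow> real" and \<alpha> :: real
  assumes h: "harm k h" and x: "x \<noteq> 0"
  defines "m \<equiv> \<alpha> + k"
  defines "q \<equiv> \<alpha> - 2 * b"
  shows "\<And>i. C1_off (\<lambda>x. \<alpha> * (wt s (q - 2) x * (h x * (axis i 1 \<bullet> x))) + wt s q x * grad h x $ i)"
    "(\<Sum>i\<in>UNIV. grad (\<lambda>x. \<alpha> * (wt s (q - 2) x * (h x * (axis i 1 \<bullet> x))) + wt s q x * grad h x $ i) x $ i) =
     ((m\<^sup>2 + \<gamma> * m - k * (k + real CARD('n) - 2)) * wt s (q - 2) x - 2 * m * wt s (q + s - 2) x) * h x"
proof -
  have hh: "hom k h" and lap: "lap h x = 0" using h by (auto simp: harm_def)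
  have s0: "s \<noteq> 0" using s_pos by simp
  show "C1_off (\<lambda>x. \<alpha> * (wt s (q - 2) x * (h x * (axis i 1 \<bullet> x))) + wt s q x * grad h x $ i)" for i
    by (intro C1_off_add C1_off_mult C1_off_const C1_off_wt s0 C1_off_hom[OF hh] C1_off_hom[OF hom_linear]
        C1_off_hom[OF hom_grad[OF hh]])
  \<comment> \<open>\<open>P\<close> and \<open>P'\<close> are the radial coefficients in the
    gradients of \<open>wt s (q - 2)\<close> and \<open>wt s q\<close>.\<close>
  define P where "P = (q - 2) * wt s (q - 2 - 2) x - 2 * wt s (q - 2 + s - 2) x"
  define P' where "P' = q * wt s (q - 2) x - 2 * wt s (q + s - 2) x"
  have Pr: "P * (norm x)\<^sup>2 = (q - 2) * wt s (q - 2) x - 2 * wt s (q + s - 2) x"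
    using wt_mult_power[of s "q - 2 - 2" x 2] wt_mult_power[of s "q - 2 + s - 2" x 2]
    by (simp add: P_def left_diff_distrib mult.assoc add.commute diff_add_eq)
  have c: "grad (\<lambda>x. \<alpha> * (wt s (q - 2) x * (h x * (axis i 1 \<bullet> x))) + wt s q x * grad h x $ i) x $ i =
    \<alpha> * (wt s (q - 2) x * (h x + x $ i * grad h x $ i) + P * h x * (x $ i * x $ i)) +
    (wt s q x * grad (\<lambda>x. grad h x $ i) x $ i + P' * (x $ i * grad h x $ i))" for i
  proof -
    have "grad (\<lambda>x. \<alpha> * (wt s (q - 2) x * (h x * (axis i 1 \<bullet> x))) + wt s q x * grad h x $ i) x =
      \<alpha> *\<^sub>R (wt s (q - 2) x *\<^sub>R (h x *\<^sub>R axis i 1 + (axis i 1 \<bullet> x) *\<^sub>R grad h x) + (h x * (axis i 1 \<bullet> x)) *\<^sub>R (P *\<^sub>R x)) +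
      (wt s q x *\<^sub>R grad (\<lambda>x. grad h x $ i) x + (grad h x $ i) *\<^sub>R (P' *\<^sub>R x))"
      unfolding P_def P'_def
      by (intro GDERIV_D(2) GDERIV_add GDERIV_cmult GDERIV_mult GDERIV_wt x s0 hom_GDERIV[OF hh] GDERIV_inner_left
          hom_GDERIV[OF hom_grad[OF hh]])
    then show ?thesis by (simp add: inner_axis' algebra_simps)
  qed
  have sx: "(\<Sum>i\<in>UNIV. x $ i * grad h x $ i) = k * h x"
    using hom_Euler[OF hh, of x] by (simp add: inner_vec_def)
  have "(\<Sum>i\<in>UNIV. grad (\<lambda>x. \<alpha> * (wt s (q - 2) x * (h x * (axis i 1 \<bullet> x))) + wt s q x * grad h x $ i) x $ i) =
    \<alpha> * (wt s (q - 2) x * (CARD('n) * h x + k * h x) + P * h x * (norm x)\<^sup>2) +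
    (wt s q x * lap h x + P' * (k * h x))"
    unfolding c sum.distrib sum_distrib_left[symmetric] sx sum_square_component lap_def by simp
  also have "\<dots> = \<alpha> * (wt s (q - 2) x * (CARD('n) * h x + k * h x) + (P * (norm x)\<^sup>2) * h x) + P' * (k * h x)"
    by (simp add: lap)
  also have "\<dots> = ((m\<^sup>2 + \<gamma> * m - k * (k + real CARD('n) - 2)) * wt s (q - 2) x - 2 * m * wt s (q + s - 2) x) * h x"
    unfolding Pr P'_def m_def \<gamma>_eq
    by (simp add: q_def power2_eq_square algebra_simps)
  finally show "(\<Sum>i\<in>UNIV. grad (\<lambda>x. \<alpha> * (wt s (q - 2) x * (h x * (axis i 1 \<bullet> x))) + wt s q x * grad h x $ i) x $ i) =
     ((m\<^sup>2 + \<gamma> * m - k * (k + real CARD('n) - 2)) * wt s (q - 2) x - 2 * m * wt s (q + s - 2) x) * h x" .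
qed

text \<open>The divergence theorem for g times the weighted gradient of
  \<open>psi \<alpha> h\<close>. Because g vanishes near 0 and near infinity, no boundary terms
  arise; the identity stays under one integral sign, so that integrability of the separate terms is
  not at issue yet.\<close>

lemma weak_form_compact:
  fixes g h :: "real ^ 'n \<Rightarrow> real" and \<alpha> :: real
  assumes h: "harm k h" and g: "C1_off g"
    and \<delta>: "0 < \<delta>" and supp: "\<And>x. x \<noteq> 0 \<Longrightarrow> norm x < \<delta> \<or> norm x > R \<Longrightarrow> g x = 0"
  defines "m \<equiv> \<alpha> + k"
  defines "\<beta> \<equiv> m\<^sup>2 + \<gamma> * m - k * (k + real CARD('n) - 2)"
  shows "(\<integral>x. wt s (- 2 * b) x * (grad g x \<bullet> grad (psi \<alpha> h) x) +
      (\<beta> * wt s (- 2 * b - 2) x - 2 * m * wt s (s - 2 - 2 * b) x) * (g x * psi \<alpha> h x) \<partial>lborel) = 0"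
proof -
  have hh: "hom k h" using h by (simp add: harm_def)
  define q where "q = \<alpha> - 2 * b"
  define Q where "Q i x = \<alpha> * (wt s (q - 2) x * (h x * (axis i 1 \<bullet> x))) + wt s q x * grad h x $ i" for i x
  define u where "u i x = g x * Q i x" for i x
  have CQ: "C1_off (Q i)" for i
    using divergence_formula(1)[OF h, of "axis undefined 1" \<alpha> i] by (simp add: Q_def[abs_def] q_def)
  have Cu: "C1_off (u i)" for i unfolding u_def[abs_def] by (intro C1_off_mult g CQ)
  \<comment> \<open>At the origin g may be nonzero, but the weights inside \<open>Q\<close> are 0
    there.\<close>
  have us: "u i x = 0" if "norm x < \<delta> \<or> norm x > R" for i x
    using supp[OF _ that] by (cases "x = 0") (auto simp: u_def Q_def)
  have "(\<integral>x. (\<Sum>i\<in>UNIV. grad (u i) x $ i) \<partial>lborel) = (\<Sum>i\<in>UNIV. \<integral>x. grad (u i) x $ i \<partial>lborel)"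
    by (intro Bochner_Integration.integral_sum integral_partial_zero(1)[OF Cu \<delta> us])
  also have "\<dots> = 0" using integral_partial_zero(2)[OF Cu \<delta> us] by simp
  finally have zero: "(\<integral>x. (\<Sum>i\<in>UNIV. grad (u i) x $ i) \<partial>lborel) = 0" .
  have eq: "(\<Sum>i\<in>UNIV. grad (u i) x $ i) = wt s (- 2 * b) x * (grad g x \<bullet> grad (psi \<alpha> h) x) +
      (\<beta> * wt s (- 2 * b - 2) x - 2 * m * wt s (s - 2 - 2 * b) x) * (g x * psi \<alpha> h x)" if x: "x \<noteq> 0" for x
  proof -
    have "grad (u i) x $ i = g x * grad (Q i) x $ i + Q i x * grad g x $ i" for i
      unfolding u_def[abs_def] using grad_mult[OF C1_offD(1)[OF g x] C1_offD(1)[OF CQ x]] by simp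
    then have "(\<Sum>i\<in>UNIV. grad (u i) x $ i) = g x * (\<Sum>i\<in>UNIV. grad (Q i) x $ i) + (\<Sum>i\<in>UNIV. Q i x * grad g x $ i)"
      by (simp add: sum.distrib sum_distrib_left)
    also have "(\<Sum>i\<in>UNIV. grad (Q i) x $ i) = (\<beta> * wt s (q - 2) x - 2 * m * wt s (q + s - 2) x) * h x"
      using divergence_formula(2)[OF h x, of \<alpha>] by (simp only: Q_def[abs_def] q_def \<beta>_def m_def)
    also have "\<dots> = (\<beta> * wt s (- 2 * b - 2) x - 2 * m * wt s (s - 2 - 2 * b) x) * psi \<alpha> h x"
      using wt_mult_powr[of s "- 2 * b - 2" x \<alpha>] wt_mult_powr[of s "s - 2 - 2 * b" x \<alpha>]
      by (simp add: psi_def q_def algebra_simps)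
    also have "(\<Sum>i\<in>UNIV. Q i x * grad g x $ i) = wt s (- 2 * b) x * (grad g x \<bullet> grad (psi \<alpha> h) x)"
    proof -
      have "Q i x = wt s (- 2 * b) x * grad (psi \<alpha> h) x $ i" for i
        using wt_mult_powr[of s "- 2 * b" x \<alpha>] wt_mult_powr[of s "- 2 * b" x "\<alpha> - 2"]
        by (simp add: Q_def q_def grad_psi[OF hh x] inner_axis' algebra_simps)
      then show ?thesis by (simp add: inner_vec_def sum_distrib_left mult_ac)
    qed
    finally show ?thesis by (simp add: mult_ac)
  qed
  have gm: "g \<in> borel_measurable borel" "grad g \<in> borel_measurable borel"
    "psi \<alpha> h \<in> borel_measurable borel" "grad (psi \<alpha> h) \<in> borel_measurable borel"
    using C1_off_measurable[OF g] C1_off_measurable[OF C1_off_psi[OF hh, of \<alpha>]] by auto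
  have um: "(\<lambda>x. \<Sum>i\<in>UNIV. grad (u i) x $ i) \<in> borel_measurable lborel"
    using borel_measurable_integrable[OF integral_partial_zero(1)[OF Cu \<delta> us]]
    by (intro borel_measurable_sum)
  have "(\<integral>x. wt s (- 2 * b) x * (grad g x \<bullet> grad (psi \<alpha> h) x) +
      (\<beta> * wt s (- 2 * b - 2) x - 2 * m * wt s (s - 2 - 2 * b) x) * (g x * psi \<alpha> h x) \<partial>lborel) =
    (\<integral>x. (\<Sum>i\<in>UNIV. grad (u i) x $ i) \<partial>lborel)"
  proof (rule integral_cong_AE)
    show "AE x in lborel. wt s (- 2 * b) x * (grad g x \<bullet> grad (psi \<alpha> h) x) +
      (\<beta> * wt s (- 2 * b - 2) x - 2 * m * wt s (s - 2 - 2 * b) x) * (g x * psi \<alpha> h x) = (\<Sum>i\<in>UNIV. grad (u i) x $ i)"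
      using AE_lborel_singleton[of 0] by (rule eventually_mono) (rule eq[symmetric])
  qed (use gm um in simp_all)
  with zero show ?thesis by simp
qed

end

definition cutoff :: "nat \<Rightarrow> real ^ 'n \<Rightarrow> real" where
  "cutoff n x = bump (ln (norm x) / real (Suc n))"

lemma GDERIV_cutoff:
  fixes x :: "real ^ 'n"
  assumes "x \<noteq> 0"
  shows "GDERIV (cutoff n) x :> (bump' (ln (norm x) / real (Suc n)) / real (Suc n) / (norm x)\<^sup>2) *\<^sub>R x"
proof -
  have d: "((\<lambda>r. bump (ln r / real (Suc n))) has_real_derivative
      bump' (ln (norm x) / real (Suc n)) * (1 / norm x / real (Suc n))) (at (norm x))"
  proof (rule DERIV_chain2[OF DERIV_bump])
    show "((\<lambda>r. ln r / real (Suc n)) has_real_derivative 1 / norm x / real (Suc n)) (at (norm x))"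
      using assms by (intro DERIV_cdivide) (auto intro!: derivative_eq_intros simp: divide_inverse)
  qed
  from GDERIV_DERIV_compose[OF GDERIV_norm[OF assms] d]
  have "GDERIV (cutoff n) x :> (bump' (ln (norm x) / real (Suc n)) * (1 / norm x / real (Suc n))) *\<^sub>R sgn x"
    by (simp only: cutoff_def[abs_def])
  moreover have "(bump' (ln (norm x) / real (Suc n)) * (1 / norm x / real (Suc n))) *\<^sub>R sgn x =
     (bump' (ln (norm x) / real (Suc n)) / real (Suc n) / (norm x)\<^sup>2) *\<^sub>R x"
    by (simp add: sgn_div_norm divide_inverse power2_eq_square mult_ac)
  ultimately show ?thesis by (simp only:)
qed

lemma C1_off_cutoff: "C1_off (cutoff n)"
proof (rule C1_offI[OF GDERIV_cutoff])
  show "continuous_on (- {0}) (\<lambda>x :: real ^ 'n. (bump' (ln (norm x) / real (Suc n)) / real (Suc n) / (norm x)\<^sup>2) *\<^sub>R x)"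
    by (intro continuous_intros continuous_on_compose2[OF continuous_bump'[of UNIV]]) auto
qed

lemma cutoff_support:
  assumes "x \<noteq> 0" "norm x < exp (- real (Suc n)) \<or> norm x > exp (real (Suc n))"
  shows "cutoff n x = 0"
proof -
  have "ln (norm x) < - real (Suc n) \<or> ln (norm x) > real (Suc n)"
    using assms by (metis exp_less_cancel_iff exp_ln zero_less_norm_iff)
  then have "1 \<le> \<bar>ln (norm x) / real (Suc n)\<bar>" by (auto simp: abs_divide le_divide_eq simp del: of_nat_Suc)
  then show ?thesis unfolding cutoff_def by (rule bump_bounds(4))
qed

lemma cutoff_limits:
  "(\<lambda>n. cutoff n x) \<longlonglongrightarrow> 1" "(\<lambda>n. bump' (ln (norm x) / real (Suc n)) / real (Suc n)) \<longlonglongrightarrow> 0"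
proof -
  have l0: "(\<lambda>n. c / real (Suc n)) \<longlonglongrightarrow> 0" for c :: real
    using tendsto_mult[OF tendsto_const[of c] LIMSEQ_inverse_real_of_nat] by (simp add: divide_inverse)
  have "isCont bump 0" using DERIV_bump by (rule DERIV_isCont)
  from isCont_tendsto_compose[OF this l0[of "ln (norm x)"]] show "(\<lambda>n. cutoff n x) \<longlonglongrightarrow> 1"
    by (simp add: cutoff_def bump_bounds(5))
  show "(\<lambda>n. bump' (ln (norm x) / real (Suc n)) / real (Suc n)) \<longlonglongrightarrow> 0"
  proof (rule Lim_null_comparison[OF _ l0[of 4]])
    show "\<forall>\<^sub>F n in sequentially. norm (bump' (ln (norm x) / real (Suc n)) / real (Suc n)) \<le> 4 / real (Suc n)"
      using bump_bounds(3) by (intro always_eventually allI) (auto simp: abs_divide intro!: divide_right_mono)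
  qed
qed

context ckn
begin

text \<open>Cut f off and let the cutoff tend to 1. As the cutoff is radial, its gradient meets that
  of \<psi> only through x . grad \<psi> = m \<psi>. The resulting error tends to 0 pointwise and is
  dominated by 4 m |x|^(-2) |f \<psi>| times the \<open>mu\<close> weight, which is integrable since
  \<gamma> + m > 0.\<close>

lemma weak_form:
  fixes f h :: "real ^ 'n \<Rightarrow> real" and \<alpha> :: real
  assumes f: "f \<in> G" and h: "harm k h" and m: "0 < \<alpha> + k"
  shows "B f (psi \<alpha> h) = 2 * (\<alpha> + k) * I f (psi \<alpha> h) -
    ((\<alpha> + k)\<^sup>2 + \<gamma> * (\<alpha> + k) - k * (k + real CARD('n) - 2)) * I f (psi (\<alpha> - s) h)"
proof -
  have hh: "hom k h" using h by (simp add: harm_def)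
  define m where "m = \<alpha> + k"
  define \<beta> where "\<beta> = m\<^sup>2 + \<gamma> * m - k * (k + real CARD('n) - 2)"
  have m0: "0 < m" using m by (simp add: m_def)
  define \<psi> where "\<psi> = psi \<alpha> h"
  have \<psi>G: "\<psi> \<in> G" unfolding \<psi>_def by (rule psi_G[OF hh m])
  define g where "g n x = cutoff n x * f x" for n x
  have gC: "C1_off (g n)" for n unfolding g_def[abs_def] by (intro C1_off_mult C1_off_cutoff G_C1 f)
  define F where "F n x = wt s (- 2 * b) x * (grad (g n) x \<bullet> grad \<psi> x) +
    (\<beta> * wt s (- 2 * b - 2) x - 2 * m * wt s (s - 2 - 2 * b) x) * (g n x * \<psi> x)" for n x
  define L where "L x = wt s (- 2 * b) x * (grad f x \<bullet> grad \<psi> x) +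
    (\<beta> * wt s (- 2 * b - 2) x - 2 * m * wt s (s - 2 - 2 * b) x) * (f x * \<psi> x)" for x
  define W where "W x = \<bar>wt s (- 2 * b) x * (grad f x \<bullet> grad \<psi> x)\<bar> + (4 * m + \<bar>\<beta>\<bar>) * \<bar>wt s (- 2 * b - 2) x * (f x * \<psi> x)\<bar>
    + 2 * m * \<bar>wt s (s - 2 - 2 * b) x * (f x * \<psi> x)\<bar>" for x
  have zero: "(\<integral>x. F n x \<partial>lborel) = 0" for n
    unfolding F_def \<psi>_def \<beta>_def m_def
    by (rule weak_form_compact[OF h gC, where \<delta> = "exp (- real (Suc n))" and R = "exp (real (Suc n))"])
      (simp_all add: g_def cutoff_support)
  have meas: "f \<in> borel_measurable borel" "grad f \<in> borel_measurable borel"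
     "\<psi> \<in> borel_measurable borel" "grad \<psi> \<in> borel_measurable borel"
     "g n \<in> borel_measurable borel" "grad (g n) \<in> borel_measurable borel" for n
    using G_measurable[OF f] G_measurable[OF \<psi>G] C1_off_measurable[OF gC] by auto
  have i1: "integrable lborel (\<lambda>x. wt s (- 2 * b) x * (grad f x \<bullet> grad \<psi> x))"
    using G_integrable_B[OF f \<psi>G] meas(2,4) by (subst integral_mu(2)[symmetric]) auto
  have i3: "integrable lborel (\<lambda>x. wt s (s - 2 - 2 * b) x * (f x * \<psi> x))"
    using G_integrable_I[OF f \<psi>G] meas(1,3) by (subst integral_nu(2)[symmetric]) auto
  have i2: "integrable lborel (\<lambda>x. wt s (- 2 * b - 2) x * (f x * \<psi> x))"
  proof -
    obtain C n where C: "C \<ge> 0" "\<And>x. x \<noteq> 0 \<Longrightarrow> \<bar>f x\<bar> \<le> C * (1 + norm x) ^ n" using G_bound[OF f] by blast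
    obtain D where D: "D \<ge> 0" "\<And>x. x \<noteq> 0 \<Longrightarrow> \<bar>\<psi> x\<bar> \<le> D * norm x powr m"
      unfolding \<psi>_def m_def using psi_bound[OF hh, of \<alpha>] by blast
    show ?thesis
    proof (rule integrable_wt[where q = m and C = "C * D" and n = n])
      show "(\<lambda>x. f x * \<psi> x) \<in> borel_measurable borel" using meas by simp
      show "0 < - 2 * b - 2 + m + real CARD('n)" using m0 \<gamma>_nonneg by (simp add: \<gamma>_eq)
      show "\<bar>f x * \<psi> x\<bar> \<le> C * D * norm x powr m * (1 + norm x) ^ n" if "x \<noteq> 0" for x
      proof -
        have "\<bar>f x * \<psi> x\<bar> \<le> (C * (1 + norm x) ^ n) * (D * norm x powr m)"
          unfolding abs_mult using C D that by (intro mult_mono) auto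
        then show ?thesis by (simp add: mult_ac)
      qed
    qed
  qed
  have F_eq: "F n x = cutoff n x * L x + bump' (ln (norm x) / real (Suc n)) / real (Suc n) * (m * (wt s (- 2 * b - 2) x * (f x * \<psi> x)))"
    if x: "x \<noteq> 0" for n x
  proof -
    have gg: "grad (g n) x = cutoff n x *\<^sub>R grad f x + f x *\<^sub>R ((bump' (ln (norm x) / real (Suc n)) / real (Suc n) / (norm x)\<^sup>2) *\<^sub>R x)"
      unfolding g_def[abs_def]
      by (rule GDERIV_D(2)[OF GDERIV_mult[OF GDERIV_cutoff[OF x] C1_off_GDERIV[OF G_C1[OF f] x]]])
    have E: "x \<bullet> grad \<psi> x = m * \<psi> x" unfolding \<psi>_def m_def by (rule grad_psi_Euler[OF hh x])
    have w: "wt s (- 2 * b) x / (norm x)\<^sup>2 = wt s (- 2 * b - 2) x"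
      using wt_mult_power[of s "- 2 * b - 2" x 2] x by (simp add: divide_simps)
    define c where "c = bump' (ln (norm x) / real (Suc n)) / real (Suc n)"
    have "wt s (- 2 * b) x * (grad (g n) x \<bullet> grad \<psi> x) =
      cutoff n x * (wt s (- 2 * b) x * (grad f x \<bullet> grad \<psi> x)) + c * (m * (wt s (- 2 * b) x / (norm x)\<^sup>2 * (f x * \<psi> x)))"
      unfolding gg inner_add_left inner_scaleR_left E c_def[symmetric] by (simp add: algebra_simps)
    then show ?thesis unfolding w c_def[symmetric] F_def L_def g_def by (simp add: algebra_simps)
  qed
  have dom: "\<bar>F n x\<bar> \<le> W x" if x: "x \<noteq> 0" for n x
  proof -
    have "\<bar>bump' (ln (norm x) / real (Suc n)) / real (Suc n)\<bar> \<le> 4"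
    proof -
      have "\<bar>bump' (ln (norm x) / real (Suc n)) / real (Suc n)\<bar> \<le> \<bar>bump' (ln (norm x) / real (Suc n))\<bar> / 1"
        unfolding abs_divide by (intro divide_left_mono) auto
      with bump_bounds(3)[of "ln (norm x) / real (Suc n)"] show ?thesis by linarith
    qed
    then have 1: "\<bar>bump' (ln (norm x) / real (Suc n)) / real (Suc n) * (m * (wt s (- 2 * b - 2) x * (f x * \<psi> x)))\<bar>
        \<le> 4 * \<bar>m * (wt s (- 2 * b - 2) x * (f x * \<psi> x))\<bar>"
      unfolding abs_mult[of "bump' (ln (norm x) / real (Suc n)) / real (Suc n)"] by (intro mult_right_mono) auto
    have "\<bar>cutoff n x\<bar> \<le> 1" using bump_bounds(1,2) by (simp add: cutoff_def)
    then have 2: "\<bar>cutoff n x * L x\<bar> \<le> 1 * \<bar>L x\<bar>" unfolding abs_mult by (intro mult_right_mono) auto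
    have 3: "\<bar>L x\<bar> \<le> \<bar>wt s (- 2 * b) x * (grad f x \<bullet> grad \<psi> x)\<bar> + \<bar>\<beta>\<bar> * \<bar>wt s (- 2 * b - 2) x * (f x * \<psi> x)\<bar>
      + 2 * m * \<bar>wt s (s - 2 - 2 * b) x * (f x * \<psi> x)\<bar>"
    proof -
      have "L x = wt s (- 2 * b) x * (grad f x \<bullet> grad \<psi> x) + \<beta> * (wt s (- 2 * b - 2) x * (f x * \<psi> x))
        - (2 * m) * (wt s (s - 2 - 2 * b) x * (f x * \<psi> x))" by (simp add: L_def algebra_simps)
      moreover have "\<bar>\<beta> * (wt s (- 2 * b - 2) x * (f x * \<psi> x))\<bar> = \<bar>\<beta>\<bar> * \<bar>wt s (- 2 * b - 2) x * (f x * \<psi> x)\<bar>"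
        by (rule abs_mult)
      moreover have "\<bar>(2 * m) * (wt s (s - 2 - 2 * b) x * (f x * \<psi> x))\<bar> = 2 * m * \<bar>wt s (s - 2 - 2 * b) x * (f x * \<psi> x)\<bar>"
        using m0 by (simp add: abs_mult)
      ultimately show ?thesis by linarith
    qed
    have 4: "\<bar>m * (wt s (- 2 * b - 2) x * (f x * \<psi> x))\<bar> = m * \<bar>wt s (- 2 * b - 2) x * (f x * \<psi> x)\<bar>"
      using m0 by (simp add: abs_mult)
    have "\<bar>F n x\<bar> \<le> \<bar>L x\<bar> + 4 * (m * \<bar>wt s (- 2 * b - 2) x * (f x * \<psi> x)\<bar>)"
      unfolding F_eq[OF x] using 1 2 unfolding 4 by linarith
    with 3 have "\<bar>F n x\<bar> \<le> \<bar>wt s (- 2 * b) x * (grad f x \<bullet> grad \<psi> x)\<bar> + \<bar>\<beta>\<bar> * \<bar>wt s (- 2 * b - 2) x * (f x * \<psi> x)\<bar>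
      + 2 * m * \<bar>wt s (s - 2 - 2 * b) x * (f x * \<psi> x)\<bar> + 4 * (m * \<bar>wt s (- 2 * b - 2) x * (f x * \<psi> x)\<bar>)" by linarith
    also have "\<dots> = W x" unfolding W_def by (simp only: distrib_right mult.assoc add_ac)
    finally show ?thesis .
  qed
  have lim: "(\<lambda>n. F n x) \<longlonglongrightarrow> L x" if x: "x \<noteq> 0" for x
    unfolding F_eq[OF x]
    using tendsto_add[OF tendsto_mult_right[OF cutoff_limits(1)[of x], of "L x"]
      tendsto_mult_right[OF cutoff_limits(2)[of x], of "m * (wt s (- 2 * b - 2) x * (f x * \<psi> x))"]]
    by simp
  have W_int: "integrable lborel W"
    unfolding W_def[abs_def] using i1 i2 i3
    by (intro Bochner_Integration.integrable_add integrable_mult_right integrable_abs)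
  have Lm: "L \<in> borel_measurable lborel" and Fm: "\<And>n. F n \<in> borel_measurable lborel"
    using meas unfolding L_def[abs_def] F_def[abs_def] by simp_all
  have "(\<lambda>n. \<integral>x. F n x \<partial>lborel) \<longlonglongrightarrow> (\<integral>x. L x \<partial>lborel)"
  proof (rule integral_dominated_convergence[OF Lm Fm W_int])
    show "AE x in lborel. (\<lambda>n. F n x) \<longlonglongrightarrow> L x"
      using AE_lborel_singleton[of 0] by (rule eventually_mono) (rule lim)
    show "AE x in lborel. norm (F n x) \<le> W x" for n
      using AE_lborel_singleton[of 0] by (rule eventually_mono) (simp add: dom)
  qed
  then have "(\<integral>x. L x \<partial>lborel) = 0" using zero LIMSEQ_unique[OF _ tendsto_const[of 0]] by simp
  moreover have "(\<integral>x. L x \<partial>lborel) = (\<integral>x. wt s (- 2 * b) x * (grad f x \<bullet> grad \<psi> x) \<partial>lborel)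
     + \<beta> * (\<integral>x. wt s (- 2 * b - 2) x * (f x * \<psi> x) \<partial>lborel) - 2 * m * (\<integral>x. wt s (s - 2 - 2 * b) x * (f x * \<psi> x) \<partial>lborel)"
  proof -
    have "(\<integral>x. L x \<partial>lborel) = (\<integral>x. wt s (- 2 * b) x * (grad f x \<bullet> grad \<psi> x)
     + \<beta> * (wt s (- 2 * b - 2) x * (f x * \<psi> x)) - 2 * m * (wt s (s - 2 - 2 * b) x * (f x * \<psi> x)) \<partial>lborel)"
      by (intro Bochner_Integration.integral_cong) (simp_all add: L_def algebra_simps)
    then show ?thesis using i1 i2 i3 by simp
  qed
  moreover have "(\<integral>x. wt s (- 2 * b) x * (grad f x \<bullet> grad \<psi> x) \<partial>lborel) = B f \<psi>"
    unfolding B_def using meas(2,4) by (subst integral_mu(1)) auto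
  moreover have "(\<integral>x. wt s (s - 2 - 2 * b) x * (f x * \<psi> x) \<partial>lborel) = I f \<psi>"
    unfolding I_def using meas(1,3) by (subst integral_nu(1)) auto
  \<comment> \<open>Lowering \<alpha> by s turns the exponent s - 2 - 2 b of the \<open>nu\<close>
    weight into -2 b - 2.\<close>
  moreover have "(\<integral>x. wt s (- 2 * b - 2) x * (f x * \<psi> x) \<partial>lborel) = I f (psi (\<alpha> - s) h)"
  proof -
    have "psi (\<alpha> - s) h \<in> borel_measurable borel" using C1_off_measurable(1)[OF C1_off_psi[OF hh]] .
    then have "I f (psi (\<alpha> - s) h) = (\<integral>x. wt s (s - 2 - 2 * b) x * (f x * psi (\<alpha> - s) h x) \<partial>lborel)"
      unfolding I_def using meas(1) by (subst integral_nu(1)) auto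
    also have "\<dots> = (\<integral>x. wt s (- 2 * b - 2) x * (f x * \<psi> x) \<partial>lborel)"
    proof (rule Bochner_Integration.integral_cong)
      fix x :: "real ^ 'n"
      have "wt s (s - 2 - 2 * b) x * norm x powr (\<alpha> - s) = wt s (- 2 * b - 2) x * norm x powr \<alpha>"
        unfolding wt_mult_powr by (simp add: algebra_simps)
      then show "wt s (s - 2 - 2 * b) x * (f x * psi (\<alpha> - s) h x) = wt s (- 2 * b - 2) x * (f x * \<psi> x)"
        by (simp add: psi_def \<psi>_def mult.left_commute mult.commute)
    qed simp
    finally show ?thesis by simp
  qed
  ultimately show ?thesis unfolding \<psi>_def m_def \<beta>_def by simp
qed

text \<open>
  \<open>mk k\<close> is \<open>D\<^sub>k / 2\<close>, and \<open>ps k j h\<close> is the function \<open>\<psi>\<^sub>j\<close> belonging to \<open>h\<close>.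
\<close>

definition lam :: "nat \<Rightarrow> real" where "lam k = real k * (real k + real CARD('n) - 2)"
definition mk :: "nat \<Rightarrow> real" where "mk k = (sqrt (\<gamma>\<^sup>2 + 4 * lam k) - \<gamma>) / 2"
definition ps :: "nat \<Rightarrow> nat \<Rightarrow> (real ^ 'n \<Rightarrow> real) \<Rightarrow> real ^ 'n \<Rightarrow> real" where
  "ps k j h = psi (mk k - k + s * j) h"

lemma card_ge_1: "1 \<le> real CARD('n)"
proof -
  have "0 < CARD('n)" by simp
  then show ?thesis by linarith
qed

text \<open>The factor k + N - 2 is negative for k = 0 and N = 1, so monotonicity as a product only
  starts at k = 1; k = 0 is compared through \<open>lam 0 = 0\<close>.\<close>

lemma lam_mono: "k \<le> l \<Longrightarrow> lam k \<le> lam l"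
proof -
  assume "k \<le> l"
  show ?thesis
  proof (cases "k = 0")
    case True
    have "0 \<le> lam l"
    proof (cases "l = 0")
      case False
      then have "1 \<le> real l" by simp
      then have "0 \<le> real l + real CARD('n) - 2" using card_ge_1 by linarith
      then show ?thesis by (simp add: lam_def)
    qed (simp add: lam_def)
    then show ?thesis using True by (simp add: lam_def)
  next
    case False
    then have "1 \<le> real k" by simp
    then have "0 \<le> real k + real CARD('n) - 2" using card_ge_1 by linarith
    then show ?thesis unfolding lam_def using \<open>k \<le> l\<close> by (intro mult_mono) auto
  qed
qed

lemma lam_nonneg: "0 \<le> lam k" using lam_mono[of 0 k] by (simp add: lam_def)

lemma mk_nonneg: "0 \<le> mk k"
  using real_sqrt_le_mono[of "\<gamma>\<^sup>2" "\<gamma>\<^sup>2 + 4 * lam k"] lam_nonneg[of k] \<gamma>_nonneg by (simp add: mk_def)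

lemma mk_mono: "k \<le> l \<Longrightarrow> mk k \<le> mk l"
  unfolding mk_def by (intro divide_right_mono diff_right_mono real_sqrt_le_mono add_left_mono) (auto simp: lam_mono)

lemma mk_eq: "(mk k)\<^sup>2 + \<gamma> * mk k = lam k"
proof -
  have "(sqrt (\<gamma>\<^sup>2 + 4 * lam k))\<^sup>2 = \<gamma>\<^sup>2 + 4 * lam k" using lam_nonneg[of k] by simp
  then show ?thesis by (simp add: mk_def power2_eq_square field_simps)
qed

lemma mk_zero: "mk 0 = 0" using \<gamma>_nonneg by (simp add: mk_def lam_def)

text \<open>In dimension one every vector is parallel to a nonzero x. This serves the sign function
  in \<open>grad_ps_trivial\<close>.\<close>

lemma one_dim_parallel:
  fixes x y :: "real ^ 'n"
  assumes "CARD('n) = 1"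
  shows "(x \<bullet> y) *\<^sub>R x = (norm x)\<^sup>2 *\<^sub>R y"
proof -
  obtain i0 :: 'n where "UNIV = {i0}" using assms card_1_singletonE by blast
  then have U: "(UNIV :: 'n set) = {i0}" and i: "\<And>i. i = i0" by auto
  have "x \<bullet> y = x $ i0 * y $ i0" "(norm x)\<^sup>2 = x $ i0 * x $ i0"
    by (simp_all add: inner_vec_def U power2_norm_eq_inner)
  then show ?thesis unfolding vec_eq_iff by (metis i mult.assoc mult.commute vector_scaleR_component real_scaleR_def)
qed

text \<open>\<open>mk k = 0\<close> forces \<open>lam k = 0\<close>, that is k = 0, or k = 1 in
  dimension one. The function is then constant or a multiple of the sign function, in both cases
  locally constant off the origin. This supplies the degree 0 that \<open>psi_G\<close> and
  \<open>weak_form\<close> exclude.\<close>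

lemma grad_ps_trivial:
  assumes h: "harm k h" and k: "mk k = 0" and x: "x \<noteq> 0"
  shows "grad (ps k 0 h) x = 0"
proof -
  have hh: "hom k h" using h by (simp add: harm_def)
  have "lam k = 0" using mk_eq[of k] k by simp
  then have "k = 0 \<or> (k \<noteq> 0 \<and> real k + real CARD('n) = 2)" by (auto simp: lam_def)
  moreover have "real k = 1 \<and> real CARD('n) = 1" if "k \<noteq> 0" "real k + real CARD('n) = 2"
  proof -
    have "1 \<le> real k" using that(1) by simp
    then show ?thesis using that(2) card_ge_1 by linarith
  qed
  ultimately consider "k = 0" | "k = 1" "CARD('n) = 1" by fastforce
  then show ?thesis
  proof cases
    case 1
    then obtain c where c: "h = (\<lambda>x. c)" using hom_0D hh by blast
    have "grad h x = 0" unfolding c by simp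
    then show ?thesis using 1 k unfolding ps_def grad_psi[OF hh x] by simp
  next
    case 2
    have "x \<bullet> grad h x = h x" using hom_Euler[OF hh, of x] 2 by simp
    then have "h x *\<^sub>R x = (norm x)\<^sup>2 *\<^sub>R grad h x" using one_dim_parallel[OF 2(2), of x "grad h x"] by simp
    moreover have "norm x powr (- 3) * (norm x)\<^sup>2 = norm x powr (- 1)"
    proof -
      have "norm x powr (- 3) * (norm x)\<^sup>2 = norm x powr (- 3) * norm x powr 2" using x by (simp add: powr_numeral)
      also have "\<dots> = norm x powr (- 1)" unfolding powr_add[symmetric] by simp
      finally show ?thesis .
    qed
    moreover have "grad (ps k 0 h) x = norm x powr (- 1) *\<^sub>R grad h x - norm x powr (- 3) *\<^sub>R (h x *\<^sub>R x)"
      using 2 k by (simp add: ps_def grad_psi[OF hh x])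
    ultimately show ?thesis by (simp add: scaleR_scaleR)
  qed
qed

lemma ps_G:
  assumes h: "harm k h"
  shows "ps k j h \<in> G"
proof (cases "0 < mk k + s * j")
  case True
  then show ?thesis unfolding ps_def using h by (intro psi_G[of k]) (auto simp: harm_def)
next
  case False
  have hh: "hom k h" using h by (simp add: harm_def)
  have "0 \<le> s * j" using s_pos by simp
  with False mk_nonneg[of k] have "mk k = 0" "s * j = 0" by linarith+
  then have k: "mk k = 0" and j: "j = 0" using s_pos by auto
  obtain C where C: "C \<ge> 0" "\<And>x. x \<noteq> 0 \<Longrightarrow> \<bar>ps k 0 h x\<bar> \<le> C * norm x powr (mk k - k + s * real 0 + k)"
    unfolding ps_def using psi_bound[OF hh, of "mk k - k + s * real 0"] by blast
  have b: "\<bar>ps k 0 h x\<bar> \<le> C * (1 + norm x) ^ 0" if "x \<noteq> 0" for x using C(2)[OF that] k that by simp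
  have C1: "C1_off (ps k 0 h)" unfolding ps_def by (rule C1_off_psi[OF hh])
  have "integrable (mu a b) (\<lambda>x. (norm (grad (ps k 0 h) x))\<^sup>2) \<longleftrightarrow> integrable (mu a b) (\<lambda>x :: real ^ 'n. 0 :: real)"
  proof (rule integrable_cong_AE)
    show "AE x in mu a b. (norm (grad (ps k 0 h) x))\<^sup>2 = 0"
      using AE_mu_nu_nonzero(1) by (rule eventually_mono) (simp add: grad_ps_trivial[OF h k])
  qed (use C1_off_measurable(2)[OF C1] in simp_all)
  then have "integrable (mu a b) (\<lambda>x. (norm (grad (ps k 0 h) x))\<^sup>2)" by simp
  then show ?thesis unfolding G_def j using C1 b by blast
qed

text \<open>By \<open>mk_eq\<close>, the indicial polynomial at m = mk k + s j equals s j (2 mk k +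
  s j + \<gamma>). It vanishes for j = 0, so the truncated \<open>j - 1\<close> does no harm
  there.\<close>

lemma ps_weak:
  assumes f: "f \<in> G" and h: "harm k h"
  shows "B f (ps k j h) = 2 * (mk k + s * j) * I f (ps k j h) - s * j * (2 * mk k + s * j + \<gamma>) * I f (ps k (j - 1) h)"
proof (cases "0 < mk k + s * j")
  case True
  have m: "mk k - k + s * j + k = mk k + s * j" by simp
  have \<beta>: "(mk k + s * j)\<^sup>2 + \<gamma> * (mk k + s * j) - lam k = s * j * (2 * mk k + s * j + \<gamma>)"
    unfolding mk_eq[of k, symmetric] by (simp add: power2_eq_square algebra_simps)
  have "B f (ps k j h) = 2 * (mk k + s * j) * I f (ps k j h) - s * j * (2 * mk k + s * j + \<gamma>) * I f (psi (mk k - k + s * j - s) h)"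
    using weak_form[OF f h, of "mk k - k + s * j"] True
    unfolding m ps_def lam_def[symmetric] \<beta> by simp
  moreover have "mk k - k + s * j - s = mk k - k + s * real (j - 1)" if "j \<noteq> 0"
    using that by (simp add: of_nat_diff algebra_simps)
  ultimately show ?thesis by (cases "j = 0") (simp_all add: ps_def)
next
  case False
  have "0 \<le> s * j" using s_pos by simp
  with False mk_nonneg[of k] have "mk k = 0" "s * j = 0" by linarith+
  then have k: "mk k = 0" and j: "j = 0" using s_pos by auto
  have "B f (ps k 0 h) = (\<integral>x. 0 \<partial>(mu a b :: (real ^ 'n) measure))"
    unfolding B_def
  proof (rule integral_cong_AE)
    show "AE x in mu a b. grad f x \<bullet> grad (ps k 0 h) x = 0"
      using AE_mu_nu_nonzero(1) by (rule eventually_mono) (simp add: grad_ps_trivial[OF h k])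
  qed (use G_measurable(2)[OF f] G_measurable(2)[OF ps_G[OF h, of 0]] in simp_all)
  then show ?thesis using k j by simp
qed

section \<open>Weak eigenfunctions\<close>

definition eigen :: "real \<Rightarrow> (real ^ 'n \<Rightarrow> real) \<Rightarrow> bool" where
  "eigen l \<phi> \<longleftrightarrow> \<phi> \<in> G \<and> (\<forall>f\<in>G. B f \<phi> = l * I f \<phi>)"

lemma eigenD: "eigen l \<phi> \<Longrightarrow> \<phi> \<in> G" "eigen l \<phi> \<Longrightarrow> f \<in> G \<Longrightarrow> B f \<phi> = l * I f \<phi>"
  by (auto simp: eigen_def)

lemma eigen_add:
  assumes "eigen l f" "eigen l g"
  shows "eigen l (\<lambda>x. f x + g x)"
  unfolding eigen_def
proof (intro conjI ballI)
  show "(\<lambda>x. f x + g x) \<in> G" using assms by (intro G_add eigenD(1))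
  fix u assume u: "u \<in> G"
  have fg: "f \<in> G" "g \<in> G" using assms by (auto simp: eigen_def)
  show "B u (\<lambda>x. f x + g x) = l * I u (\<lambda>x. f x + g x)"
    unfolding B_commute[of u] I_commute[of u] B_add[OF fg u] I_add[OF fg u]
    using eigenD(2)[OF assms(1) u] eigenD(2)[OF assms(2) u] by (simp add: B_commute[of _ u] I_commute[of _ u] distrib_left)
qed

lemma eigen_cmult:
  assumes "eigen l f"
  shows "eigen l (\<lambda>x. c * f x)"
  unfolding eigen_def
proof (intro conjI ballI)
  have f: "f \<in> G" using assms by (rule eigenD(1))
  then show "(\<lambda>x. c * f x) \<in> G" by (rule G_cmult)
  fix u assume u: "u \<in> G"
  show "B u (\<lambda>x. c * f x) = l * I u (\<lambda>x. c * f x)"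
    unfolding B_commute[of u] I_commute[of u] B_cmult[OF f u] I_cmult
    using eigenD(2)[OF assms u] by (simp add: B_commute[of _ u] I_commute[of _ u])
qed

lemma eigen_zero: "eigen l (\<lambda>x. 0)"
  using G_const B_commute B_const I_commute I_cmult[of 0 "\<lambda>x. 0"] by (simp add: eigen_def I_def B_def)

lemma eigen_orthogonal:
  assumes "eigen l f" "eigen l' g" "l \<noteq> l'"
  shows "I f g = 0"
proof -
  have "l * I g f = l' * I f g"
    using eigenD(2)[OF assms(1) eigenD(1)[OF assms(2)]] eigenD(2)[OF assms(2) eigenD(1)[OF assms(1)]]
    by (simp add: B_commute)
  then show ?thesis using assms(3) by (simp add: I_commute[of g])
qed

text \<open>A triangular action with distinct diagonal entries can be diagonalised: one
  eigenfunction for each i <= j. The part \<open>e i\<close> is a combination of the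
  \<open>ps k i' h\<close> with i' <= i only; this is recorded through its consequence for
  orthogonality, the form in which it enters the spectral gap.\<close>

lemma ps_eigen_decomposition:
  assumes h: "harm k h"
  shows "\<exists>e. (\<forall>i\<le>j. eigen (2 * (mk k + s * real i)) (e i) \<and>
      (\<forall>w\<in>G. (\<forall>i'\<le>i. I (ps k i' h) w = 0) \<longrightarrow> I (e i) w = 0)) \<and> ps k j h = (\<lambda>x. \<Sum>i\<le>j. e i x)"
proof (induction j)
  case 0
  have "eigen (2 * (mk k + s * real 0)) (ps k 0 h)"
    unfolding eigen_def using ps_G[OF h] ps_weak[OF _ h, of _ 0] by simp
  then show ?case by (intro exI[of _ "\<lambda>i. ps k 0 h"]) simp
next
  case (Suc j)
  then obtain e where e: "\<And>i. i \<le> j \<Longrightarrow> eigen (2 * (mk k + s * real i)) (e i)"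
    and orth: "\<And>i w. i \<le> j \<Longrightarrow> w \<in> G \<Longrightarrow> (\<forall>i'\<le>i. I (ps k i' h) w = 0) \<Longrightarrow> I (e i) w = 0"
    and sum: "ps k j h = (\<lambda>x. \<Sum>i\<le>j. e i x)"
    by (elim exE conjE) (rule that, simp_all)
  define \<beta> where "\<beta> = s * real (Suc j) * (2 * mk k + s * real (Suc j) + \<gamma>)"
  \<comment> \<open>The eigenvalues of index Suc j and i differ by 2 s (Suc j - i); with this choice
    the correction by \<open>c i * e i\<close> cancels the term \<beta> I (e i) w coming from
    \<open>ps_weak\<close>.\<close>
  define c where "c i = \<beta> / (2 * s * (real (Suc j) - real i))" for i
  define E where "E x = ps k (Suc j) h x - (\<Sum>i\<le>j. c i * e i x)" for x
  have eG: "e i \<in> G" if "i \<le> j" for i using e[OF that] by (rule eigenD(1))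
  have sG: "(\<lambda>x. \<Sum>i\<le>j. c i * e i x) \<in> G" by (intro G_sum G_cmult eG) simp
  have EG: "E \<in> G" unfolding E_def[abs_def] by (intro G_diff ps_G[OF h] sG)
  have I_E: "I E w = I (ps k (Suc j) h) w - (\<Sum>i\<le>j. c i * I (e i) w)" if w: "w \<in> G" for w
    unfolding E_def[abs_def] I_diff[OF ps_G[OF h] sG w]
    by (subst I_sum) (auto simp: I_cmult w intro: G_cmult eG)
  have B_E: "B E w = B (ps k (Suc j) h) w - (\<Sum>i\<le>j. c i * B (e i) w)" if w: "w \<in> G" for w
    unfolding E_def[abs_def] B_diff[OF ps_G[OF h] sG w]
    by (subst B_sum) (auto simp: B_cmult[OF eG w] w intro: G_cmult eG)
  have eigE: "eigen (2 * (mk k + s * real (Suc j))) E"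
    unfolding eigen_def
  proof (intro conjI ballI EG)
    fix w assume w: "w \<in> G"
    have Ij: "I (ps k j h) w = (\<Sum>i\<le>j. I (e i) w)"
      unfolding sum by (rule I_sum) (auto intro: eG w)
    have "B (ps k (Suc j) h) w = 2 * (mk k + s * real (Suc j)) * I (ps k (Suc j) h) w - \<beta> * I (ps k j h) w"
      using ps_weak[OF w h, of "Suc j"] by (simp add: B_commute[of w] I_commute[of w] \<beta>_def)
    also have "\<dots> = 2 * (mk k + s * real (Suc j)) * I (ps k (Suc j) h) w - (\<Sum>i\<le>j. \<beta> * I (e i) w)"
      by (simp add: Ij sum_distrib_left)
    finally have 1: "B (ps k (Suc j) h) w = \<dots>" .
    have 2: "c i * B (e i) w = 2 * (mk k + s * real (Suc j)) * (c i * I (e i) w) - \<beta> * I (e i) w" if i: "i \<le> j" for i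
    proof -
      have "real (Suc j) - real i \<noteq> 0" using i by simp
      then have c: "c i * (2 * s * (real (Suc j) - real i)) = \<beta>" using s_pos by (simp add: c_def)
      have "B (e i) w = 2 * (mk k + s * real i) * I (e i) w"
        using eigenD(2)[OF e[OF i] w] by (simp only: B_commute[of w] I_commute[of w])
      then have "c i * B (e i) w = 2 * (mk k + s * real (Suc j)) * (c i * I (e i) w) - c i * (2 * s * (real (Suc j) - real i)) * I (e i) w"
        by (simp add: algebra_simps)
      then show ?thesis unfolding c .
    qed
    have "(\<Sum>i\<le>j. c i * B (e i) w) = (\<Sum>i\<le>j. 2 * (mk k + s * real (Suc j)) * (c i * I (e i) w) - \<beta> * I (e i) w)"
      by (rule sum.cong[OF refl]) (simp only: 2 atMost_iff)
    also have "\<dots> = 2 * (mk k + s * real (Suc j)) * (\<Sum>i\<le>j. c i * I (e i) w) - (\<Sum>i\<le>j. \<beta> * I (e i) w)"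
      by (simp only: sum_subtractf sum_distrib_left)
    finally show "B w E = 2 * (mk k + s * real (Suc j)) * I w E"
      unfolding B_commute[of w] I_commute[of w] B_E[OF w] I_E[OF w] 1 by (simp add: right_diff_distrib)
  qed
  define e' where "e' i = (if i \<le> j then (\<lambda>x. c i * e i x) else E)" for i
  have e1: "eigen (2 * (mk k + s * real i)) (e' i)" if "i \<le> Suc j" for i
  proof (cases "i \<le> j")
    case True
    then show ?thesis using eigen_cmult[OF e[OF True]] by (simp add: e'_def)
  next
    case False
    then have "i = Suc j" using that by simp
    then show ?thesis using eigE by (simp add: e'_def)
  qed
  have e2: "I (e' i) w = 0" if "i \<le> Suc j" "w \<in> G" "\<forall>i'\<le>i. I (ps k i' h) w = 0" for i w
  proof (cases "i \<le> j")
    case True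
    then show ?thesis using orth[OF True that(2,3)] by (simp add: e'_def I_cmult)
  next
    case False
    then have i: "i = Suc j" using that by simp
    have "I (e i') w = 0" if "i' \<le> j" for i' using orth[OF that \<open>w \<in> G\<close>] \<open>\<forall>i'\<le>i. I (ps k i' h) w = 0\<close> that i by simp
    then show ?thesis using that(3) i by (simp add: e'_def I_E[OF that(2)])
  qed
  have e3: "ps k (Suc j) h = (\<lambda>x. \<Sum>i\<le>Suc j. e' i x)"
    by (rule ext) (simp add: e'_def E_def)
  have "\<forall>i\<le>Suc j. eigen (2 * (mk k + s * real i)) (e' i) \<and>
      (\<forall>w\<in>G. (\<forall>i'\<le>i. I (ps k i' h) w = 0) \<longrightarrow> I (e' i) w = 0)"
    using e1 e2 by simp
  then show ?case using e3 by (intro exI[of _ e'] conjI)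
qed


section \<open>Density of the span of the eigenfunctions\<close>

text \<open>The linear span of all \<open>ps k j h\<close>; scalars are moved into h, see
  \<open>V_cmult\<close>.\<close>

inductive V :: "(real ^ 'n \<Rightarrow> real) \<Rightarrow> bool" where
  V_zero: "V (\<lambda>x. 0)"
| V_ps: "harm k h \<Longrightarrow> V (ps k j h)"
| V_add: "V f \<Longrightarrow> V g \<Longrightarrow> V (\<lambda>x. f x + g x)"

lemma ps_cmult: "ps k j (\<lambda>x. c * h x) = (\<lambda>x. c * ps k j h x)"
  unfolding ps_def by (rule psi_cmult)

lemma V_cmult: "V f \<Longrightarrow> V (\<lambda>x. c * f x)"
proof (induction rule: V.induct)
  case V_zero
  show ?case using V.V_zero by simp
next
  case (V_ps k h j)
  have "V (ps k j (\<lambda>x. c * h x))" by (rule V.V_ps[OF harm_cmult[OF V_ps]])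
  then show ?case by (simp only: ps_cmult)
next
  case (V_add f g)
  then show ?case using V.V_add by (simp add: distrib_left)
qed

lemma V_G: "V f \<Longrightarrow> f \<in> G"
  by (induction rule: V.induct) (simp_all add: G_const ps_G G_add)

section \<open>Approximation by the span in L2(nu)\<close>

definition L2 :: "(real ^ 'n \<Rightarrow> real) set" where
  "L2 = {f. f \<in> borel_measurable borel \<and> integrable (nu a b) (\<lambda>x. (f x)\<^sup>2)}"

lemma G_L2: "f \<in> G \<Longrightarrow> f \<in> L2"
  using G_integrable_I[of f f] by (simp add: L2_def G_measurable(1) power2_eq_square)

lemma L2_dom:
  assumes "W \<in> L2" "f \<in> borel_measurable borel" "\<And>x. x \<noteq> 0 \<Longrightarrow> \<bar>f x\<bar> \<le> \<bar>W x\<bar>"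
  shows "f \<in> L2"
proof -
  have "integrable (nu a b) (\<lambda>x. (f x)\<^sup>2)"
  proof (rule Bochner_Integration.integrable_bound)
    show "integrable (nu a b) (\<lambda>x. (W x)\<^sup>2)" using assms(1) by (simp add: L2_def)
    show "(\<lambda>x. (f x)\<^sup>2) \<in> borel_measurable (nu a b)" using assms(2) by simp
    show "AE x in nu a b. norm ((f x)\<^sup>2) \<le> norm ((W x)\<^sup>2)"
      using AE_mu_nu_nonzero(2) by (rule eventually_mono) (simp add: assms(3) abs_le_square_iff[symmetric])
  qed
  then show ?thesis using assms(2) by (simp add: L2_def)
qed

lemma L2_cmult: "f \<in> L2 \<Longrightarrow> (\<lambda>x. c * f x) \<in> L2"
  by (simp add: L2_def power_mult_distrib borel_measurable_times)

lemma L2_abs: "f \<in> L2 \<Longrightarrow> (\<lambda>x. \<bar>f x\<bar>) \<in> L2"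
  by (simp add: L2_def borel_measurable_abs)

lemma square_add_le: "(x + y)\<^sup>2 \<le> 2 * x\<^sup>2 + 2 * y\<^sup>2" for x y :: real
  using sum_squares_bound[of x y] by (simp add: power2_sum)

lemma L2_add:
  assumes f: "f \<in> L2" and g: "g \<in> L2"
  shows "(\<lambda>x. f x + g x) \<in> L2" "I (\<lambda>x. f x + g x) (\<lambda>x. f x + g x) \<le> 2 * I f f + 2 * I g g"
proof -
  have meas: "f \<in> borel_measurable borel" "g \<in> borel_measurable borel" using f g by (auto simp: L2_def)
  have int: "integrable (nu a b) (\<lambda>x. 2 * (f x)\<^sup>2 + 2 * (g x)\<^sup>2)"
    using f g by (simp add: L2_def)
  have i: "integrable (nu a b) (\<lambda>x. (f x + g x)\<^sup>2)"
  proof (rule Bochner_Integration.integrable_bound[OF int])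
    show "(\<lambda>x. (f x + g x)\<^sup>2) \<in> borel_measurable (nu a b)" using meas by simp
    show "AE x in nu a b. norm ((f x + g x)\<^sup>2) \<le> norm (2 * (f x)\<^sup>2 + 2 * (g x)\<^sup>2)"
      by (rule AE_I2) (simp add: square_add_le)
  qed
  then show "(\<lambda>x. f x + g x) \<in> L2" using meas by (simp add: L2_def)
  have "(\<integral>x. (f x + g x)\<^sup>2 \<partial>nu a b) \<le> (\<integral>x. 2 * (f x)\<^sup>2 + 2 * (g x)\<^sup>2 \<partial>nu a b)"
    by (rule integral_mono[OF i int]) (rule square_add_le)
  also have "\<dots> = 2 * (\<integral>x. (f x)\<^sup>2 \<partial>nu a b) + 2 * (\<integral>x. (g x)\<^sup>2 \<partial>nu a b)"
    using f g by (simp add: L2_def)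
  finally show "I (\<lambda>x. f x + g x) (\<lambda>x. f x + g x) \<le> 2 * I f f + 2 * I g g"
    by (simp add: I_def power2_eq_square)
qed

lemma L2_diff: "f \<in> L2 \<Longrightarrow> g \<in> L2 \<Longrightarrow> (\<lambda>x. f x - g x) \<in> L2"
  using L2_add(1)[OF _ L2_cmult[of g "-1"]] by simp

text \<open>Membership in the L2(\<open>nu\<close>) closure of \<open>V\<close>, with the error
  measured by the squared norm; hence the quarters of \<epsilon> below, which come from (x + y)^2 <=
  2 x^2 + 2 y^2.\<close>

definition appr :: "(real ^ 'n \<Rightarrow> real) \<Rightarrow> bool" where
  "appr f \<longleftrightarrow> f \<in> L2 \<and> (\<forall>\<epsilon>>0. \<exists>\<Phi>. V \<Phi> \<and> I (\<lambda>x. f x - \<Phi> x) (\<lambda>x. f x - \<Phi> x) < \<epsilon>)"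

lemma apprE:
  assumes "appr f" "0 < \<epsilon>"
  obtains \<Phi> where "V \<Phi>" "I (\<lambda>x. f x - \<Phi> x) (\<lambda>x. f x - \<Phi> x) < \<epsilon>"
proof -
  have "\<exists>\<Phi>. V \<Phi> \<and> I (\<lambda>x. f x - \<Phi> x) (\<lambda>x. f x - \<Phi> x) < \<epsilon>" using assms by (simp add: appr_def)
  then show ?thesis by (elim exE conjE) (rule that)
qed

lemma appr_L2: "appr f \<Longrightarrow> f \<in> L2" by (simp add: appr_def)

lemma appr_V:
  assumes "V f"
  shows "appr f"
  unfolding appr_def
proof (intro conjI allI impI)
  show "f \<in> L2" using assms by (intro G_L2 V_G)
  show "\<exists>\<Phi>. V \<Phi> \<and> I (\<lambda>x. f x - \<Phi> x) (\<lambda>x. f x - \<Phi> x) < \<epsilon>" if "0 < \<epsilon>" for \<epsilon>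
    using assms that by (intro exI[of _ f]) (simp add: I_def)
qed

lemma appr_limit:
  assumes f: "f \<in> L2" and *: "\<And>\<epsilon>. 0 < \<epsilon> \<Longrightarrow> \<exists>g. appr g \<and> I (\<lambda>x. f x - g x) (\<lambda>x. f x - g x) < \<epsilon>"
  shows "appr f"
  unfolding appr_def
proof (intro conjI allI impI f)
  fix \<epsilon> :: real
  assume "0 < \<epsilon>"
  then have e: "0 < \<epsilon> / 4" by simp
  from *[OF e] obtain g where g: "appr g" "I (\<lambda>x. f x - g x) (\<lambda>x. f x - g x) < \<epsilon> / 4" by (elim exE conjE)
  obtain \<Phi> where \<Phi>: "V \<Phi>" "I (\<lambda>x. g x - \<Phi> x) (\<lambda>x. g x - \<Phi> x) < \<epsilon> / 4"
    by (rule apprE[OF g(1) e])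
  have "I (\<lambda>x. (f x - g x) + (g x - \<Phi> x)) (\<lambda>x. (f x - g x) + (g x - \<Phi> x)) \<le>
     2 * I (\<lambda>x. f x - g x) (\<lambda>x. f x - g x) + 2 * I (\<lambda>x. g x - \<Phi> x) (\<lambda>x. g x - \<Phi> x)"
    by (intro L2_add(2) L2_diff f appr_L2 g(1) appr_V \<Phi>(1))
  then have "I (\<lambda>x. f x - \<Phi> x) (\<lambda>x. f x - \<Phi> x) < \<epsilon>" using g(2) \<Phi>(2) by simp
  with \<Phi>(1) show "\<exists>\<Phi>. V \<Phi> \<and> I (\<lambda>x. f x - \<Phi> x) (\<lambda>x. f x - \<Phi> x) < \<epsilon>" by (intro exI[of _ \<Phi>] conjI)
qed

lemma appr_add:
  assumes "appr f" "appr g"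
  shows "appr (\<lambda>x. f x + g x)"
  unfolding appr_def
proof (intro conjI allI impI)
  show "(\<lambda>x. f x + g x) \<in> L2" using assms by (intro L2_add(1) appr_L2)
  fix \<epsilon> :: real
  assume "0 < \<epsilon>"
  then have e: "0 < \<epsilon> / 4" by simp
  obtain \<Phi> where \<Phi>: "V \<Phi>" "I (\<lambda>x. f x - \<Phi> x) (\<lambda>x. f x - \<Phi> x) < \<epsilon> / 4"
    by (rule apprE[OF assms(1) e])
  obtain \<Psi> where \<Psi>: "V \<Psi>" "I (\<lambda>x. g x - \<Psi> x) (\<lambda>x. g x - \<Psi> x) < \<epsilon> / 4"
    by (rule apprE[OF assms(2) e])
  have "I (\<lambda>x. (f x - \<Phi> x) + (g x - \<Psi> x)) (\<lambda>x. (f x - \<Phi> x) + (g x - \<Psi> x)) \<le>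
     2 * I (\<lambda>x. f x - \<Phi> x) (\<lambda>x. f x - \<Phi> x) + 2 * I (\<lambda>x. g x - \<Psi> x) (\<lambda>x. g x - \<Psi> x)"
    by (intro L2_add(2) L2_diff appr_L2 assms appr_V \<Phi>(1) \<Psi>(1))
  moreover have "(\<lambda>x. (f x - \<Phi> x) + (g x - \<Psi> x)) = (\<lambda>x. f x + g x - (\<Phi> x + \<Psi> x))" by (simp add: algebra_simps)
  ultimately have "I (\<lambda>x. f x + g x - (\<Phi> x + \<Psi> x)) (\<lambda>x. f x + g x - (\<Phi> x + \<Psi> x)) < \<epsilon>"
    using \<Phi>(2) \<Psi>(2) by (simp only:)
  with V_add[OF \<Phi>(1) \<Psi>(1)]
  show "\<exists>\<Phi>. V \<Phi> \<and> I (\<lambda>x. f x + g x - \<Phi> x) (\<lambda>x. f x + g x - \<Phi> x) < \<epsilon>"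
    by (intro exI[of _ "\<lambda>x. \<Phi> x + \<Psi> x"] conjI)
qed

lemma I_cmult2: "I (\<lambda>x. c * f x) (\<lambda>x. c * f x) = c\<^sup>2 * I f f"
  unfolding I_cmult I_commute[of f "\<lambda>x. c * f x"] by (simp add: power2_eq_square)

lemma appr_cmult:
  assumes "appr f"
  shows "appr (\<lambda>x. c * f x)"
  unfolding appr_def
proof (intro conjI allI impI)
  show "(\<lambda>x. c * f x) \<in> L2" using assms by (intro L2_cmult appr_L2)
  fix \<epsilon> :: real
  assume "0 < \<epsilon>"
  then have e: "0 < \<epsilon> / (1 + c\<^sup>2)" by (simp add: add_pos_nonneg)
  obtain \<Phi> where \<Phi>: "V \<Phi>" "I (\<lambda>x. f x - \<Phi> x) (\<lambda>x. f x - \<Phi> x) < \<epsilon> / (1 + c\<^sup>2)"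
    by (rule apprE[OF assms e])
  have "I (\<lambda>x. c * f x - c * \<Phi> x) (\<lambda>x. c * f x - c * \<Phi> x) = c\<^sup>2 * I (\<lambda>x. f x - \<Phi> x) (\<lambda>x. f x - \<Phi> x)"
    unfolding right_diff_distrib[symmetric] by (rule I_cmult2)
  also have "\<dots> \<le> (1 + c\<^sup>2) * I (\<lambda>x. f x - \<Phi> x) (\<lambda>x. f x - \<Phi> x)"
    using I_nonneg by (intro mult_right_mono) auto
  also have "\<dots> < \<epsilon>" using \<Phi>(2) by (simp add: less_divide_eq add_pos_nonneg mult.commute)
  finally show "\<exists>\<Phi>. V \<Phi> \<and> I (\<lambda>x. c * f x - \<Phi> x) (\<lambda>x. c * f x - \<Phi> x) < \<epsilon>"
    using V_cmult[OF \<Phi>(1)] by (intro exI[of _ "\<lambda>x. c * \<Phi> x"] conjI)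
qed

lemma appr_sum: "(\<And>i. i \<in> J \<Longrightarrow> appr (f i)) \<Longrightarrow> appr (\<lambda>x. \<Sum>i\<in>J. f i x)"
proof (induction J rule: infinite_finite_induct)
  case (insert i J)
  then show ?case using appr_add[of "f i" "\<lambda>x. \<Sum>i\<in>J. f i x"] by simp
qed (simp_all add: appr_V[OF V_zero])

text \<open>The limit steps of the density proof are instances of this: pointwise convergence off
  the origin under a fixed L2 majorant is convergence in L2.\<close>

lemma appr_seq:
  assumes F: "\<And>n. appr (F n)" and lim: "\<And>x. x \<noteq> 0 \<Longrightarrow> (\<lambda>n. F n x) \<longlonglongrightarrow> f x"
    and fm: "f \<in> borel_measurable borel"
    and dom: "\<And>n x. x \<noteq> 0 \<Longrightarrow> \<bar>F n x\<bar> \<le> W x" and W: "W \<in> L2"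
  shows "appr f"
proof (rule appr_limit)
  have fb: "\<bar>f x\<bar> \<le> W x" if "x \<noteq> 0" for x
    using tendsto_rabs[OF lim[OF that]] dom[OF that] by (intro LIMSEQ_le_const2) auto
  show fL: "f \<in> L2"
  proof (rule L2_dom[OF W fm])
    show "\<bar>f x\<bar> \<le> \<bar>W x\<bar>" if "x \<noteq> 0" for x using fb[OF that] by linarith
  qed
  fix \<epsilon> :: real
  assume e: "0 < \<epsilon>"
  have Fm: "F n \<in> borel_measurable borel" for n using appr_L2[OF F] by (simp add: L2_def)
  have "(\<lambda>n. \<integral>x. (f x - F n x) * (f x - F n x) \<partial>nu a b) \<longlonglongrightarrow> (\<integral>x. 0 \<partial>(nu a b :: (real ^ 'n) measure))"
  proof (rule integral_dominated_convergence[where w = "\<lambda>x. 4 * (W x)\<^sup>2"])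
    show "integrable (nu a b) (\<lambda>x. 4 * (W x)\<^sup>2)" using W by (simp add: L2_def)
    show "AE x in nu a b. (\<lambda>n. (f x - F n x) * (f x - F n x)) \<longlonglongrightarrow> 0"
      using AE_mu_nu_nonzero(2)
    proof (rule eventually_mono)
      fix x :: "real ^ 'n" assume "x \<noteq> 0"
      then have "(\<lambda>n. f x - F n x) \<longlonglongrightarrow> f x - f x" by (intro tendsto_intros lim)
      then show "(\<lambda>n. (f x - F n x) * (f x - F n x)) \<longlonglongrightarrow> 0"
        using tendsto_mult[of "\<lambda>n. f x - F n x" 0 sequentially "\<lambda>n. f x - F n x" 0] by simp
    qed
    show "AE x in nu a b. norm ((f x - F n x) * (f x - F n x)) \<le> 4 * (W x)\<^sup>2" for n
      using AE_mu_nu_nonzero(2)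
    proof (rule eventually_mono)
      fix x :: "real ^ 'n" assume "x \<noteq> 0"
      then have "\<bar>f x - F n x\<bar> \<le> 2 * W x" using fb[of x] dom[of x n] by linarith
      then have "\<bar>f x - F n x\<bar>\<^sup>2 \<le> (2 * W x)\<^sup>2" by (intro power_mono) auto
      then show "norm ((f x - F n x) * (f x - F n x)) \<le> 4 * (W x)\<^sup>2"
        by (simp add: power2_eq_square)
    qed
  qed (use fm Fm in simp_all)
  then have "(\<lambda>n. I (\<lambda>x. f x - F n x) (\<lambda>x. f x - F n x)) \<longlonglongrightarrow> 0" by (simp add: I_def)
  from order_tendstoD(2)[OF this e] obtain n where "I (\<lambda>x. f x - F n x) (\<lambda>x. f x - F n x) < \<epsilon>"
    by (auto simp: eventually_sequentially)
  then show "\<exists>g. appr g \<and> I (\<lambda>x. f x - g x) (\<lambda>x. f x - g x) < \<epsilon>"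
    using F by (intro exI[of _ "F n"] conjI)
qed

text \<open>
  With this choice of \<open>\<delta>\<close>, the function \<open>exp (2 \<delta> |x| powr s)\<close> is still integrable against \<open>\<nu>\<close>, so that the
  Taylor series of \<open>exp (- \<delta> |x| powr s)\<close> converges in \<open>L\<^sup>2(\<nu>)\<close>.
\<close>

definition \<delta> :: real where "\<delta> = 1 / (2 * s)"

lemma \<delta>_pos: "0 < \<delta>" using s_pos by (simp add: \<delta>_def)

text \<open>With y = |x| powr s, squaring exp (\<delta> y) gives exp (y / s), and the weight exp (-
  2 y / s) still leaves the decay exp (- y / s).\<close>

lemma L2_exp:
  fixes g :: "real ^ 'n \<Rightarrow> real" and m C :: real
  assumes gm: "g \<in> borel_measurable borel" and m: "0 \<le> m" and C: "0 \<le> C"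
    and b: "\<And>x. x \<noteq> 0 \<Longrightarrow> \<bar>g x\<bar> \<le> C * norm x powr m * exp (\<delta> * norm x powr s)"
  shows "g \<in> L2"
proof -
  have "integrable lborel (\<lambda>x. wt s (s - 2 - 2 * b) x * (g x)\<^sup>2)"
  proof (rule integrable_powr_exp_bound[where p = "s - 2 - 2 * b + 2 * m" and c = "1 / s" and s = s and C = "C\<^sup>2" and n = 0])
    show "(\<lambda>x. wt s (s - 2 - 2 * b) x * (g x)\<^sup>2) \<in> borel_measurable borel" using gm by simp
    show "0 < s - 2 - 2 * b + 2 * m + real DIM(real ^ 'n)" using s_pos \<gamma>_nonneg m by (simp add: \<gamma>_eq)
    fix x :: "real ^ 'n"
    assume x: "x \<noteq> 0"
    have "(g x)\<^sup>2 \<le> (C * norm x powr m * exp (\<delta> * norm x powr s))\<^sup>2"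
      using b[OF x] by (simp add: abs_le_square_iff[symmetric])
    also have "\<dots> = C\<^sup>2 * norm x powr (2 * m) * exp (norm x powr s / s)"
    proof -
      have "(exp (\<delta> * norm x powr s))\<^sup>2 = exp (norm x powr s / s)"
        unfolding power2_eq_square exp_add[symmetric] by (simp add: \<delta>_def)
      moreover have "(norm x powr m)\<^sup>2 = norm x powr (2 * m)"
        using powr_nat_power[of "norm x" m 2] x by (simp add: mult.commute)
      ultimately show ?thesis by (simp add: power_mult_distrib)
    qed
    finally have "wt s (s - 2 - 2 * b) x * (g x)\<^sup>2 \<le> wt s (s - 2 - 2 * b) x * (C\<^sup>2 * norm x powr (2 * m) * exp (norm x powr s / s))"
      by (intro mult_left_mono) auto
    also have "\<dots> = C\<^sup>2 * (norm x powr (s - 2 - 2 * b) * norm x powr (2 * m)) * (exp (- (2 / s) * norm x powr s) * exp (norm x powr s / s))"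
      by (simp add: wt_def)
    also have "\<dots> = C\<^sup>2 * norm x powr (s - 2 - 2 * b + 2 * m) * exp (- (1 / s) * norm x powr s)"
      unfolding powr_add[symmetric] exp_add[symmetric] by (simp add: field_simps)
    finally show "\<bar>wt s (s - 2 - 2 * b) x * (g x)\<^sup>2\<bar> \<le> C\<^sup>2 * norm x powr (s - 2 - 2 * b + 2 * m) * (1 + norm x) ^ 0 * exp (- (1 / s) * norm x powr s)"
      by (simp add: abs_mult)
  qed (use s_pos in simp_all)
  then show ?thesis using gm integral_nu(2)[of "\<lambda>x. (g x)\<^sup>2"] by (simp add: L2_def)
qed

lemma ps_measurable: "harm k h \<Longrightarrow> ps k j h \<in> borel_measurable borel"
  using G_measurable(1)[OF ps_G] .

lemma ps_bound:
  assumes "harm k h"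
  obtains C where "0 \<le> C" "\<And>x. x \<noteq> 0 \<Longrightarrow> \<bar>ps k j h x\<bar> \<le> C * norm x powr (mk k + s * real j)"
proof -
  have "hom k h" using assms by (simp add: harm_def)
  from psi_bound[OF this, of "mk k - k + s * real j"]
  obtain C where "0 \<le> C" "\<And>x. x \<noteq> 0 \<Longrightarrow> \<bar>psi (mk k - k + s * real j) h x\<bar> \<le> C * norm x powr (mk k - k + s * real j + k)"
    by blast
  then show ?thesis by (intro that[of C]) (simp_all add: ps_def)
qed

lemma ps_shift: "(norm x powr s) ^ i * ps k j h x = ps k (j + i) h x"
proof (cases "x = 0")
  case True
  then show ?thesis by (simp add: ps_def psi_def)
next
  case False
  then have "(norm x powr s) ^ i = norm x powr (s * real i)" by (intro powr_nat_power) simp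
  then show ?thesis by (simp add: ps_def psi_def mult.assoc[symmetric] powr_add[symmetric] algebra_simps)
qed

text \<open>Induction on q with j arbitrary: only one factor exp (- \<delta> y) is expanded at a
  time, because its majorant exp (\<delta> y) is in L2 whereas exp (q \<delta> y) is not for large
  q. The powers of y in the Taylor polynomials merely raise j, see \<open>ps_shift\<close>.\<close>

lemma appr_exp_ps:
  assumes h: "harm k h"
  shows "appr (\<lambda>x. exp (- real q * \<delta> * norm x powr s) * ps k j h x)"
proof (induction q arbitrary: j)
  case 0
  show ?case using appr_V[OF V_ps[OF h, of j]] by simp
next
  case (Suc q)
  define y where "y x = norm x powr s" for x :: "real ^ 'n"
  have y0: "0 \<le> y x" for x by (simp add: y_def)
  define F where "F n x = (\<Sum>i<n. ((- \<delta>) ^ i / fact i) * (exp (- real q * \<delta> * y x) * ps k (j + i) h x))" for n x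
  have F_eq: "F n x = (\<Sum>i<n. (- \<delta> * y x) ^ i /\<^sub>R fact i) * (exp (- real q * \<delta> * y x) * ps k j h x)" for n x
  proof -
    have "((- \<delta>) ^ i / fact i) * (exp (- real q * \<delta> * y x) * ps k (j + i) h x) =
      ((- \<delta> * y x) ^ i /\<^sub>R fact i) * (exp (- real q * \<delta> * y x) * ps k j h x)" for i
      unfolding ps_shift[symmetric] y_def[symmetric] power_mult_distrib by (simp add: divide_inverse mult_ac)
    then show ?thesis unfolding F_def sum_distrib_right by (simp only:)
  qed
  obtain C where C: "0 \<le> C" "\<And>x. x \<noteq> 0 \<Longrightarrow> \<bar>ps k j h x\<bar> \<le> C * norm x powr (mk k + s * real j)"
    using ps_bound[OF h, of j] by blast
  define W where "W x = exp (\<delta> * y x) * \<bar>ps k j h x\<bar>" for x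
  have ym: "y \<in> borel_measurable borel" unfolding y_def[abs_def] by measurable
  have pm: "ps k j h \<in> borel_measurable borel" by (rule ps_measurable[OF h])
  have "appr (\<lambda>x. exp (- real (Suc q) * \<delta> * y x) * ps k j h x)"
  proof (rule appr_seq[where F = F and W = W])
    show "appr (F n)" for n
      unfolding F_def[abs_def] using Suc.IH by (intro appr_sum appr_cmult) (simp add: y_def)
    show "(\<lambda>n. F n x) \<longlonglongrightarrow> exp (- real (Suc q) * \<delta> * y x) * ps k j h x" for x
    proof -
      have "(\<lambda>n. \<Sum>i<n. (- \<delta> * y x) ^ i /\<^sub>R fact i) \<longlonglongrightarrow> exp (- \<delta> * y x)"
        using exp_converges[of "- \<delta> * y x"] by (simp add: sums_def)
      then have "(\<lambda>n. F n x) \<longlonglongrightarrow> exp (- \<delta> * y x) * (exp (- real q * \<delta> * y x) * ps k j h x)"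
        unfolding F_eq by (rule tendsto_mult_right)
      moreover have "exp (- \<delta> * y x) * (exp (- real q * \<delta> * y x) * ps k j h x) = exp (- real (Suc q) * \<delta> * y x) * ps k j h x"
        unfolding mult.assoc[symmetric] exp_add[symmetric] by (simp add: algebra_simps)
      ultimately show ?thesis by (simp only:)
    qed
    show "(\<lambda>x. exp (- real (Suc q) * \<delta> * y x) * ps k j h x) \<in> borel_measurable borel"
      using ym pm by measurable
    show "\<bar>F n x\<bar> \<le> W x" for n x
    proof -
      have "\<bar>\<Sum>i<n. (- \<delta> * y x) ^ i /\<^sub>R fact i\<bar> \<le> (\<Sum>i<n. \<bar>(- \<delta> * y x) ^ i /\<^sub>R fact i\<bar>)" by (rule sum_abs)
      also have "\<dots> = (\<Sum>i<n. (\<delta> * y x) ^ i /\<^sub>R fact i)"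
        using y0[of x] \<delta>_pos by (intro sum.cong) (simp_all add: abs_mult power_abs)
      also have "\<dots> \<le> (\<Sum>i. (\<delta> * y x) ^ i /\<^sub>R fact i)"
        using y0[of x] \<delta>_pos by (intro sum_le_suminf summable_exp_generic) auto
      also have "\<dots> = exp (\<delta> * y x)" by (simp add: exp_def)
      finally have 1: "\<bar>\<Sum>i<n. (- \<delta> * y x) ^ i /\<^sub>R fact i\<bar> \<le> exp (\<delta> * y x)" .
      have "0 \<le> real q * \<delta> * y x" using y0[of x] \<delta>_pos by simp
      then have "exp (- real q * \<delta> * y x) \<le> 1" by simp
      then have 2: "\<bar>exp (- real q * \<delta> * y x) * ps k j h x\<bar> \<le> \<bar>ps k j h x\<bar>"
        unfolding abs_mult by (intro mult_left_le_one_le) auto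
      show ?thesis unfolding F_eq W_def abs_mult[of "sum _ _"] using 1 2 by (intro mult_mono) auto
    qed
    show "W \<in> L2"
    proof (rule L2_exp[where m = "mk k + s * real j" and C = C])
      show "W \<in> borel_measurable borel" unfolding W_def[abs_def] using ym pm by measurable
      show "0 \<le> mk k + s * real j" using mk_nonneg s_pos by simp
      show "\<bar>W x\<bar> \<le> C * norm x powr (mk k + s * real j) * exp (\<delta> * norm x powr s)" if "x \<noteq> 0" for x
        using mult_left_mono[OF C(2)[OF that], of "exp (\<delta> * y x)"] by (simp add: W_def y_def abs_mult mult_ac)
    qed (rule C(1))
  qed
  then show ?case by (simp add: y_def)
qed

text \<open>
  In the variable \<open>z = exp (- \<delta> |x| powr s)\<close> the function \<open>\<phi>\<close> becomes continuous on \<open>[0, 1]\<close>, where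
  polynomials in \<open>z\<close> are uniformly dense.
\<close>

lemma appr_radial:
  fixes \<phi> :: "real \<Rightarrow> real"
  assumes h: "harm k h" and cont: "continuous_on UNIV \<phi>" and R: "\<And>y. R \<le> y \<Longrightarrow> \<phi> y = 0"
  shows "appr (\<lambda>x. \<phi> (norm x powr s) * ps k 0 h x)"
proof -
  \<comment> \<open>The substitution y = - ln z / \<delta>, with z kept above exp (- \<delta> R) so
    that the logarithm is continuous up to z = 0; below that level the value is \<phi> R =
    0.\<close>
  define H where "H z = \<phi> (- ln (max z (exp (- \<delta> * R))) / \<delta>)" for z
  have H_cont: "continuous_on {0..1} H"
    unfolding H_def[abs_def]
  proof (intro continuous_on_compose2[OF cont] continuous_intros)
    show "\<forall>z\<in>{0..1}. max z (exp (- \<delta> * R)) \<noteq> 0" by (metis exp_gt_zero less_max_iff_disj less_numeral_extra(3))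
  qed (use \<delta>_pos in auto)
  have H_eq: "H (exp (- \<delta> * y)) = \<phi> y" for y
  proof (cases "y \<le> R")
    case True
    then have "max (exp (- \<delta> * y)) (exp (- \<delta> * R)) = exp (- \<delta> * y)" using \<delta>_pos by (simp add: max_def)
    then show ?thesis using \<delta>_pos by (simp add: H_def)
  next
    case False
    then have "max (exp (- \<delta> * y)) (exp (- \<delta> * R)) = exp (- \<delta> * R)" using \<delta>_pos by (simp add: max_def)
    then show ?thesis using \<delta>_pos False R[of R] R[of y] by (simp add: H_def)
  qed
  have "\<exists>g. real_polynomial_function g \<and> (\<forall>z\<in>{0..1}. \<bar>H z - g z\<bar> < 1 / real (Suc n))" for n
    using Stone_Weierstrass_real_polynomial_function[OF compact_Icc H_cont, of "1 / real (Suc n)"]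
    by (metis of_nat_0_less_iff zero_less_Suc zero_less_divide_1_iff)
  then obtain g where g: "\<And>n. real_polynomial_function (g n)"
    "\<And>n z. z \<in> {0..1} \<Longrightarrow> \<bar>H z - g n z\<bar> < 1 / real (Suc n)" by metis
  define z where "z x = exp (- \<delta> * norm x powr s)" for x :: "real ^ 'n"
  have z01: "z x \<in> {0..1}" for x using \<delta>_pos by (simp add: z_def)
  have Hz: "H (z x) = \<phi> (norm x powr s)" for x unfolding z_def by (rule H_eq)
  obtain M where "\<forall>y\<in>H ` {0..1}. norm y \<le> M"
    using compact_imp_bounded[OF compact_continuous_image[OF H_cont compact_Icc]]
    unfolding bounded_iff by blast
  then have M: "\<bar>H z\<bar> \<le> M" if "z \<in> {0..1}" for z using imageI[OF that, of H] by (metis real_norm_def)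
  show ?thesis
  proof (rule appr_seq[where F = "\<lambda>n x. g n (z x) * ps k 0 h x" and W = "\<lambda>x. (M + 1) * \<bar>ps k 0 h x\<bar>"])
    show "appr (\<lambda>x. g n (z x) * ps k 0 h x)" for n
    proof -
      obtain c d where "g n = (\<lambda>x. \<Sum>i\<le>d. c i * x ^ i)"
        using g(1)[of n] unfolding real_polynomial_function_iff_sum by blast
      moreover have "z x ^ i = exp (- real i * \<delta> * norm x powr s)" for x i
        unfolding z_def exp_of_nat_mult[symmetric] by (simp add: mult_ac)
      ultimately have "(\<lambda>x. g n (z x) * ps k 0 h x) = (\<lambda>x. \<Sum>i\<le>d. c i * (exp (- real i * \<delta> * norm x powr s) * ps k 0 h x))"
        by (simp add: sum_distrib_right mult.assoc)
      moreover have "appr (\<lambda>x. \<Sum>i\<le>d. c i * (exp (- real i * \<delta> * norm x powr s) * ps k 0 h x))"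
        by (intro appr_sum appr_cmult appr_exp_ps h)
      ultimately show ?thesis by (simp only:)
    qed
    have glim: "(\<lambda>n. g n (z x)) \<longlonglongrightarrow> H (z x)" for x
    proof (rule LIM_zero_cancel, rule Lim_null_comparison)
      show "\<forall>\<^sub>F n in sequentially. norm (g n (z x) - H (z x)) \<le> 1 / real (Suc n)"
        using g(2)[OF z01[of x]] by (intro always_eventually allI) (simp add: abs_minus_commute less_imp_le)
      show "(\<lambda>n. 1 / real (Suc n)) \<longlonglongrightarrow> 0" using LIMSEQ_inverse_real_of_nat by (simp add: inverse_eq_divide)
    qed
    show "(\<lambda>n. g n (z x) * ps k 0 h x) \<longlonglongrightarrow> \<phi> (norm x powr s) * ps k 0 h x" for x
      using tendsto_mult_right[OF glim[of x], of "ps k 0 h x"] by (simp only: Hz)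
    have "\<phi> \<in> borel_measurable borel" using cont by (rule borel_measurable_continuous_onI)
    then show "(\<lambda>x. \<phi> (norm x powr s) * ps k 0 h x) \<in> borel_measurable borel"
      using ps_measurable[OF h, of 0] by measurable
    show "\<bar>g n (z x) * ps k 0 h x\<bar> \<le> (M + 1) * \<bar>ps k 0 h x\<bar>" for n x
    proof -
      have "1 / real (Suc n) \<le> 1" by simp
      then have "\<bar>g n (z x)\<bar> \<le> M + 1" using g(2)[OF z01[of x], of n] M[OF z01[of x]] by linarith
      then show ?thesis unfolding abs_mult by (intro mult_right_mono) auto
    qed
    show "(\<lambda>x. (M + 1) * \<bar>ps k 0 h x\<bar>) \<in> L2"
      by (intro L2_cmult L2_abs G_L2 ps_G h)
  qed
qed

text \<open>A tent in ln |x|, supported in exp (- n - 1) <= |x| <= exp (n + 1). Continuity suffices,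
  as only L2 limits are taken with it; the value 0 at the origin makes the identity in
  \<open>appr_chi_harmonic\<close> hold at every point.\<close>

definition chi :: "nat \<Rightarrow> real ^ 'n \<Rightarrow> real" where
  "chi n x = (if x = 0 then 0 else max 0 (1 - \<bar>ln (norm x)\<bar> / real (Suc n)))"

lemma chi_bounds: "0 \<le> chi n x" "chi n x \<le> 1"
  by (auto simp: chi_def)

lemma chi_measurable: "chi n \<in> borel_measurable borel"
  unfolding chi_def[abs_def] by measurable

lemma chi_limit: "x \<noteq> 0 \<Longrightarrow> (\<lambda>n. chi n x) \<longlonglongrightarrow> 1"
proof -
  assume x: "x \<noteq> 0"
  have "(\<lambda>n. \<bar>ln (norm x)\<bar> / real (Suc n)) \<longlonglongrightarrow> 0"
    using tendsto_mult[OF tendsto_const[of "\<bar>ln (norm x)\<bar>"] LIMSEQ_inverse_real_of_nat] by (simp add: divide_inverse)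
  then have "(\<lambda>n. max 0 (1 - \<bar>ln (norm x)\<bar> / real (Suc n))) \<longlonglongrightarrow> max 0 (1 - 0)"
    by (intro tendsto_intros)
  then show ?thesis using x by (simp add: chi_def)
qed

lemma chi_support: "norm x > exp (real (Suc n)) \<Longrightarrow> chi n x = 0"
proof -
  assume x: "norm x > exp (real (Suc n))"
  then have "0 < norm x" using exp_gt_zero[of "real (Suc n)"] by linarith
  then have "ln (norm x) > real (Suc n)" using x by (metis exp_less_cancel_iff exp_ln)
  then have "1 \<le> \<bar>ln (norm x)\<bar> / real (Suc n)" by (simp add: le_divide_eq)
  then show ?thesis by (simp add: chi_def)
qed

text \<open>The degree 2 j + l of the polynomial differs from the degree \<open>mk l\<close> of
  \<open>ps l 0 h\<close>, in general by an unrelated real exponent. The radial function \<phi>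
  absorbs the difference, which is possible with a continuous \<phi> because the cutoff removes the
  origin.\<close>

lemma appr_chi_harmonic:
  assumes h: "harm l h"
  shows "appr (\<lambda>x. chi n x * (norm x ^ (2 * j) * h x))"
proof -
  \<comment> \<open>The value of |x| powr s at the inner edge of the support of
    \<open>chi n\<close>.\<close>
  define \<epsilon> where "\<epsilon> = exp (- (s * real (Suc n)))"
  \<comment> \<open>Chosen so that s c + mk l - l = 2 j.\<close>
  define c where "c = (2 * real j + real l - mk l) / s"
  define \<phi> where "\<phi> y = max 0 (1 - \<bar>ln (max y \<epsilon>)\<bar> / (s * real (Suc n))) * max y \<epsilon> powr c" for y
  have e0: "0 < \<epsilon>" by (simp add: \<epsilon>_def)
  then have e1: "max y \<epsilon> \<noteq> 0" for y by (metis less_max_iff_disj less_numeral_extra(3))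
  have sn: "0 < s * real (Suc n)" using s_pos by simp
  have "continuous_on UNIV \<phi>"
    unfolding \<phi>_def[abs_def] using e1 sn by (intro continuous_intros) auto
  moreover have "\<phi> y = 0" if "exp (s * real (Suc n)) \<le> y" for y
  proof -
    have "\<epsilon> \<le> exp (s * real (Suc n))" using sn by (simp add: \<epsilon>_def)
    then have "max y \<epsilon> = y" using that by simp
    moreover have "s * real (Suc n) \<le> ln y" using that by (metis exp_gt_zero ln_exp ln_le_cancel_iff less_le_trans)
    then have "1 \<le> \<bar>ln y\<bar> / (s * real (Suc n))" using sn by (simp add: le_divide_eq)
    ultimately show ?thesis by (simp add: \<phi>_def)
  qed
  ultimately have "appr (\<lambda>x. \<phi> (norm x powr s) * ps l 0 h x)" by (rule appr_radial[OF h])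
  moreover have "\<phi> (norm x powr s) * ps l 0 h x = chi n x * (norm x ^ (2 * j) * h x)" for x
  proof (cases "x = 0")
    case True
    then show ?thesis by (simp add: ps_def psi_def chi_def)
  next
    case False
    show ?thesis
    proof (cases "norm x powr s \<le> \<epsilon>")
      case True
      have "ln (norm x powr s) \<le> ln \<epsilon>" using True False e0 by (subst ln_le_cancel_iff) auto
      then have "s * ln (norm x) \<le> s * (- real (Suc n))" using False by (simp add: ln_powr \<epsilon>_def del: of_nat_Suc)
      then have "ln (norm x) \<le> - real (Suc n)" using s_pos mult_le_cancel_left_pos by blast
      then have "real (Suc n) \<le> \<bar>ln (norm x)\<bar>" by linarith
      then have "1 \<le> \<bar>ln (norm x)\<bar> / real (Suc n)" by (simp add: le_divide_eq del: of_nat_Suc)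
      then have "chi n x = 0" by (simp add: chi_def)
      moreover have "\<phi> (norm x powr s) = 0"
      proof -
        have "max (norm x powr s) \<epsilon> = \<epsilon>" using True by simp
        moreover have "\<bar>ln \<epsilon>\<bar> = s * real (Suc n)" using sn by (simp add: \<epsilon>_def del: of_nat_Suc)
        then have "\<bar>ln \<epsilon>\<bar> / (s * real (Suc n)) = 1" 
          using less_imp_neq[OF sn, symmetric] by (simp only: divide_self_if if_False)
        ultimately show ?thesis by (simp only: \<phi>_def) simp
      qed
      ultimately show ?thesis by simp
    next
      case F2: False
      then have m: "max (norm x powr s) \<epsilon> = norm x powr s" by simp
      have "\<bar>ln (norm x powr s)\<bar> / (s * real (Suc n)) = \<bar>ln (norm x)\<bar> / real (Suc n)"
        using False s_pos by (simp add: ln_powr abs_mult del: of_nat_Suc)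
      then have "\<phi> (norm x powr s) = chi n x * norm x powr (s * c)"
        using False by (simp add: \<phi>_def m chi_def powr_powr)
      moreover have "norm x powr (s * c) * ps l 0 h x = norm x ^ (2 * j) * h x"
      proof -
        have "s * c + (mk l - l + s * real 0) = real (2 * j)" using s_pos by (simp add: c_def)
        then have "norm x powr (s * c) * norm x powr (mk l - l + s * real 0) = norm x powr real (2 * j)"
          unfolding powr_add[symmetric] by (simp only:)
        also have "\<dots> = norm x ^ (2 * j)" using False by (intro powr_realpow) simp
        finally show ?thesis unfolding ps_def psi_def mult.assoc[symmetric] by (simp only:)
      qed
      ultimately show ?thesis by (simp only: mult.assoc)
    qed
  qed
  ultimately show ?thesis by (simp only:)
qed

lemma appr_chi_graded:
  assumes "graded p"
  shows "appr (\<lambda>x. chi n x * p x)"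
  using assms
proof (induction rule: graded.induct)
  case (graded_hom k f)
  then have "harmonic_sum k f" by (rule hom_imp_harmonic_sum)
  then show ?case
  proof (induction rule: harmonic_sum.induct)
    case (harmonic_sum_zero k)
    then show ?case using appr_V[OF V_zero] by simp
  next
    case (harmonic_sum_base l h j)
    then show ?case by (rule appr_chi_harmonic)
  next
    case (harmonic_sum_add k f g)
    then show ?case using appr_add by (simp add: distrib_left)
  qed
next
  case (graded_add f g)
  then show ?case using appr_add by (simp add: distrib_left)
qed

lemma L2_const: "(\<lambda>x. c) \<in> L2" by (rule G_L2[OF G_const])

text \<open>Two nested limits: the outer one removes the cutoff; the inner one, for a fixed cutoff,
  approximates v uniformly on its ball by polynomials, which \<open>appr_chi_graded\<close> handles
  after multiplication by \<open>chi n\<close>.\<close>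

lemma appr_continuous_bounded:
  fixes v :: "real ^ 'n \<Rightarrow> real"
  assumes v: "continuous_on UNIV v" and M: "\<And>x. \<bar>v x\<bar> \<le> M"
  shows "appr v"
proof (rule appr_seq[where F = "\<lambda>n x. chi n x * v x" and W = "\<lambda>x. M"])
  have vm: "v \<in> borel_measurable borel" using v by (rule borel_measurable_continuous_onI)
  then show "v \<in> borel_measurable borel" .
  show "\<bar>chi n x * v x\<bar> \<le> M" for n x
    using mult_mono[OF chi_bounds(2)[of n x] M[of x]] chi_bounds(1)[of n x] by (simp add: abs_mult)
  show "(\<lambda>n. chi n x * v x) \<longlonglongrightarrow> v x" if "x \<noteq> 0" for x
    using tendsto_mult_right[OF chi_limit[OF that], of "v x"] by simp
  show "appr (\<lambda>x. chi n x * v x)" for n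
  proof -
    let ?K = "cball (0 :: real ^ 'n) (exp (real (Suc n)))"
    have "\<exists>p. real_polynomial_function p \<and> (\<forall>x\<in>?K. \<bar>v x - p x\<bar> < 1 / real (Suc i))" for i
      using Stone_Weierstrass_real_polynomial_function[OF compact_cball continuous_on_subset[OF v subset_UNIV], of "1 / real (Suc i)"]
      by (metis of_nat_0_less_iff zero_less_Suc zero_less_divide_1_iff)
    then obtain p where p: "\<And>i. real_polynomial_function (p i)"
      "\<And>i x. x \<in> ?K \<Longrightarrow> \<bar>v x - p i x\<bar> < 1 / real (Suc i)" by metis
    show ?thesis
    proof (rule appr_seq[where F = "\<lambda>i x. chi n x * p i x" and W = "\<lambda>x. M + 1"])
      show "appr (\<lambda>x. chi n x * p i x)" for i
        by (intro appr_chi_graded real_polynomial_function_imp_graded p(1))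
      show "(\<lambda>x. chi n x * v x) \<in> borel_measurable borel" using chi_measurable vm by measurable
      show "(\<lambda>i. chi n x * p i x) \<longlonglongrightarrow> chi n x * v x" for x
      proof (cases "x \<in> ?K")
        case True
        have "(\<lambda>i. p i x) \<longlonglongrightarrow> v x"
        proof (rule LIM_zero_cancel, rule Lim_null_comparison)
          show "\<forall>\<^sub>F i in sequentially. norm (p i x - v x) \<le> 1 / real (Suc i)"
            using p(2)[OF True] by (intro always_eventually allI) (simp add: abs_minus_commute less_imp_le)
          show "(\<lambda>n. 1 / real (Suc n)) \<longlonglongrightarrow> 0" using LIMSEQ_inverse_real_of_nat by (simp add: inverse_eq_divide)
        qed
        then show ?thesis by (rule tendsto_mult_left)
      next
        case False
        then have "chi n x = 0" by (intro chi_support) simp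
        then show ?thesis by simp
      qed
      show "\<bar>chi n x * p i x\<bar> \<le> M + 1" for i x
      proof (cases "x \<in> ?K")
        case True
        have "1 / real (Suc i) \<le> 1" by simp
        then have "\<bar>p i x\<bar> \<le> M + 1" using p(2)[OF True, of i] M[of x] by linarith
        then show ?thesis using mult_mono[OF chi_bounds(2)[of n x], of "\<bar>p i x\<bar>" "M + 1"] chi_bounds(1)[of n x]
          by (simp add: abs_mult)
      next
        case False
        then have "chi n x = 0" by (intro chi_support) simp
        then show ?thesis using M[of x] by simp
      qed
    qed (rule L2_const)
  qed
qed (rule L2_const)


section \<open>Spectral gap\<close>

lemma I_square_diff:
  assumes f: "f \<in> G" and g: "g \<in> G"
  shows "I (\<lambda>x. f x - g x) (\<lambda>x. f x - g x) = I f f - 2 * I f g + I g g"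
proof -
  have fg: "(\<lambda>x. f x - g x) \<in> G" by (rule G_diff[OF f g])
  show ?thesis
    unfolding I_diff[OF f g fg] I_commute[of f "\<lambda>x. f x - g x"] I_commute[of g "\<lambda>x. f x - g x"]
      I_diff[OF f g f] I_diff[OF f g g] I_commute[of g f] by simp
qed

lemma I_square_add:
  assumes f: "f \<in> G" and g: "g \<in> G"
  shows "I (\<lambda>x. f x + g x) (\<lambda>x. f x + g x) = I f f + 2 * I f g + I g g"
proof -
  have fg: "(\<lambda>x. f x + g x) \<in> G" by (rule G_add[OF f g])
  show ?thesis
    unfolding I_add[OF f g fg] I_commute[of f "\<lambda>x. f x + g x"] I_commute[of g "\<lambda>x. f x + g x"]
      I_add[OF f g f] I_add[OF f g g] I_commute[of g f] by simp
qed

lemma B_square_diff: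
  assumes f: "f \<in> G" and g: "g \<in> G"
  shows "B (\<lambda>x. f x - g x) (\<lambda>x. f x - g x) = B f f - 2 * B f g + B g g"
proof -
  have fg: "(\<lambda>x. f x - g x) \<in> G" by (rule G_diff[OF f g])
  show ?thesis
    unfolding B_diff[OF f g fg] B_commute[of f "\<lambda>x. f x - g x"] B_commute[of g "\<lambda>x. f x - g x"]
      B_diff[OF f g f] B_diff[OF f g g] B_commute[of g f] by simp
qed

lemma B_square_add:
  assumes f: "f \<in> G" and g: "g \<in> G"
  shows "B (\<lambda>x. f x + g x) (\<lambda>x. f x + g x) = B f f + 2 * B f g + B g g"
proof -
  have fg: "(\<lambda>x. f x + g x) \<in> G" by (rule G_add[OF f g])
  show ?thesis
    unfolding B_add[OF f g fg] B_commute[of f "\<lambda>x. f x + g x"] B_commute[of g "\<lambda>x. f x + g x"]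
      B_add[OF f g f] B_add[OF f g g] B_commute[of g f] by simp
qed

text \<open>The degenerate case of Cauchy-Schwarz. It justifies the quotients by
  \<open>I g g\<close> in later projections, where the default value of a division by 0 is then a
  correct coefficient.\<close>

lemma I_null:
  assumes f: "f \<in> G" and g: "g \<in> G" and z: "I g g = 0"
  shows "I f g = 0"
proof (rule ccontr)
  assume nz: "I f g \<noteq> 0"
  \<comment> \<open>Makes 2 t I f g = I f f + 1, so that the quadratic below takes the value
    -1.\<close>
  define t where "t = (I f f + 1) / (2 * I f g)"
  have "0 \<le> I (\<lambda>x. f x - t * g x) (\<lambda>x. f x - t * g x)" by (rule I_nonneg)
  also have "\<dots> = I f f - 2 * (t * I f g) + t\<^sup>2 * I g g"
    unfolding I_square_diff[OF f G_cmult[OF g]] I_cmult2 I_commute[of f "\<lambda>x. t * g x"] I_cmult I_commute[of g f] by simp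
  also have "\<dots> = - 1"
  proof -
    have "2 * (t * I f g) = I f f + 1" using nz by (simp add: t_def)
    then show ?thesis using z by simp
  qed
  finally show False by simp
qed

text \<open>Either the eigenvalue reaches the threshold \<open>l2\<close>, or the component is
  invisible to w; the alternative depends on l in such a way that it survives sums for a fixed
  eigenvalue.\<close>

definition good :: "real \<Rightarrow> (real ^ 'n \<Rightarrow> real) \<Rightarrow> real \<Rightarrow> (real ^ 'n \<Rightarrow> real) \<Rightarrow> bool" where
  "good l2 w l f \<longleftrightarrow> eigen l f \<and> (l2 \<le> l \<or> I f w = 0)"

text \<open>Summands are indexed by their eigenvalue, everything of equal eigenvalue being collected
  in one function. Different summands are then orthogonal by \<open>eigen_orthogonal\<close>, and no
  orthonormal basis of harmonic polynomials has to be chosen.\<close>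

definition decomposes :: "real \<Rightarrow> (real ^ 'n \<Rightarrow> real) \<Rightarrow> (real ^ 'n \<Rightarrow> real) \<Rightarrow> bool" where
  "decomposes l2 w \<Phi> \<longleftrightarrow> (\<exists>\<Lambda> e. finite \<Lambda> \<and> (\<forall>l. good l2 w l (e l)) \<and> \<Phi> = (\<lambda>x. \<Sum>l\<in>\<Lambda>. e l x))"

lemma good_zero: "good l2 w l (\<lambda>x. 0)"
  by (simp add: good_def eigen_zero I_def)

lemma good_add:
  assumes "w \<in> G" "good l2 w l f" "good l2 w l g"
  shows "good l2 w l (\<lambda>x. f x + g x)"
  using assms unfolding good_def by (auto simp: eigen_add I_add eigenD(1))

lemma decomposes_good:
  assumes "good l2 w l f"
  shows "decomposes l2 w f"
  unfolding decomposes_def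
proof (intro exI conjI)
  show "finite {l}" by simp
  show "\<forall>l'. good l2 w l' (if l' = l then f else (\<lambda>x. 0))" using assms good_zero by simp
  show "f = (\<lambda>x. \<Sum>l'\<in>{l}. (if l' = l then f else (\<lambda>x. 0)) x)" by simp
qed

lemma decomposes_add:
  assumes w: "w \<in> G" and "decomposes l2 w f" "decomposes l2 w g"
  shows "decomposes l2 w (\<lambda>x. f x + g x)"
proof -
  obtain \<Lambda> e where e: "finite \<Lambda>" "\<forall>l. good l2 w l (e l)" "f = (\<lambda>x. \<Sum>l\<in>\<Lambda>. e l x)"
    using assms(2) unfolding decomposes_def by (elim exE conjE)
  obtain \<Lambda>' e' where e': "finite \<Lambda>'" "\<forall>l. good l2 w l (e' l)" "g = (\<lambda>x. \<Sum>l\<in>\<Lambda>'. e' l x)"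
    using assms(3) unfolding decomposes_def by (elim exE conjE)
  define u where "u l = (if l \<in> \<Lambda> then e l else (\<lambda>x. 0))" for l
  define u' where "u' l = (if l \<in> \<Lambda>' then e' l else (\<lambda>x. 0))" for l
  have "(\<Sum>l\<in>\<Lambda>. e l x) = (\<Sum>l\<in>\<Lambda> \<union> \<Lambda>'. u l x)" for x
    using e(1) e'(1) by (intro sum.mono_neutral_cong_left) (auto simp: u_def)
  moreover have "(\<Sum>l\<in>\<Lambda>'. e' l x) = (\<Sum>l\<in>\<Lambda> \<union> \<Lambda>'. u' l x)" for x
    using e(1) e'(1) by (intro sum.mono_neutral_cong_left) (auto simp: u'_def)
  ultimately have "(\<lambda>x. f x + g x) = (\<lambda>x. \<Sum>l\<in>\<Lambda> \<union> \<Lambda>'. (\<lambda>x. u l x + u' l x) x)"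
    unfolding e(3) e'(3) by (simp add: sum.distrib)
  moreover have "\<forall>l. good l2 w l (\<lambda>x. u l x + u' l x)"
    using e(2) e'(2) by (intro allI good_add[OF w]) (simp_all add: u_def u'_def good_zero)
  ultimately show ?thesis
    unfolding decomposes_def using e(1) e'(1)
    by (intro exI[of _ "\<Lambda> \<union> \<Lambda>'"] exI[of _ "\<lambda>l x. u l x + u' l x"] conjI) simp_all
qed

lemma decomposes_sum:
  assumes w: "w \<in> G"
  shows "(\<And>i. i \<in> J \<Longrightarrow> decomposes l2 w (f i)) \<Longrightarrow> decomposes l2 w (\<lambda>x. \<Sum>i\<in>J. f i x)"
proof (induction J rule: infinite_finite_induct)
  case (insert i J)
  then show ?case using decomposes_add[OF w, of l2 "f i" "\<lambda>x. \<Sum>i\<in>J. f i x"] by simp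
qed (simp_all add: decomposes_good[OF good_zero])

lemma V_decomposes:
  assumes w: "w \<in> G"
    and low: "\<And>k j h. harm k h \<Longrightarrow> 2 * (mk k + s * real j) < l2 \<Longrightarrow> I (ps k j h) w = 0"
    and "V \<Phi>"
  shows "decomposes l2 w \<Phi>"
  using \<open>V \<Phi>\<close>
proof (induction rule: V.induct)
  case V_zero
  show ?case by (rule decomposes_good[OF good_zero])
next
  case (V_ps k h j)
  obtain e where e: "\<And>i. i \<le> j \<Longrightarrow> eigen (2 * (mk k + s * real i)) (e i)"
    and orth: "\<And>i. i \<le> j \<Longrightarrow> (\<forall>i'\<le>i. I (ps k i' h) w = 0) \<Longrightarrow> I (e i) w = 0"
    and sum: "ps k j h = (\<lambda>x. \<Sum>i\<le>j. e i x)"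
    using ps_eigen_decomposition[OF V_ps, of j] w by (elim exE conjE) (rule that, simp_all)
  have "good l2 w (2 * (mk k + s * real i)) (e i)" if i: "i \<le> j" for i
  proof (cases "l2 \<le> 2 * (mk k + s * real i)")
    case True
    then show ?thesis using e[OF i] by (simp add: good_def)
  next
    case False
    \<comment> \<open>The eigenvalue grows with i, so all indices up to i lie below the threshold
      together with i.\<close>
    have "I (ps k i' h) w = 0" if "i' \<le> i" for i'
    proof (rule low[OF V_ps])
      have "2 * (mk k + s * real i') \<le> 2 * (mk k + s * real i)" using s_pos that by simp
      also have "\<dots> < l2" using False by (simp only: not_le)
      finally show "2 * (mk k + s * real i') < l2" .
    qed
    then show ?thesis using e[OF i] orth[OF i] by (simp add: good_def)
  qed
  then show ?case unfolding sum by (intro decomposes_sum[OF w] decomposes_good) simp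
next
  case (V_add f g)
  then show ?case by (intro decomposes_add[OF w])
qed

text \<open>Only L2 closeness of \<Phi> to w is available, not closeness in energy. The energy is
  therefore bounded below through the projection of w onto the eigenfunctions occurring in \<Phi>,
  while \<Phi> itself only guarantees that this projection carries almost all of
  \<open>I w w\<close>.\<close>

theorem spectral_gap:
  assumes w: "w \<in> G" and appr: "appr w" and l2: "0 \<le> l2"
    and low: "\<And>k j h. harm k h \<Longrightarrow> 2 * (mk k + s * real j) < l2 \<Longrightarrow> I (ps k j h) w = 0"
  shows "l2 * I w w \<le> B w w"
proof -
  have approx: "l2 * (I w w - \<epsilon>) \<le> B w w" if \<epsilon>: "0 < \<epsilon>" for \<epsilon>
  proof -
    obtain \<Phi> where \<Phi>: "V \<Phi>" "I (\<lambda>x. w x - \<Phi> x) (\<lambda>x. w x - \<Phi> x) < \<epsilon>" by (rule apprE[OF appr \<epsilon>])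
    have "decomposes l2 w \<Phi>" by (rule V_decomposes[OF w low \<Phi>(1)])
    then obtain \<Lambda> e where fin: "finite \<Lambda>" and good: "\<forall>l. good l2 w l (e l)" and sum: "\<Phi> = (\<lambda>x. \<Sum>l\<in>\<Lambda>. e l x)"
      unfolding decomposes_def by (elim exE conjE)
    have eig: "eigen l (e l)" for l using good by (simp add: good_def)
    have eG: "e l \<in> G" for l using eigenD(1)[OF eig] .
    have orth: "I (e l) (e l') = 0" if "l \<noteq> l'" for l l' by (rule eigen_orthogonal[OF eig eig that])
    define n where "n l = I (e l) (e l)" for l
    have n0: "0 \<le> n l" for l unfolding n_def by (rule I_nonneg)
    \<comment> \<open>The Fourier coefficient; if \<open>e l\<close> is a null function it is 0 by
      division by zero, consistently with \<open>I_null\<close>.\<close>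
    define c where "c l = I (e l) w / n l" for l
    have cn: "c l * n l = I (e l) w" for l
      using I_null[OF w eG, of l] by (cases "n l = 0") (simp_all add: c_def n_def I_commute[of _ w])
    define \<phi> where "\<phi> = (\<lambda>x. \<Sum>l\<in>\<Lambda>. c l * e l x)"
    have \<phi>G: "\<phi> \<in> G" unfolding \<phi>_def by (intro G_sum G_cmult eG)
    have I\<phi>: "I \<phi> g = (\<Sum>l\<in>\<Lambda>. c l * I (e l) g)" if "g \<in> G" for g
      unfolding \<phi>_def by (subst I_sum) (simp_all add: I_cmult G_cmult eG that)
    have B\<phi>: "B \<phi> g = (\<Sum>l\<in>\<Lambda>. c l * (l * I (e l) g))" if g: "g \<in> G" for g
    proof -
      have "B (e l) g = l * I (e l) g" for l
        using eigenD(2)[OF eig g] by (simp only: B_commute[of g] I_commute[of g])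
      then show ?thesis unfolding \<phi>_def by (subst B_sum) (simp_all add: B_cmult[OF eG g] G_cmult eG g)
    qed
    have I\<phi>e: "I (e l) \<phi> = c l * n l" if "l \<in> \<Lambda>" for l
    proof -
      have "I \<phi> (e l) = (\<Sum>l'\<in>\<Lambda>. if l' = l then c l * n l else 0)"
        unfolding I\<phi>[OF eG] by (rule sum.cong) (auto simp: orth n_def)
      then show ?thesis using that fin by (simp add: I_commute[of _ \<phi>])
    qed
    define S where "S = (\<Sum>l\<in>\<Lambda>. (c l)\<^sup>2 * n l)"
    \<comment> \<open>The projection is the best approximation in the span of the
      \<open>e l\<close>, so its defect is at most the error of \<Phi>.\<close>
    have "I w w - S \<le> I (\<lambda>x. w x - \<Phi> x) (\<lambda>x. w x - \<Phi> x)"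
    proof -
      have \<Phi>G: "\<Phi> \<in> G" by (rule V_G[OF \<Phi>(1)])
      have I\<Phi>: "I \<Phi> g = (\<Sum>l\<in>\<Lambda>. I (e l) g)" if "g \<in> G" for g
        unfolding sum by (rule I_sum) (simp_all add: eG that)
      have "I (e l) \<Phi> = n l" if "l \<in> \<Lambda>" for l
      proof -
        have "I \<Phi> (e l) = (\<Sum>l'\<in>\<Lambda>. if l' = l then n l else 0)"
          unfolding I\<Phi>[OF eG] by (rule sum.cong) (auto simp: orth n_def)
        then show ?thesis using that fin by (simp add: I_commute[of _ \<Phi>])
      qed
      then have "I \<Phi> \<Phi> = (\<Sum>l\<in>\<Lambda>. n l)" unfolding I\<Phi>[OF \<Phi>G] by simp
      moreover have "I w \<Phi> = (\<Sum>l\<in>\<Lambda>. c l * n l)" unfolding I_commute[of w] I\<Phi>[OF w] cn ..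
      ultimately have "I (\<lambda>x. w x - \<Phi> x) (\<lambda>x. w x - \<Phi> x) = I w w - 2 * (\<Sum>l\<in>\<Lambda>. c l * n l) + (\<Sum>l\<in>\<Lambda>. n l)"
        unfolding I_square_diff[OF w \<Phi>G] by simp
      also have "\<dots> = I w w - S + (\<Sum>l\<in>\<Lambda>. (c l - 1)\<^sup>2 * n l)"
        unfolding S_def by (simp add: power2_eq_square algebra_simps sum.distrib sum_subtractf sum_distrib_left)
      also have "\<dots> \<ge> I w w - S"
        using n0 by (simp add: sum_nonneg)
      finally show ?thesis .
    qed
    then have S: "I w w - \<epsilon> \<le> S" using \<Phi>(2) by linarith
    have Bw: "B w \<phi> = (\<Sum>l\<in>\<Lambda>. l * ((c l)\<^sup>2 * n l))"
      unfolding B_commute[of w] B\<phi>[OF w] cn[symmetric] by (rule sum.cong) (simp_all add: power2_eq_square)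
    have Bp: "B \<phi> \<phi> = (\<Sum>l\<in>\<Lambda>. l * ((c l)\<^sup>2 * n l))"
      unfolding B\<phi>[OF \<phi>G] by (rule sum.cong) (simp_all add: I\<phi>e power2_eq_square)
    \<comment> \<open>Bessel's inequality for \<open>B\<close>: the cross term
      \<open>B w \<phi>\<close> equals \<open>B \<phi> \<phi>\<close>, since both are computed from
      the same coefficients on eigenfunctions.\<close>
    have "0 \<le> B (\<lambda>x. w x - \<phi> x) (\<lambda>x. w x - \<phi> x)" by (rule B_nonneg)
    then have "(\<Sum>l\<in>\<Lambda>. l * ((c l)\<^sup>2 * n l)) \<le> B w w"
      unfolding B_square_diff[OF w \<phi>G] Bw Bp by simp
    moreover have "l2 * S \<le> (\<Sum>l\<in>\<Lambda>. l * ((c l)\<^sup>2 * n l))"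
      unfolding S_def sum_distrib_left
    proof (rule sum_mono)
      fix l
      show "l2 * ((c l)\<^sup>2 * n l) \<le> l * ((c l)\<^sup>2 * n l)"
      proof (cases "l2 \<le> l")
        case True
        then show ?thesis using n0[of l] by (intro mult_right_mono) simp_all
      next
        case False
        then have "I (e l) w = 0" using good by (auto simp: good_def)
        then show ?thesis by (simp add: c_def)
      qed
    qed
    moreover have "l2 * (I w w - \<epsilon>) \<le> l2 * S" using S l2 by (rule mult_left_mono)
    ultimately show ?thesis by linarith
  qed
  have "((\<lambda>\<epsilon>. l2 * (I w w - \<epsilon>)) \<longlongrightarrow> l2 * (I w w - 0)) (at_right 0)"
    by (intro tendsto_intros)
  moreover have "\<forall>\<^sub>F \<epsilon> in at_right 0. l2 * (I w w - \<epsilon>) \<le> B w w"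
    unfolding eventually_at_right_field by (intro exI[of _ 1]) (auto intro: approx)
  ultimately have "l2 * (I w w - 0) \<le> B w w"
    by (intro tendsto_upperbound[of "\<lambda>\<epsilon>. l2 * (I w w - \<epsilon>)" _ "at_right 0"]) simp_all
  then show ?thesis by simp
qed

section \<open>Orthogonal projection onto finite-dimensional subspaces\<close>

definition lin :: "(real ^ 'n \<Rightarrow> real) set \<Rightarrow> bool" where
  "lin S \<longleftrightarrow> S \<subseteq> G \<and> (\<lambda>x. 0) \<in> S \<and> (\<forall>f\<in>S. \<forall>g\<in>S. (\<lambda>x. f x + g x) \<in> S) \<and> (\<forall>f\<in>S. \<forall>c. (\<lambda>x. c * f x) \<in> S)"

definition projectable :: "(real ^ 'n \<Rightarrow> real) set \<Rightarrow> bool" where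
  "projectable S \<longleftrightarrow> lin S \<and> (\<forall>v\<in>G. \<exists>q\<in>S. \<forall>g\<in>S. I (\<lambda>x. v x - q x) g = 0)"

definition ext :: "(real ^ 'n \<Rightarrow> real) set \<Rightarrow> (real ^ 'n \<Rightarrow> real) \<Rightarrow> (real ^ 'n \<Rightarrow> real) set" where
  "ext S u = {\<lambda>x. q x + c * u x | q c. q \<in> S}"

lemma extI: "q \<in> S \<Longrightarrow> f = (\<lambda>x. q x + c * u x) \<Longrightarrow> f \<in> ext S u"
  unfolding ext_def by blast

lemma projectable_zero: "projectable {\<lambda>x. 0}"
  unfolding projectable_def lin_def using G_const by (auto simp: I_def)

lemma lin_ext:
  assumes S: "lin S" and u: "u \<in> G"
  shows "lin (ext S u)"
  unfolding lin_def
proof (intro conjI ballI allI)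
  have SG: "\<And>q. q \<in> S \<Longrightarrow> q \<in> G" and S0: "(\<lambda>x. 0) \<in> S"
    and Sadd: "\<And>f g. f \<in> S \<Longrightarrow> g \<in> S \<Longrightarrow> (\<lambda>x. f x + g x) \<in> S"
    and Smult: "\<And>f c. f \<in> S \<Longrightarrow> (\<lambda>x. c * f x) \<in> S" using S by (auto simp: lin_def)
  show "ext S u \<subseteq> G" unfolding ext_def using SG u by (auto intro!: G_add G_cmult)
  show "(\<lambda>x. 0) \<in> ext S u" by (rule extI[OF S0, of _ 0]) simp
  fix f assume "f \<in> ext S u"
  then obtain q c where f: "q \<in> S" "f = (\<lambda>x. q x + c * u x)" unfolding ext_def by blast
  show "(\<lambda>x. d * f x) \<in> ext S u" for d
    by (rule extI[OF Smult[OF f(1)], of _ d "d * c"]) (simp add: f(2) algebra_simps)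
  fix g assume "g \<in> ext S u"
  then obtain p d where g: "p \<in> S" "g = (\<lambda>x. p x + d * u x)" unfolding ext_def by blast
  show "(\<lambda>x. f x + g x) \<in> ext S u"
    by (rule extI[OF Sadd[OF f(1) g(1)], of _ "c + d"]) (simp add: f(2) g(2) algebra_simps)
qed

text \<open>A Gram-Schmidt step, with no appeal to completeness: v and u are made orthogonal to S,
  then v' is corrected by a multiple of u'. If u' is a null function, \<open>I_null\<close> makes v'
  orthogonal to it anyway.\<close>

lemma projectable_ext:
  assumes S: "projectable S" and u: "u \<in> G"
  shows "projectable (ext S u)"
  unfolding projectable_def
proof (intro conjI ballI)
  have lS: "lin S" using S by (simp add: projectable_def)
  then have SG: "\<And>q. q \<in> S \<Longrightarrow> q \<in> G"
    and Sadd: "\<And>f g. f \<in> S \<Longrightarrow> g \<in> S \<Longrightarrow> (\<lambda>x. f x + g x) \<in> S"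
    and Smult: "\<And>f c. f \<in> S \<Longrightarrow> (\<lambda>x. c * f x) \<in> S" by (auto simp: lin_def)
  show "lin (ext S u)" by (rule lin_ext[OF lS u])
  fix v assume v: "v \<in> G"
  obtain q0 where q0: "q0 \<in> S" "\<And>g. g \<in> S \<Longrightarrow> I (\<lambda>x. v x - q0 x) g = 0"
    using S v unfolding projectable_def by blast
  obtain r0 where r0: "r0 \<in> S" "\<And>g. g \<in> S \<Longrightarrow> I (\<lambda>x. u x - r0 x) g = 0"
    using S u unfolding projectable_def by blast
  define u' where "u' = (\<lambda>x. u x - r0 x)"
  define v' where "v' = (\<lambda>x. v x - q0 x)"
  have u'G: "u' \<in> G" unfolding u'_def by (intro G_diff u SG r0)
  have v'G: "v' \<in> G" unfolding v'_def by (intro G_diff v SG q0)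
  define c where "c = I v' u' / I u' u'"
  have cn: "c * I u' u' = I v' u'" using I_null[OF v'G u'G] by (cases "I u' u' = 0") (simp_all add: c_def)
  define w where "w = (\<lambda>x. v' x - c * u' x)"
  have wI: "I w g = I v' g - c * I u' g" if "g \<in> G" for g
    unfolding w_def I_diff[OF v'G G_cmult[OF u'G] that] I_cmult ..
  have wS: "I w g = 0" if "g \<in> S" for g
    unfolding wI[OF SG[OF that]] using q0(2)[OF that] r0(2)[OF that] by (simp add: u'_def v'_def)
  have wG: "w \<in> G" unfolding w_def by (intro G_diff v'G G_cmult u'G)
  have wu: "I w u = 0"
  proof -
    have "I w u' = 0" unfolding wI[OF u'G] cn by simp
    moreover have "I w u' = I w u - I w r0"
      unfolding I_commute[of w] unfolding u'_def by (rule I_diff[OF u SG[OF r0(1)] wG])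
    ultimately show ?thesis using wS[OF r0(1)] by simp
  qed
  have "(\<lambda>x. q0 x + (- c) * r0 x) \<in> S" by (intro Sadd Smult q0 r0)
  then have "(\<lambda>x. (q0 x + (- c) * r0 x) + c * u x) \<in> ext S u" by (rule extI) simp
  moreover have "I (\<lambda>x. v x - ((q0 x + (- c) * r0 x) + c * u x)) g = 0" if "g \<in> ext S u" for g
  proof -
    obtain p d where g: "p \<in> S" "g = (\<lambda>x. p x + d * u x)" using \<open>g \<in> ext S u\<close> unfolding ext_def by blast
    have "(\<lambda>x. v x - ((q0 x + (- c) * r0 x) + c * u x)) = w" by (simp add: w_def v'_def u'_def fun_eq_iff algebra_simps)
    moreover have "I w g = I w p + d * I w u"
      unfolding I_commute[of w] g(2) I_add[OF SG[OF g(1)] G_cmult[OF u] wG] I_cmult ..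
    ultimately show ?thesis using wS[OF g(1)] wu by simp
  qed
  ultimately show "\<exists>q\<in>ext S u. \<forall>g\<in>ext S u. I (\<lambda>x. v x - q x) g = 0"
    by (intro bexI[of _ "\<lambda>x. (q0 x + (- c) * r0 x) + c * u x"] ballI)
qed

lemma projectable_family:
  fixes u :: "'i \<Rightarrow> real ^ 'n \<Rightarrow> real"
  assumes S: "projectable S" and u: "\<And>i. u i \<in> G" and A: "finite A"
  shows "projectable {\<lambda>x. q x + (\<Sum>i\<in>A. e i * u i x) | q e. q \<in> S}"
  using A
proof (induction A rule: finite_induct)
  case empty
  have "{\<lambda>x. q x + (\<Sum>i\<in>{}. e i * u i x) | q e. q \<in> S} = S" by auto
  then show ?case using S by simp
next
  case (insert i A)
  have "{\<lambda>x. q x + (\<Sum>i\<in>insert i A. e i * u i x) | q e. q \<in> S} = ext {\<lambda>x. q x + (\<Sum>i\<in>A. e i * u i x) | q e. q \<in> S} (u i)"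
    (is "?L = ?R")
  proof (intro equalityI subsetI)
    fix f assume "f \<in> ?L"
    then obtain q e where "q \<in> S" "f = (\<lambda>x. q x + (\<Sum>i\<in>insert i A. e i * u i x))" by blast
    then have "f = (\<lambda>x. (q x + (\<Sum>i\<in>A. e i * u i x)) + e i * u i x)"
      using insert by (simp add: fun_eq_iff)
    moreover have "(\<lambda>x. q x + (\<Sum>i\<in>A. e i * u i x)) \<in> {\<lambda>x. q x + (\<Sum>i\<in>A. e i * u i x) | q e. q \<in> S}"
      using \<open>q \<in> S\<close> by blast
    ultimately show "f \<in> ?R" by (intro extI)
  next
    fix f assume "f \<in> ?R"
    then obtain q e c where q: "q \<in> S" and f: "f = (\<lambda>x. (q x + (\<Sum>i\<in>A. e i * u i x)) + c * u i x)"
      unfolding ext_def by blast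
    have "(\<Sum>j\<in>A. (e(i := c)) j * u j x) = (\<Sum>j\<in>A. e j * u j x)" for x
      using insert by (intro sum.cong) auto
    then have "f = (\<lambda>x. q x + (\<Sum>j\<in>insert i A. (e(i := c)) j * u j x))"
      unfolding f using insert by (simp add: fun_eq_iff)
    then show "f \<in> ?L" using q by blast
  qed
  then show ?case using projectable_ext[OF insert.IH u] by simp
qed

section \<open>Test functions and the splitting of the deficit\<close>

lemma test_function_C1_off:
  assumes "v \<in> test_functions"
  shows "C1_off v" "continuous_on UNIV v" "continuous_on UNIV (grad v)" "\<And>x. v differentiable (at x)"
proof -
  have C: "Ck k v" for k using assms by (simp add: test_functions_def)
  show d: "v differentiable (at x)" for x using C[of 1] by simp
  have "continuous_on UNIV (\<lambda>x. frechet_derivative v (at x) h)" for h using C[of 1] by simp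
  then have "continuous_on UNIV (\<lambda>x. grad v x $ i)" for i by (simp add: grad_def)
  then show c: "continuous_on UNIV (grad v)"
    unfolding continuous_on_componentwise[of _ "grad v"]
    by (intro ballI) (auto simp: Basis_vec_def inner_axis)
  show "continuous_on UNIV v" using C[of 0] by simp
  show "C1_off v" using d continuous_on_subset[OF c] by (simp add: C1_off_def)
qed

lemma test_function_bounded:
  fixes v :: "real ^ 'n \<Rightarrow> real"
  assumes "v \<in> test_functions"
  obtains M where "\<And>x. \<bar>v x\<bar> \<le> M" "\<And>x. norm (grad v x) \<le> M"
proof -
  define K where "K = closure {x. v x \<noteq> 0}"
  have K: "compact K" using assms by (simp add: test_functions_def K_def)
  have z: "v x = 0" if "x \<notin> K" for x using that closure_subset[of "{x. v x \<noteq> 0}"] by (auto simp: K_def)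
  have gz: "grad v x = 0" if "x \<notin> K" for x
  proof -
    have "GDERIV v x :> 0"
    proof (rule GDERIV_cong_open[OF GDERIV_const[of 0]])
      show "open (- K)" using K by (simp add: K_def open_Compl)
      show "x \<in> - K" using that by simp
    qed (simp add: z)
    then show ?thesis by (rule GDERIV_D(2))
  qed
  have c: "compact (v ` K)" "compact (grad v ` K)"
    using test_function_C1_off(2,3)[OF assms] K by (auto intro!: compact_continuous_image intro: continuous_on_subset)
  obtain M1 where M1: "\<forall>y\<in>v ` K. norm y \<le> M1" using compact_imp_bounded[OF c(1)] unfolding bounded_iff by blast
  obtain M2 where M2: "\<forall>y\<in>grad v ` K. norm y \<le> M2" using compact_imp_bounded[OF c(2)] unfolding bounded_iff by blast
  have M1: "\<bar>v x\<bar> \<le> M1" if "x \<in> K" for x using M1 imageI[OF that, of v] by (metis real_norm_def)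
  have M2: "norm (grad v x) \<le> M2" if "x \<in> K" for x using M2 imageI[OF that, of "grad v"] by blast
  show ?thesis
  proof (rule that[of "max 0 (max M1 M2)"])
    show "\<bar>v x\<bar> \<le> max 0 (max M1 M2)" for x
      using M1[of x] z[of x] by (cases "x \<in> K") (auto simp: le_max_iff_disj)
    show "norm (grad v x) \<le> max 0 (max M1 M2)" for x
      using M2[of x] gz[of x] by (cases "x \<in> K") (auto simp: le_max_iff_disj)
  qed
qed

lemma test_function_G:
  fixes v :: "real ^ 'n \<Rightarrow> real"
  assumes v: "v \<in> test_functions"
  shows "v \<in> G" "appr v"
proof -
  obtain M where M: "\<And>x. \<bar>v x\<bar> \<le> M" "\<And>x. norm (grad v x) \<le> M" using test_function_bounded[OF v] by blast
  have "integrable (mu a b) (\<lambda>x. (norm (grad v x))\<^sup>2)"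
  proof (rule integrable_muI[where q = 0 and C = "M\<^sup>2" and n = 0])
    show "(\<lambda>x. (norm (grad v x))\<^sup>2) \<in> borel_measurable borel"
      using C1_off_measurable(2)[OF test_function_C1_off(1)[OF v]] by measurable
    show "\<bar>(norm (grad v x))\<^sup>2\<bar> \<le> M\<^sup>2 * norm x powr 0 * (1 + norm x) ^ 0" if "x \<noteq> 0" for x
      using power_mono[OF M(2)[of x], of 2] that by simp
  qed (use \<gamma>_nonneg in simp)
  moreover have "\<exists>C n. \<forall>x. x \<noteq> 0 \<longrightarrow> \<bar>v x\<bar> \<le> C * (1 + norm x) ^ n"
    using M(1) by (intro exI[of _ M] exI[of _ "0 :: nat"]) simp
  ultimately show "v \<in> G" using test_function_C1_off(1)[OF v] by (simp add: G_def)
  show "appr v" by (rule appr_continuous_bounded[OF test_function_C1_off(2)[OF v] M(1)])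
qed

lemma appr_const: "appr (\<lambda>x. c)"
  by (rule appr_continuous_bounded[where M = "\<bar>c\<bar>"]) simp_all

lemma eigen_const: "eigen 0 (\<lambda>x. c)"
  by (simp add: eigen_def G_const B_commute[of _ "\<lambda>x. c"] B_const)

lemma INF_sqint_le: "(INF c. sqint a b (\<lambda>x. v x - c)) \<le> I (\<lambda>x. v x - c) (\<lambda>x. v x - c)"
proof -
  have "bdd_below (range (\<lambda>c. sqint a b (\<lambda>x. v x - c)))"
    by (rule bdd_belowI[of _ 0]) (auto simp: sqint_eq_I I_nonneg)
  from cINF_lower[OF this UNIV_I[of c]] show ?thesis by (simp add: sqint_eq_I)
qed

text \<open>Mixed terms vanish, since p is an eigenfunction orthogonal to w, and l1 I p p cancels
  between energy and variance. Bounding the infimum above by its value at one constant is enough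
  because it enters with a negative sign.\<close>

lemma gap:
  assumes w: "w \<in> G" and p: "eigen l1 p" and orth: "I w p = 0" and v: "v = (\<lambda>x. w x + p x + c)"
    and l1: "0 \<le> l1"
  shows "B w w - l1 * I w w \<le> energy a b v - l1 * (INF c. sqint a b (\<lambda>x. v x - c))"
proof -
  have pG: "p \<in> G" by (rule eigenD(1)[OF p])
  have wpG: "(\<lambda>x. w x + p x) \<in> G" by (rule G_add[OF w pG])
  have Bwp: "B w p = 0" using eigenD(2)[OF p w] orth by simp
  have Bpp: "B p p = l1 * I p p" by (rule eigenD(2)[OF p pG])
  have "B v v = B (\<lambda>x. w x + p x) (\<lambda>x. w x + p x)"
    unfolding v B_square_add[OF wpG G_const] B_commute[of "\<lambda>x. w x + p x" "\<lambda>x. c"] B_const by simp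
  also have "\<dots> = B w w + l1 * I p p" unfolding B_square_add[OF w pG] Bwp Bpp by simp
  finally have 1: "energy a b v = B w w + l1 * I p p" by (simp add: energy_eq_B)
  have "(INF c. sqint a b (\<lambda>x. v x - c)) \<le> I (\<lambda>x. v x - c) (\<lambda>x. v x - c)" by (rule INF_sqint_le)
  also have "(\<lambda>x. v x - c) = (\<lambda>x. w x + p x)" by (simp add: v)
  also have "I (\<lambda>x. w x + p x) (\<lambda>x. w x + p x) = I w w + I p p" unfolding I_square_add[OF w pG] orth by simp
  finally have "l1 * (INF c. sqint a b (\<lambda>x. v x - c)) \<le> l1 * (I w w + I p p)" using l1 by (rule mult_left_mono)
  then show ?thesis unfolding 1 by (simp add: distrib_left)
qed

end

section \<open>Approximation by test functions\<close>

text \<open>Flat at t = 0 for every real \<alpha>, and closed under differentiation up to shifting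
  \<alpha> by 1 and 2. For \<alpha> = 0 it is the classical cutoff; other \<alpha> produce powers of
  |x| when evaluated at |x|^2.\<close>

definition flat :: "real \<Rightarrow> real \<Rightarrow> real \<Rightarrow> real" where
  "flat \<alpha> \<epsilon> t = (if 0 < t then t powr \<alpha> * exp (- \<epsilon> / t) else 0)"

text \<open>The behaviour at t = 0 is that of r powr (2 - \<alpha>) exp (- \<epsilon> r) at
  infinity, with r = 1 / t. The quadratic bound yields the derivative 0 at t = 0.\<close>

lemma flat_quadratic_bound:
  assumes "0 < \<epsilon>"
  shows "\<exists>K. \<forall>t\<le>1. \<bar>flat \<alpha> \<epsilon> t\<bar> \<le> K * t\<^sup>2"
proof -
  obtain K where K: "0 < K" "\<And>r. 1 \<le> r \<Longrightarrow> r powr (2 - \<alpha>) * exp (- \<epsilon> * r powr 1) \<le> K"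
    using powr_exp_bounded[OF assms, of 1 "2 - \<alpha>"] by auto
  have "\<bar>flat \<alpha> \<epsilon> t\<bar> \<le> K * t\<^sup>2" if t: "t \<le> 1" for t
  proof (cases "0 < t")
    case True
    have "(1 / t) powr (2 - \<alpha>) * exp (- \<epsilon> * (1 / t) powr 1) \<le> K" using True t by (intro K(2)) simp
    moreover have "(1 / t) powr (2 - \<alpha>) = t powr \<alpha> / t\<^sup>2"
      using True by (simp add: powr_divide powr_diff powr_numeral)
    ultimately have "t powr \<alpha> * exp (- \<epsilon> / t) / t\<^sup>2 \<le> K" using True by simp
    then show ?thesis using True by (simp add: flat_def abs_mult divide_le_eq)
  qed (use K(1) in \<open>simp add: flat_def\<close>)
  then show ?thesis by blast
qed

lemma DERIV_flat:
  assumes e: "0 < \<epsilon>"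
  shows "(flat \<alpha> \<epsilon> has_real_derivative (\<alpha> * flat (\<alpha> - 1) \<epsilon> t + \<epsilon> * flat (\<alpha> - 2) \<epsilon> t)) (at t)"
proof -
  consider "0 < t" | "t < 0" | "t = 0" by linarith
  then show ?thesis
  proof cases
    case 1
    have p2: "t powr (\<alpha> - 2) = t powr \<alpha> / t\<^sup>2" using 1 by (simp add: powr_diff powr_numeral)
    have p1: "t powr (\<alpha> - 1) = t powr \<alpha> / t" using 1 by (simp add: powr_diff)
    have "((\<lambda>t. t powr \<alpha> * exp (- \<epsilon> / t)) has_real_derivative
      (\<alpha> * t powr (\<alpha> - 1) * exp (- \<epsilon> / t) + t powr \<alpha> * (exp (- \<epsilon> / t) * (\<epsilon> / t\<^sup>2)))) (at t)"
      using 1 by (auto intro!: derivative_eq_intros simp: power2_eq_square field_simps p1)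
    then have "((\<lambda>t. t powr \<alpha> * exp (- \<epsilon> / t)) has_real_derivative (\<alpha> * flat (\<alpha> - 1) \<epsilon> t + \<epsilon> * flat (\<alpha> - 2) \<epsilon> t)) (at t)"
      using 1 by (simp add: flat_def p2 mult_ac)
    then show ?thesis
      by (rule has_field_derivative_transform_within_open[where S = "{0<..}"]) (use 1 in \<open>auto simp: flat_def\<close>)
  next
    case 2
    have "((\<lambda>t. 0) has_real_derivative 0) (at t)" by simp
    then have "(flat \<alpha> \<epsilon> has_real_derivative 0) (at t)"
      by (rule has_field_derivative_transform_within_open[where S = "{..<0}"]) (use 2 in \<open>auto simp: flat_def\<close>)
    then show ?thesis using 2 by (simp add: flat_def)
  next
    case 3
    obtain K where K: "\<And>t. t \<le> 1 \<Longrightarrow> \<bar>flat \<alpha> \<epsilon> t\<bar> \<le> K * t\<^sup>2"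
      using flat_quadratic_bound[OF e, of \<alpha>] by blast
    have "(\<lambda>u. (flat \<alpha> \<epsilon> u - flat \<alpha> \<epsilon> 0) / (u - 0)) \<midarrow>0\<rightarrow> 0"
    proof (rule Lim_null_comparison)
      show "\<forall>\<^sub>F u in at 0. norm ((flat \<alpha> \<epsilon> u - flat \<alpha> \<epsilon> 0) / (u - 0)) \<le> K * \<bar>u\<bar>"
        unfolding eventually_at
      proof (intro exI[of _ 1] conjI ballI impI)
        fix u :: real assume "u \<noteq> 0 \<and> dist u 0 < 1"
        then have u: "u \<noteq> 0" "u \<le> 1" by (auto simp: dist_real_def)
        have "\<bar>flat \<alpha> \<epsilon> u\<bar> \<le> (K * \<bar>u\<bar>) * \<bar>u\<bar>" using K[OF u(2)] by (simp add: power2_eq_square)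
        then show "norm ((flat \<alpha> \<epsilon> u - flat \<alpha> \<epsilon> 0) / (u - 0)) \<le> K * \<bar>u\<bar>"
          using u by (simp add: flat_def[of _ _ 0] abs_divide divide_le_eq)
      qed simp
      show "(\<lambda>u. K * \<bar>u\<bar>) \<midarrow>0\<rightarrow> 0" by (auto intro!: tendsto_eq_intros)
    qed
    then show ?thesis using 3 by (simp add: has_field_derivative_iff flat_def)
  qed
qed

text \<open>A class of expressions closed under directional derivatives, so that membership alone
  yields \<open>Ck k\<close> for every k; the norm occurs only through |x|^2.\<close>

inductive smooth :: "(real ^ 'n \<Rightarrow> real) \<Rightarrow> bool" where
  smooth_const: "smooth (\<lambda>x. c)"
| smooth_linear: "smooth (\<lambda>x. e \<bullet> x)"
| smooth_flat: "0 < \<epsilon> \<Longrightarrow> smooth (\<lambda>x. flat \<alpha> \<epsilon> (q + p * (norm x)\<^sup>2))"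
| smooth_add: "smooth f \<Longrightarrow> smooth g \<Longrightarrow> smooth (\<lambda>x. f x + g x)"
| smooth_mult: "smooth f \<Longrightarrow> smooth g \<Longrightarrow> smooth (\<lambda>x. f x * g x)"

lemma GDERIV_flat_norm:
  assumes "0 < \<epsilon>"
  shows "GDERIV (\<lambda>x. flat \<alpha> \<epsilon> (q + p * (norm x)\<^sup>2)) x :>
    (\<alpha> * flat (\<alpha> - 1) \<epsilon> (q + p * (norm x)\<^sup>2) + \<epsilon> * flat (\<alpha> - 2) \<epsilon> (q + p * (norm x)\<^sup>2)) *\<^sub>R ((2 * p) *\<^sub>R x)"
proof -
  have "GDERIV (\<lambda>x. q + p * (norm x)\<^sup>2) x :> 0 + p *\<^sub>R (2 *\<^sub>R x)"
    by (intro GDERIV_add GDERIV_const GDERIV_cmult GDERIV_sqnorm)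
  then have "GDERIV (\<lambda>x. q + p * (norm x)\<^sup>2) x :> (2 * p) *\<^sub>R x" by (simp add: mult.commute)
  from GDERIV_DERIV_compose[OF this DERIV_flat[OF assms]] show ?thesis .
qed

lemma smooth_derivative:
  "smooth f \<Longrightarrow> (\<forall>x. f differentiable (at x)) \<and> (\<forall>h. smooth (\<lambda>x. h \<bullet> grad f x))"
proof (induction rule: smooth.induct)
  case (smooth_const c)
  show ?case using smooth.smooth_const[of 0] by simp
next
  case (smooth_linear e)
  have "(\<lambda>x. e \<bullet> x) differentiable (at x)" for x using GDERIV_D(1)[OF GDERIV_inner_left] .
  then show ?case unfolding grad_linear by (intro conjI allI smooth.smooth_const)
next
  case (smooth_flat \<epsilon> \<alpha> q p)
  let ?f = "\<lambda>\<alpha> (x :: real ^ 'n). flat \<alpha> \<epsilon> (q + p * (norm x)\<^sup>2)"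
  have "smooth (\<lambda>x. h \<bullet> grad (?f \<alpha>) x)" for h
  proof -
    have "smooth (\<lambda>x. (\<alpha> * ?f (\<alpha> - 1) x + \<epsilon> * ?f (\<alpha> - 2) x) * ((2 * p) * (h \<bullet> x)))"
      by (intro smooth.intros smooth_flat)
    moreover have "(\<lambda>x. h \<bullet> grad (?f \<alpha>) x) = (\<lambda>x. (\<alpha> * ?f (\<alpha> - 1) x + \<epsilon> * ?f (\<alpha> - 2) x) * ((2 * p) * (h \<bullet> x)))"
      unfolding GDERIV_D(2)[OF GDERIV_flat_norm[OF smooth_flat]] inner_scaleR_right ..
    ultimately show ?thesis by (simp only:)
  qed
  then show ?case using GDERIV_D(1)[OF GDERIV_flat_norm[OF smooth_flat]] by blast
next
  case (smooth_add f g)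
  have eq: "(\<lambda>x. h \<bullet> grad (\<lambda>x. f x + g x) x) = (\<lambda>x. h \<bullet> grad f x + h \<bullet> grad g x)" for h
    using smooth_add.IH by (simp add: grad_add inner_add_right)
  show ?case
  proof (intro conjI allI)
    show "(\<lambda>x. f x + g x) differentiable (at x)" for x using smooth_add.IH by simp
    show "smooth (\<lambda>x. h \<bullet> grad (\<lambda>x. f x + g x) x)" for h
      unfolding eq by (intro smooth.smooth_add spec[OF conjunct2[OF smooth_add.IH(1)]] spec[OF conjunct2[OF smooth_add.IH(2)]])
  qed
next
  case (smooth_mult f g)
  have eq: "(\<lambda>x. h \<bullet> grad (\<lambda>x. f x * g x) x) = (\<lambda>x. f x * (h \<bullet> grad g x) + g x * (h \<bullet> grad f x))" for h
    using smooth_mult.IH by (simp add: grad_mult inner_add_right)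
  show ?case
  proof (intro conjI allI)
    show "(\<lambda>x. f x * g x) differentiable (at x)" for x using smooth_mult.IH by simp
    show "smooth (\<lambda>x. h \<bullet> grad (\<lambda>x. f x * g x) x)" for h
      unfolding eq
      by (intro smooth.smooth_add smooth.smooth_mult smooth_mult.hyps
          spec[OF conjunct2[OF smooth_mult.IH(1)]] spec[OF conjunct2[OF smooth_mult.IH(2)]])
  qed
qed

lemma smooth_Ck: "smooth f \<Longrightarrow> Ck k f"
proof (induction k arbitrary: f)
  case 0
  then have "\<And>x. f differentiable (at x)" using smooth_derivative by blast
  then show ?case by (simp add: continuous_at_imp_continuous_on differentiable_imp_continuous_within)
next
  case (Suc k)
  have d: "\<And>x. f differentiable (at x)" using smooth_derivative[OF Suc.prems] by blast
  have "(\<lambda>x. frechet_derivative f (at x) h) = (\<lambda>x. h \<bullet> grad f x)" for h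
  proof (rule ext)
    fix x
    have "(f has_derivative (\<lambda>h. h \<bullet> grad f x)) (at x)" using GDERIV_grad[OF d] by (simp add: gderiv_def)
    from frechet_derivative_at[OF this] show "frechet_derivative f (at x) h = h \<bullet> grad f x" by metis
  qed
  then show ?case using d Suc.IH smooth_derivative[OF Suc.prems] by simp
qed

text \<open>The first \<open>flat\<close> factor removes the origin, on the scale |x|^2 of order 1 /
  (n + 1); the second vanishes for |x|^2 >= n + 1, and exp 1 compensates its limit exp (- 1). The
  arguments are written in the form q + p |x|^2 of \<open>smooth_flat\<close>.\<close>

definition theta :: "nat \<Rightarrow> real ^ 'n \<Rightarrow> real" where
  "theta n x = exp 1 * (flat 0 (1 / real (Suc n)) (0 + 1 * (norm x)\<^sup>2) * flat 0 1 (1 + (- 1 / real (Suc n)) * (norm x)\<^sup>2))"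

lemma flat_0_bounds:
  assumes "0 < \<epsilon>"
  shows "0 \<le> flat 0 \<epsilon> t" "flat 0 \<epsilon> t \<le> 1" "0 \<le> flat (- 2) \<epsilon> t"
    "\<epsilon> * flat (- 2) \<epsilon> t * t \<le> 1" "0 \<le> t \<Longrightarrow> flat (- 2) \<epsilon> t \<le> 1 / t\<^sup>2" "flat (- 2) 1 t \<le> 2"
proof -
  show "0 \<le> flat 0 \<epsilon> t" "0 \<le> flat (- 2) \<epsilon> t" by (simp_all add: flat_def)
  show "flat 0 \<epsilon> t \<le> 1" using assms by (simp add: flat_def)
  have e: "flat (- 2) \<delta> t = exp (- \<delta> / t) / t\<^sup>2" if "0 < t" for \<delta>
    using that by (simp add: flat_def powr_minus powr_numeral divide_inverse)
  show "flat (- 2) \<epsilon> t \<le> 1 / t\<^sup>2" if "0 \<le> t"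
  proof (cases "t = 0")
    case False
    then have t: "0 < t" using that by simp
    have "exp (- \<epsilon> / t) \<le> 1" using t assms by simp
    then show ?thesis unfolding e[OF t] by (rule divide_right_mono) simp
  qed (simp add: flat_def)
  show "\<epsilon> * flat (- 2) \<epsilon> t * t \<le> 1"
  proof (cases "0 < t")
    case True
    \<comment> \<open>The quantity is u exp (- u) with u = \<epsilon> / t, which is at most
      1.\<close>
    have "\<epsilon> / t \<le> exp (\<epsilon> / t)" using exp_ge_add_one_self[of "\<epsilon> / t"] by linarith
    then have "\<epsilon> / t * exp (- (\<epsilon> / t)) \<le> exp (\<epsilon> / t) * exp (- (\<epsilon> / t))" by (rule mult_right_mono) simp
    also have "\<dots> = 1" unfolding exp_add[symmetric] by simp
    also have "\<epsilon> / t * exp (- (\<epsilon> / t)) = \<epsilon> * flat (- 2) \<epsilon> t * t"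
      unfolding e[OF True] using True by (simp add: power2_eq_square)
    finally show ?thesis .
  qed (simp add: flat_def)
  show "flat (- 2) 1 t \<le> 2"
  proof (cases "0 < t")
    case True
    have "(1 / t) ^ 2 \<le> fact 2 * exp (1 / t)" using True by (intro power_le_fact_exp) simp
    then have "(1 / t) ^ 2 * exp (- (1 / t)) \<le> (2 * exp (1 / t)) * exp (- (1 / t))"
      by (intro mult_right_mono) (simp_all add: fact_numeral)
    also have "\<dots> = 2" unfolding mult.assoc exp_add[symmetric] by simp
    also have "(1 / t) ^ 2 * exp (- (1 / t)) = flat (- 2) 1 t"
      unfolding e[OF True] by (simp add: power_inverse divide_inverse mult.commute)
    finally show ?thesis .
  qed (simp add: flat_def)
qed

definition dtheta :: "nat \<Rightarrow> real ^ 'n \<Rightarrow> real" where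
  "dtheta n x = exp 1 * (flat 0 (1 / real (Suc n)) ((norm x)\<^sup>2) * (- (2 / real (Suc n)) * flat (- 2) 1 (1 + (- 1 / real (Suc n)) * (norm x)\<^sup>2))
    + flat 0 1 (1 + (- 1 / real (Suc n)) * (norm x)\<^sup>2) * (2 * (1 / real (Suc n)) * flat (- 2) (1 / real (Suc n)) ((norm x)\<^sup>2)))"

lemma GDERIV_theta: "GDERIV (theta n) x :> dtheta n x *\<^sub>R x"
proof -
  let ?e = "1 / real (Suc n)" and ?t = "1 + (- 1 / real (Suc n)) * (norm x)\<^sup>2"
  have e: "0 < ?e" by simp
  have "GDERIV (theta n) x :> exp 1 *\<^sub>R
     (flat 0 ?e (0 + 1 * (norm x)\<^sup>2) *\<^sub>R ((0 * flat (0 - 1) 1 ?t + 1 * flat (0 - 2) 1 ?t) *\<^sub>R ((2 * (- 1 / real (Suc n))) *\<^sub>R x))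
     + flat 0 1 ?t *\<^sub>R ((0 * flat (0 - 1) ?e (0 + 1 * (norm x)\<^sup>2) + ?e * flat (0 - 2) ?e (0 + 1 * (norm x)\<^sup>2)) *\<^sub>R ((2 * 1) *\<^sub>R x)))"
    unfolding theta_def[abs_def]
    by (intro GDERIV_cmult GDERIV_mult GDERIV_flat_norm zero_less_one e)
  then show ?thesis by (simp add: dtheta_def scaleR_add_left[symmetric] algebra_simps del: of_nat_Suc)
qed

lemma theta_bounds: "0 \<le> theta n x" "theta n x \<le> exp 1"
proof -
  let ?f = "flat 0 (1 / real (Suc n)) (0 + 1 * (norm x)\<^sup>2)" and ?g = "flat 0 1 (1 + (- 1 / real (Suc n)) * (norm x)\<^sup>2)"
  have "0 \<le> ?f" "?f \<le> 1" "0 \<le> ?g" "?g \<le> 1" by (rule flat_0_bounds; simp)+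
  then have "0 \<le> ?f * ?g" "?f * ?g \<le> 1" by (simp_all add: mult_le_one)
  then show "0 \<le> theta n x" "theta n x \<le> exp 1" unfolding theta_def by simp_all
qed

lemma theta_support: "real (Suc n) \<le> (norm x)\<^sup>2 \<Longrightarrow> theta n x = 0"
proof -
  assume "real (Suc n) \<le> (norm x)\<^sup>2"
  then have "1 + (- 1 / real (Suc n)) * (norm x)\<^sup>2 \<le> 0" by (simp add: le_divide_eq del: of_nat_Suc)
  then show ?thesis by (simp add: theta_def flat_def)
qed

lemma theta_limit:
  assumes "x \<noteq> 0"
  shows "(\<lambda>n. theta n x) \<longlonglongrightarrow> 1"
proof -
  have l0: "(\<lambda>n. c / real (Suc n)) \<longlonglongrightarrow> 0" for c :: real
    using tendsto_mult[OF tendsto_const[of c] LIMSEQ_inverse_real_of_nat] by (simp add: divide_inverse)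
  have "isCont (flat 0 1) 1" using DERIV_flat[of 1 0 1] by (intro DERIV_isCont) simp
  moreover have "(\<lambda>n. 1 + (- 1 / real (Suc n)) * (norm x)\<^sup>2) \<longlonglongrightarrow> 1 + 0 * (norm x)\<^sup>2"
    by (intro tendsto_add tendsto_const tendsto_mult l0)
  ultimately have 1: "(\<lambda>n. flat 0 1 (1 + (- 1 / real (Suc n)) * (norm x)\<^sup>2)) \<longlonglongrightarrow> flat 0 1 1"
    by (intro isCont_tendsto_compose[of 1 "flat 0 1"]) simp_all
  have "(\<lambda>n. exp (- (1 / (norm x)\<^sup>2) / real (Suc n))) \<longlonglongrightarrow> exp 0"
    by (intro tendsto_exp l0)
  moreover have "exp (- (1 / (norm x)\<^sup>2) / real (Suc n)) = flat 0 (1 / real (Suc n)) (0 + 1 * (norm x)\<^sup>2)" for n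
    using assms by (simp add: flat_def mult.commute)
  ultimately have 2: "(\<lambda>n. flat 0 (1 / real (Suc n)) (0 + 1 * (norm x)\<^sup>2)) \<longlonglongrightarrow> 1" by simp
  have "(\<lambda>n. theta n x) \<longlonglongrightarrow> exp 1 * (1 * flat 0 1 1)"
    unfolding theta_def by (intro tendsto_mult tendsto_const 1 2)
  then show ?thesis by (simp add: flat_def exp_minus)
qed

text \<open>The first bound is uniform in n and scale invariant, being a bound for |x| |grad theta|,
  and serves domination; the second gives pointwise convergence to 0 at rate 1 / (n + 1).\<close>

lemma dtheta_bounds:
  fixes x :: "real ^ 'n"
  assumes x: "x \<noteq> 0"
  shows "\<bar>dtheta n x\<bar> * (norm x)\<^sup>2 \<le> 6 * exp 1" "\<bar>dtheta n x\<bar> \<le> exp 1 * (4 + 2 / (norm x) ^ 4) / real (Suc n)"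
proof -
  let ?e = "1 / real (Suc n)" and ?t = "1 + (- 1 / real (Suc n)) * (norm x)\<^sup>2" and ?r = "(norm x)\<^sup>2"
  have e: "0 < ?e" by simp
  have r: "0 < ?r" using x by simp
  define A where "A = flat 0 ?e ?r * (2 * ?e * flat (- 2) 1 ?t)"
  define D where "D = flat 0 1 ?t * (2 * ?e * flat (- 2) ?e ?r)"
  have A0: "0 \<le> A" and D0: "0 \<le> D"
    unfolding A_def D_def using flat_0_bounds[OF e] flat_0_bounds[OF zero_less_one] by simp_all
  have A1: "A \<le> 4 * ?e"
  proof -
    have "flat 0 ?e ?r * (2 * ?e * flat (- 2) 1 ?t) \<le> 1 * (2 * ?e * 2)"
      using flat_0_bounds[OF e] flat_0_bounds[OF zero_less_one] by (intro mult_mono mult_left_mono mult_nonneg_nonneg) simp_all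
    then show ?thesis by (simp add: A_def)
  qed
  \<comment> \<open>Where the outer factor is nonzero, |x|^2 < n + 1, so a coefficient of size 1 /
    (n + 1) compensates |x|^2.\<close>
  have A2: "A * ?r \<le> 4"
  proof (cases "?t \<le> 0")
    case True
    then show ?thesis by (simp add: A_def flat_def)
  next
    case False
    then have "?e * ?r \<le> 1" by simp
    moreover have "A * ?r \<le> 4 * ?e * ?r" using A1 r by (intro mult_right_mono) simp_all
    ultimately show ?thesis by linarith
  qed
  have D1: "D \<le> 1 * (2 * ?e * flat (- 2) ?e ?r)"
    unfolding D_def using flat_0_bounds[OF e] flat_0_bounds[OF zero_less_one] by (intro mult_right_mono mult_nonneg_nonneg) simp_all
  have D2: "D * ?r \<le> 2"
  proof -
    have "D * ?r \<le> 1 * (2 * ?e * flat (- 2) ?e ?r) * ?r" using D1 r by (intro mult_right_mono) simp_all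
    also have "\<dots> = 2 * (?e * flat (- 2) ?e ?r * ?r)" by simp
    also have "\<dots> \<le> 2 * 1" using flat_0_bounds(4)[OF e] by (rule mult_left_mono) simp
    finally show ?thesis by simp
  qed
  have D3: "D \<le> 2 * ?e * (1 / (norm x) ^ 4)"
  proof -
    have "flat (- 2) ?e ?r \<le> 1 / (norm x) ^ 4" using flat_0_bounds(5)[OF e, of ?r] r by (simp flip: power_mult)
    then have "2 * ?e * flat (- 2) ?e ?r \<le> 2 * ?e * (1 / (norm x) ^ 4)" by (intro mult_left_mono) simp_all
    then show ?thesis using D1 by linarith
  qed
  have "dtheta n x = exp 1 * (D - A)" by (simp add: dtheta_def A_def D_def)
  then have d: "\<bar>dtheta n x\<bar> \<le> exp 1 * (A + D)" using A0 D0 by (simp add: abs_mult)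
  have "\<bar>dtheta n x\<bar> * ?r \<le> exp 1 * (A + D) * ?r" using d r by (intro mult_right_mono) simp_all
  also have "\<dots> = exp 1 * (A * ?r + D * ?r)" by (simp add: algebra_simps)
  also have "\<dots> \<le> exp 1 * 6" using A2 D2 by (intro mult_left_mono) simp_all
  finally show "\<bar>dtheta n x\<bar> * (norm x)\<^sup>2 \<le> 6 * exp 1" by simp
  have "exp 1 * (A + D) \<le> exp 1 * (4 * ?e + 2 * ?e * (1 / (norm x) ^ 4))" using A1 D3 by (intro mult_left_mono add_mono) simp_all
  also have "\<dots> = exp 1 * (4 + 2 / (norm x) ^ 4) / real (Suc n)" by (simp add: add_divide_distrib distrib_left del: of_nat_Suc)
  finally show "\<bar>dtheta n x\<bar> \<le> exp 1 * (4 + 2 / (norm x) ^ 4) / real (Suc n)" using d by linarith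
qed

lemma dtheta_limit:
  fixes x :: "real ^ 'n"
  assumes "x \<noteq> 0"
  shows "(\<lambda>n. dtheta n x) \<longlonglongrightarrow> 0"
proof (rule Lim_null_comparison)
  show "\<forall>\<^sub>F n in sequentially. norm (dtheta n x) \<le> exp 1 * (4 + 2 / (norm x) ^ 4) / real (Suc n)"
    using dtheta_bounds(2)[OF assms] by (intro always_eventually allI) (simp only: real_norm_def)
  show "(\<lambda>n. exp 1 * (4 + 2 / (norm x) ^ 4) / real (Suc n)) \<longlonglongrightarrow> 0"
    using tendsto_mult[OF tendsto_const[of "exp 1 * (4 + 2 / (norm x) ^ 4)"] LIMSEQ_inverse_real_of_nat] by (simp add: divide_inverse)
qed

text \<open>The inner cutoff times |x| powr \<alpha> is again a \<open>flat\<close> function of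
  |x|^2, with exponent \<alpha> / 2; the singularity of |x| powr \<alpha> at 0 disappears whatever
  the sign of \<alpha>.\<close>

lemma theta_psi_test_function:
  fixes h :: "real ^ 'n \<Rightarrow> real"
  assumes "smooth h"
  shows "(\<lambda>x. theta n x * psi \<alpha> h x) \<in> test_functions"
proof -
  let ?e = "1 / real (Suc n)"
  have eq: "theta n x * psi \<alpha> h x = exp 1 * (flat (\<alpha> / 2) ?e (0 + 1 * (norm x)\<^sup>2) * (flat 0 1 (1 + (- 1 / real (Suc n)) * (norm x)\<^sup>2) * h x))" for x
  proof (cases "x = 0")
    case False
    have "((norm x)\<^sup>2) powr (\<alpha> / 2) = norm x powr \<alpha>"
      using False by (simp add: powr_powr flip: powr_numeral)
    then show ?thesis using False by (simp add: theta_def psi_def flat_def)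
  qed (simp add: theta_def psi_def flat_def)
  have "smooth (\<lambda>x. exp 1 * (flat (\<alpha> / 2) ?e (0 + 1 * (norm x)\<^sup>2) * (flat 0 1 (1 + (- 1 / real (Suc n)) * (norm x)\<^sup>2) * h x)))"
    by (intro smooth_mult smooth_const smooth_flat assms) simp_all
  then have "smooth (\<lambda>x. theta n x * psi \<alpha> h x)" unfolding eq .
  then have "\<forall>k. Ck k (\<lambda>x. theta n x * psi \<alpha> h x)" by (intro allI smooth_Ck)
  moreover have "compact (closure {x. theta n x * psi \<alpha> h x \<noteq> 0})"
  proof -
    have "{x. theta n x * psi \<alpha> h x \<noteq> 0} \<subseteq> cball 0 (sqrt (real (Suc n)))"
    proof
      fix x assume "x \<in> {x. theta n x * psi \<alpha> h x \<noteq> 0}"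
      then have "theta n x \<noteq> 0" by simp
      then have "(norm x)\<^sup>2 < real (Suc n)" using theta_support[of n x] by linarith
      then show "x \<in> cball 0 (sqrt (real (Suc n)))" by (simp add: real_le_rsqrt del: of_nat_Suc)
    qed
    then have "bounded {x. theta n x * psi \<alpha> h x \<noteq> 0}" using bounded_cball bounded_subset by blast
    then show ?thesis by (simp add: compact_closure)
  qed
  ultimately show ?thesis by (simp add: test_functions_def)
qed

lemma grad_theta_psi:
  fixes h :: "real ^ 'n \<Rightarrow> real" and x :: "real ^ 'n" and \<alpha> :: real
  assumes h: "hom k h" and x: "x \<noteq> 0"
  shows "grad (\<lambda>x. theta n x * psi \<alpha> h x) x = theta n x *\<^sub>R grad (psi \<alpha> h) x + (psi \<alpha> h x * dtheta n x) *\<^sub>R x"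
  using GDERIV_D(2)[OF GDERIV_mult[OF GDERIV_theta C1_off_GDERIV[OF C1_off_psi[OF h] x]]] by simp

context ckn
begin

text \<open>The scale-invariant bound on the cutoff gradient gives |grad (v n)| = O(|x|^(m-1))
  uniformly in n, where m = \<alpha> + k. The square of this bound is \<open>mu\<close>-integrable
  because \<gamma> + 2 m > 0; for m = \<gamma> = 0 the domination breaks down.\<close>

lemma theta_psi_convergence:
  fixes h :: "real ^ 'n \<Rightarrow> real" and \<alpha> :: real
  assumes h: "hom k h" and sm: "smooth h" and m: "0 < \<alpha> + k"
  defines "v \<equiv> \<lambda>n x. theta n x * psi \<alpha> h x"
  shows "(\<lambda>n. B (v n) (v n)) \<longlonglongrightarrow> B (psi \<alpha> h) (psi \<alpha> h)"
    "(\<lambda>n. I (v n) (v n)) \<longlonglongrightarrow> I (psi \<alpha> h) (psi \<alpha> h)"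
    "(\<lambda>n. I (v n) (\<lambda>x. 1)) \<longlonglongrightarrow> I (psi \<alpha> h) (\<lambda>x. 1)"
proof -
  define \<psi> where "\<psi> = psi \<alpha> h"
  have \<psi>G: "\<psi> \<in> G" unfolding \<psi>_def by (rule psi_G[OF h m])
  have vG: "v n \<in> G" for n unfolding v_def by (intro test_function_G(1) theta_psi_test_function sm)
  obtain C where C: "0 \<le> C" "\<And>x. x \<noteq> 0 \<Longrightarrow> \<bar>\<psi> x\<bar> \<le> C * norm x powr (\<alpha> + k)"
    unfolding \<psi>_def using psi_bound[OF h, of \<alpha>] by blast
  obtain D where D: "0 \<le> D" "\<And>x. x \<noteq> 0 \<Longrightarrow> norm (grad \<psi> x) \<le> D * norm x powr (\<alpha> + k - 1)"
    unfolding \<psi>_def using grad_psi_bound[OF h, of \<alpha>] by blast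
  have lv: "(\<lambda>n. v n x) \<longlonglongrightarrow> \<psi> x" if "x \<noteq> 0" for x
    unfolding v_def \<psi>_def[symmetric] using tendsto_mult_right[OF theta_limit[OF that], of "\<psi> x"] by simp
  have bv: "\<bar>v n x\<bar> \<le> exp 1 * \<bar>\<psi> x\<bar>" for n x
    unfolding v_def \<psi>_def abs_mult using theta_bounds[of n x] by (intro mult_right_mono) simp_all
  have gv: "grad (v n) x = theta n x *\<^sub>R grad \<psi> x + (\<psi> x * dtheta n x) *\<^sub>R x" if "x \<noteq> 0" for n x
    unfolding v_def \<psi>_def by (rule grad_theta_psi[OF h that])
  have lg: "(\<lambda>n. grad (v n) x) \<longlonglongrightarrow> grad \<psi> x" if "x \<noteq> 0" for x
  proof -
    have "(\<lambda>n. theta n x *\<^sub>R grad \<psi> x + (\<psi> x * dtheta n x) *\<^sub>R x) \<longlonglongrightarrow> 1 *\<^sub>R grad \<psi> x + (\<psi> x * 0) *\<^sub>R x"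
      by (intro tendsto_intros theta_limit dtheta_limit that)
    then show ?thesis unfolding gv[OF that] by simp
  qed
  have bg: "norm (grad (v n) x) \<le> exp 1 * (D + 6 * C) * norm x powr (\<alpha> + k - 1)" if x: "x \<noteq> 0" for n x
  proof -
    have "norm (grad (v n) x) \<le> theta n x * norm (grad \<psi> x) + \<bar>\<psi> x\<bar> * (\<bar>dtheta n x\<bar> * norm x)"
      unfolding gv[OF x] using theta_bounds(1)[of n x]
      by (intro order_trans[OF norm_triangle_ineq]) (simp add: abs_mult mult.assoc)
    also have "theta n x * norm (grad \<psi> x) \<le> exp 1 * (D * norm x powr (\<alpha> + k - 1))"
      using theta_bounds[of n x] D(2)[OF x] by (intro mult_mono) simp_all
    also have "\<bar>\<psi> x\<bar> * (\<bar>dtheta n x\<bar> * norm x) \<le> (C * norm x powr (\<alpha> + k)) * (6 * exp 1 / norm x)"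
    proof (intro mult_mono)
      show "\<bar>dtheta n x\<bar> * norm x \<le> 6 * exp 1 / norm x"
        using dtheta_bounds(1)[OF x, of n] x by (simp add: le_divide_eq power2_eq_square mult.assoc)
    qed (use C x in simp_all)
    also have "(C * norm x powr (\<alpha> + k)) * (6 * exp 1 / norm x) = exp 1 * (6 * C) * norm x powr (\<alpha> + k - 1)"
      using x by (simp add: powr_diff)
    finally show ?thesis by (simp add: algebra_simps)
  qed
  have gm: "grad \<psi> \<in> borel_measurable borel" "grad (v n) \<in> borel_measurable borel"
    "\<psi> \<in> borel_measurable borel" "v n \<in> borel_measurable borel" for n
    using G_measurable[OF \<psi>G] G_measurable[OF vG] by auto
  define E where "E = exp 1 * (D + 6 * C)"
  show "(\<lambda>n. B (v n) (v n)) \<longlonglongrightarrow> B (psi \<alpha> h) (psi \<alpha> h)"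
    unfolding B_def \<psi>_def[symmetric]
  proof (rule integral_dominated_convergence[where w = "\<lambda>x. E\<^sup>2 * norm x powr (2 * (\<alpha> + k - 1))"])
    show "integrable (mu a b) (\<lambda>x :: real ^ 'n. E\<^sup>2 * norm x powr (2 * (\<alpha> + k - 1)))"
    proof (rule integrable_muI[where q = "2 * (\<alpha> + k - 1)" and C = "E\<^sup>2" and n = 0])
      show "(\<lambda>x :: real ^ 'n. E\<^sup>2 * norm x powr (2 * (\<alpha> + k - 1))) \<in> borel_measurable borel" by measurable
    qed (use m \<gamma>_nonneg in simp_all)
    show "AE x in mu a b. (\<lambda>n. grad (v n) x \<bullet> grad (v n) x) \<longlonglongrightarrow> grad \<psi> x \<bullet> grad \<psi> x"
      using AE_mu_nu_nonzero(1) by (rule eventually_mono) (intro tendsto_inner lg)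
    show "AE x in mu a b. norm (grad (v n) x \<bullet> grad (v n) x) \<le> E\<^sup>2 * norm x powr (2 * (\<alpha> + k - 1))" for n
      using AE_mu_nu_nonzero(1)
    proof (rule eventually_mono)
      fix x :: "real ^ 'n" assume x: "x \<noteq> 0"
      have "(norm (grad (v n) x))\<^sup>2 \<le> (E * norm x powr (\<alpha> + k - 1))\<^sup>2"
        using bg[OF x, of n] by (intro power_mono) (simp_all add: E_def)
      also have "\<dots> = E\<^sup>2 * norm x powr (2 * (\<alpha> + k - 1))"
        using powr_nat_power[of "norm x" "\<alpha> + k - 1" 2] x by (simp add: power_mult_distrib mult.commute)
      finally show "norm (grad (v n) x \<bullet> grad (v n) x) \<le> E\<^sup>2 * norm x powr (2 * (\<alpha> + k - 1))"
        by (simp add: power2_norm_eq_inner)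
    qed
  qed (use gm in simp_all)
  show "(\<lambda>n. I (v n) (v n)) \<longlonglongrightarrow> I (psi \<alpha> h) (psi \<alpha> h)"
    unfolding I_def \<psi>_def[symmetric]
  proof (rule integral_dominated_convergence[where w = "\<lambda>x. (exp 1)\<^sup>2 * (\<psi> x * \<psi> x)"])
    show "integrable (nu a b) (\<lambda>x. (exp 1)\<^sup>2 * (\<psi> x * \<psi> x))" by (intro integrable_mult_right G_integrable_I \<psi>G)
    show "AE x in nu a b. (\<lambda>n. v n x * v n x) \<longlonglongrightarrow> \<psi> x * \<psi> x"
      using AE_mu_nu_nonzero(2) by (rule eventually_mono) (intro tendsto_mult lv)
    show "AE x in nu a b. norm (v n x * v n x) \<le> (exp 1)\<^sup>2 * (\<psi> x * \<psi> x)" for n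
    proof (rule AE_I2)
      fix x
      have "\<bar>v n x\<bar> * \<bar>v n x\<bar> \<le> (exp 1 * \<bar>\<psi> x\<bar>) * (exp 1 * \<bar>\<psi> x\<bar>)" by (intro mult_mono bv) simp_all
      also have "\<dots> = (exp 1)\<^sup>2 * (\<bar>\<psi> x\<bar> * \<bar>\<psi> x\<bar>)" by (simp only: power2_eq_square mult_ac)
      finally show "norm (v n x * v n x) \<le> (exp 1)\<^sup>2 * (\<psi> x * \<psi> x)" by (simp add: abs_mult)
    qed
  qed (use gm in simp_all)
  show "(\<lambda>n. I (v n) (\<lambda>x. 1)) \<longlonglongrightarrow> I (psi \<alpha> h) (\<lambda>x. 1)"
    unfolding I_def \<psi>_def[symmetric]
  proof (rule integral_dominated_convergence[where w = "\<lambda>x. exp 1 * \<bar>\<psi> x * 1\<bar>"])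
    show "integrable (nu a b) (\<lambda>x. exp 1 * \<bar>\<psi> x * 1\<bar>)"
      by (intro integrable_mult_right integrable_abs G_integrable_I \<psi>G G_const)
    show "AE x in nu a b. (\<lambda>n. v n x * 1) \<longlonglongrightarrow> \<psi> x * 1"
      using AE_mu_nu_nonzero(2) by (rule eventually_mono) (intro tendsto_mult lv tendsto_const)
    show "AE x in nu a b. norm (v n x * 1) \<le> exp 1 * \<bar>\<psi> x * 1\<bar>" for n
      using bv by (intro AE_I2) simp
  qed (use gm in simp_all)
qed

end

section \<open>Lowest eigenspaces and sharpness\<close>

text \<open>The gradient has degree 0, hence is constant, and Euler's identity recovers h. Linear
  modes thus exhaust the harmonic polynomials of degree 1.\<close>

lemma hom_1D:
  assumes "hom 1 h"
  shows "\<exists>e. h = (\<lambda>x. e \<bullet> x)"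
proof -
  have "\<exists>c. (\<lambda>x. grad h x $ i) = (\<lambda>x. c)" for i using hom_0D hom_grad[OF assms, of i] by simp
  then obtain c where c: "\<And>i. (\<lambda>x. grad h x $ i) = (\<lambda>x. c i)" by metis
  have g: "grad h x = (\<chi> i. c i)" for x unfolding vec_eq_iff using fun_cong[OF c] by simp
  have "h x = (\<chi> i. c i) \<bullet> x" for x using hom_Euler[OF assms, of x] unfolding g by (simp add: inner_commute)
  then show ?thesis by (intro exI[of _ "\<chi> i. c i"] ext)
qed

lemma integral_odd:
  fixes f :: "'a::euclidean_space \<Rightarrow> real"
  assumes f: "f \<in> borel_measurable borel" and odd: "\<And>x. f (- x) = - f x"
  shows "(\<integral>x. f x \<partial>lborel) = 0"
proof -
  have "lborel = distr lborel borel (\<lambda>x :: 'a. - x)"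
    using lborel_affine[of "-1 :: real" "0 :: 'a"] by (simp add: density_1 one_ennreal_def[symmetric])
  then have "(\<integral>x. f x \<partial>lborel) = (\<integral>x. f x \<partial>distr lborel borel (\<lambda>x. - x))" by simp
  also have "\<dots> = (\<integral>x. f (- x) \<partial>lborel)" using f by (intro integral_distr) simp_all
  also have "\<dots> = - (\<integral>x. f x \<partial>lborel)" unfolding odd by simp
  finally show ?thesis by simp
qed

context ckn
begin

lemma I_cong:
  assumes "f \<in> borel_measurable borel" "f' \<in> borel_measurable borel" "g \<in> borel_measurable borel"
    and "\<And>x. x \<noteq> 0 \<Longrightarrow> f x = f' x"
  shows "I f g = I f' g"
  unfolding I_def
proof (rule integral_cong_AE)
  show "AE x in nu a b. f x * g x = f' x * g x"
    using AE_mu_nu_nonzero(2) by (rule eventually_mono) (simp add: assms(4))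
qed (use assms in simp_all)

lemma I_const: "I f (\<lambda>x. c) = c * I f (\<lambda>x. 1)"
  using I_cmult[of c "\<lambda>x. 1" f] by (simp add: I_commute[of f])

text \<open>f is continuous off the origin and the \<open>nu\<close> density is positive there, so
  \<open>I f f = 0\<close> would make the nonempty open set of its nonzeros a null set.\<close>

lemma I_positive:
  fixes f :: "real ^ 'n \<Rightarrow> real"
  assumes f: "f \<in> G" and x0: "x0 \<noteq> 0" "f x0 \<noteq> 0"
  shows "0 < I f f"
proof (rule ccontr)
  assume "\<not> 0 < I f f"
  then have z: "I f f = 0" using I_nonneg[of f] by linarith
  have fm: "f \<in> borel_measurable borel" by (rule G_measurable(1)[OF f])
  have int: "integrable lborel (\<lambda>x. wt s (s - 2 - 2 * b) x * (f x * f x))"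
    using G_integrable_I[OF f f] fm by (subst integral_nu(2)[symmetric]) simp_all
  have "(\<integral>x. wt s (s - 2 - 2 * b) x * (f x * f x) \<partial>lborel) = 0"
    using z fm unfolding I_def by (subst integral_nu(1)[symmetric]) simp_all
  then have ae: "AE x in lborel. wt s (s - 2 - 2 * b) x * (f x * f x) = 0"
    using integral_nonneg_eq_0_iff_AE[OF int] by simp
  define S where "S = (- {0 :: real ^ 'n}) \<inter> f -` (- {0})"
  have S: "open S"
    unfolding S_def using C1_off_continuous[OF G_C1[OF f]] by (intro continuous_open_preimage) auto
  have "AE x in lborel. x \<notin> S"
    using ae
  proof (rule eventually_mono)
    fix x assume "wt s (s - 2 - 2 * b) x * (f x * f x) = 0"
    then have "x = 0 \<or> f x = 0" using wt_pos[of x s "s - 2 - 2 * b"] by force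
    then show "x \<notin> S" by (auto simp: S_def)
  qed
  then have "S \<in> null_sets lborel" using S by (subst AE_iff_null_sets) auto
  then have "negligible S" by (simp add: negligible_iff_null_sets null_sets_completionI)
  then have "S = {}" using open_not_negligible[OF S] by blast
  then show False using x0 by (auto simp: S_def)
qed

text \<open>The quantity is a quadratic polynomial in c, minimal at the mean, and the left side is
  the variance. If the total mass were 0, the quotient is 0 by convention and \<open>I_null\<close>
  covers the case.\<close>

lemma INF_sqint_ge:
  assumes v: "v \<in> G"
  shows "I v v - (I v (\<lambda>x. 1))\<^sup>2 / I (\<lambda>x. 1) (\<lambda>x. 1) \<le> (INF c. sqint a b (\<lambda>x. v x - c))"
proof (rule cINF_greatest)
  fix c :: real
  let ?Z = "I (\<lambda>x. 1) (\<lambda>x. 1)" and ?J = "I v (\<lambda>x. 1)"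
  have "I (\<lambda>x. c) (\<lambda>x. c) = c * (c * ?Z)"
    unfolding I_const[of "\<lambda>x. c" c] I_commute[of "\<lambda>x. c" "\<lambda>x. 1"] I_const[of "\<lambda>x. 1" c] ..
  then have "sqint a b (\<lambda>x. v x - c) = I v v - 2 * (c * ?J) + c * (c * ?Z)"
    unfolding sqint_eq_I I_square_diff[OF v G_const] I_const[of v c] by simp
  moreover have "- (?J\<^sup>2 / ?Z) \<le> - 2 * (c * ?J) + c * (c * ?Z)"
  proof (cases "?Z = 0")
    case True
    then have "?J = 0" by (rule I_null[OF v G_const])
    then show ?thesis using True by simp
  next
    case False
    then have Z: "0 < ?Z" using I_nonneg[of "\<lambda>x. 1"] by linarith
    have "0 \<le> (c * ?Z - ?J)\<^sup>2 / ?Z" using Z by simp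
    also have "\<dots> = ?J\<^sup>2 / ?Z - 2 * (c * ?J) + c * (c * ?Z)" using Z by (simp add: field_simps power2_eq_square)
    finally show ?thesis by simp
  qed
  ultimately show "I v v - ?J\<^sup>2 / ?Z \<le> sqint a b (\<lambda>x. v x - c)" by linarith
qed simp

lemma variance_shift:
  assumes p: "p \<in> G" and orth: "I p (\<lambda>x. 1) = 0"
  shows "I (\<lambda>x. p x + c) (\<lambda>x. p x + c) - (I (\<lambda>x. p x + c) (\<lambda>x. 1))\<^sup>2 / I (\<lambda>x. 1) (\<lambda>x. 1) = I p p"
proof -
  let ?Z = "I (\<lambda>x. 1) (\<lambda>x. 1)"
  have c: "I (\<lambda>x. c) (\<lambda>x. 1) = c * ?Z" using I_cmult[of c "\<lambda>x. 1" "\<lambda>x. 1"] by simp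
  then have "I (\<lambda>x. c) (\<lambda>x. c) = c * (c * ?Z)" unfolding I_const[of "\<lambda>x. c" c] by simp
  then have "I (\<lambda>x. p x + c) (\<lambda>x. p x + c) = I p p + c * (c * ?Z)"
    unfolding I_square_add[OF p G_const] I_const[of p c] orth by simp
  moreover have "I (\<lambda>x. p x + c) (\<lambda>x. 1) = c * ?Z"
    unfolding I_add[OF p G_const G_const] orth c by simp
  ultimately show ?thesis by (simp add: power2_eq_square)
qed

text \<open>The infimum over c is replaced by the variance, which is continuous in the integrals
  whose convergence is known; C >= 0 keeps the inequality in the right direction.\<close>

lemma poincare_limit:
  fixes h :: "real ^ 'n \<Rightarrow> real" and \<alpha> :: real
  assumes P: "poincare TYPE('n) a b C" and C: "0 \<le> C"
    and h: "hom k h" and sm: "smooth h" and m: "0 < \<alpha> + k"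
  shows "C * (I (psi \<alpha> h) (psi \<alpha> h) - (I (psi \<alpha> h) (\<lambda>x. 1))\<^sup>2 / I (\<lambda>x. 1) (\<lambda>x. 1)) \<le> B (psi \<alpha> h) (psi \<alpha> h)"
proof -
  define v where "v n = (\<lambda>x. theta n x * psi \<alpha> h x)" for n
  have vt: "v n \<in> test_functions" for n unfolding v_def by (rule theta_psi_test_function[OF sm])
  note lim = theta_psi_convergence[OF h sm m, folded v_def]
  have "C * (I (v n) (v n) - (I (v n) (\<lambda>x. 1))\<^sup>2 / I (\<lambda>x. 1) (\<lambda>x. 1)) \<le> B (v n) (v n)" for n
  proof -
    have "C * (I (v n) (v n) - (I (v n) (\<lambda>x. 1))\<^sup>2 / I (\<lambda>x. 1) (\<lambda>x. 1)) \<le> C * (INF c. sqint a b (\<lambda>x. v n x - c))"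
      using INF_sqint_ge[OF test_function_G(1)[OF vt]] C by (rule mult_left_mono)
    also have "\<dots> \<le> energy a b (v n)" using P vt unfolding poincare_def by blast
    finally show ?thesis by (simp add: energy_eq_B)
  qed
  moreover have "(\<lambda>n. C * (I (v n) (v n) - (I (v n) (\<lambda>x. 1))\<^sup>2 / I (\<lambda>x. 1) (\<lambda>x. 1))) \<longlonglongrightarrow>
    C * (I (psi \<alpha> h) (psi \<alpha> h) - (I (psi \<alpha> h) (\<lambda>x. 1))\<^sup>2 / I (\<lambda>x. 1) (\<lambda>x. 1))"
    unfolding divide_inverse by (intro tendsto_mult tendsto_diff tendsto_const tendsto_power lim(2) lim(3))
  ultimately show ?thesis using lim(1) by (intro LIMSEQ_le[OF _ lim(1)]) auto
qed

section \<open>The radial and the linear modes\<close>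

definition radial :: "real ^ 'n \<Rightarrow> real" where "radial x = norm x powr s"
definition linear_mode :: "real ^ 'n \<Rightarrow> real ^ 'n \<Rightarrow> real" where
  "linear_mode e x = norm x powr (mk 1 - 1) * (e \<bullet> x)"

lemma harm_const: "harm 0 (\<lambda>x. c)" by (rule harm_low[OF hom_const]) simp
lemma harm_linear: "harm 1 (\<lambda>x. e \<bullet> x)" by (rule harm_low[OF hom_linear]) simp

lemma radial_ps: "ps 0 1 (\<lambda>x. c) = (\<lambda>x. c * radial x)"
  by (simp add: ps_def psi_def radial_def mk_zero fun_eq_iff)

lemma linear_mode_ps: "ps 1 0 (\<lambda>x. e \<bullet> x) = linear_mode e"
  by (simp add: ps_def psi_def linear_mode_def fun_eq_iff)

lemma radial_V: "V radial"
proof -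
  have "V (ps 0 1 (\<lambda>x. 1))" by (rule V_ps[OF harm_const])
  then show ?thesis unfolding radial_ps by simp
qed

lemma linear_mode_V: "V (linear_mode e)" using V_ps[OF harm_linear, of 0 e] by (simp only: linear_mode_ps)

lemma I_ps_const:
  assumes "w \<in> G"
  shows "I (ps 0 0 (\<lambda>x. c)) w = c * I (\<lambda>x. 1) w"
proof -
  have "I (ps 0 0 (\<lambda>x. c)) w = I (\<lambda>x. c * 1) w"
    by (intro I_cong ps_measurable[OF harm_const] G_measurable(1)[OF assms])
      (simp_all add: ps_def psi_def mk_zero)
  then show ?thesis unfolding I_cmult .
qed

text \<open>The shift comes from \<open>ps_weak\<close> for k = 0, j = 1, which reads B f radial = 2
  s I f radial - s (s + \<gamma>) I f 1, while constants have zero energy.\<close>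

lemma eigen_radial: "eigen (2 * s) (\<lambda>x. radial x - (s + \<gamma>) / 2)"
  unfolding eigen_def
proof (intro conjI ballI)
  let ?c = "(s + \<gamma>) / 2"
  have rG: "radial \<in> G" by (rule V_G[OF radial_V])
  show "(\<lambda>x. radial x - ?c) \<in> G" by (intro G_diff rG G_const)
  fix f assume f: "f \<in> G"
  have P: "B f (ps 0 1 (\<lambda>x. 1)) = 2 * (mk 0 + s * real 1) * I f (ps 0 1 (\<lambda>x. 1)) -
      s * real 1 * (2 * mk 0 + s * real 1 + \<gamma>) * I f (ps 0 (1 - 1) (\<lambda>x. 1))"
    by (rule ps_weak[OF f harm_const])
  have Q: "I f (ps 0 0 (\<lambda>x. 1)) = I f (\<lambda>x. 1)"
    using I_ps_const[OF f, of 1] by (simp only: I_commute[of f] mult_1_left)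
  have 1: "B f radial = 2 * s * I f radial - s * (s + \<gamma>) * I f (\<lambda>x. 1)"
    using P unfolding radial_ps mult_1_left diff_self_eq_0 Q mk_zero by simp
  have 2: "B f (\<lambda>x. radial x - ?c) = B f radial"
    using B_diff[OF rG G_const f, of ?c] B_const[of ?c f] by (simp only: B_commute[of f] diff_zero)
  have "I (\<lambda>x. ?c) f = ?c * I (\<lambda>x. 1) f" using I_cmult[of ?c "\<lambda>x. 1" f] by (simp only: mult_1_right)
  then have 3: "I f (\<lambda>x. radial x - ?c) = I f radial - ?c * I f (\<lambda>x. 1)"
    using I_diff[OF rG G_const f, of ?c] by (simp only: I_commute[of f])
  show "B f (\<lambda>x. radial x - ?c) = 2 * s * I f (\<lambda>x. radial x - ?c)"
    unfolding 1 2 3 by (simp add: algebra_simps)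
qed

lemma eigen_linear_mode: "eigen (2 * mk 1) (linear_mode e)"
  unfolding eigen_def
proof (intro conjI ballI)
  show "linear_mode e \<in> G" by (rule V_G[OF linear_mode_V])
  fix f assume f: "f \<in> G"
  show "B f (linear_mode e) = 2 * mk 1 * I f (linear_mode e)"
    using ps_weak[OF f harm_linear[of e], of 0] unfolding linear_mode_ps by simp
qed

lemma C1_eq: "C1 a b = 2 * s" by (simp add: C1_def s_eq)

lemma D1_eq: "D1 CARD('n) b = 2 * mk 1"
  unfolding D1_def \<gamma>_eq[symmetric] by (simp add: mk_def lam_def)

lemma D2_eq: "D2 CARD('n) b = 2 * mk 2"
  unfolding D2_def \<gamma>_eq[symmetric] by (simp add: mk_def lam_def)

lemma G_weighted_space: "v \<in> G \<Longrightarrow> v \<in> weighted_space a b"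
proof -
  assume v: "v \<in> G"
  have "integrable (nu a b) (\<lambda>x. \<bar>v x - c\<bar>\<^sup>2)" for c
    using G_integrable_I[OF G_diff[OF v G_const] G_diff[OF v G_const], of c c] by (simp add: power2_eq_square)
  then show ?thesis using v C1_offD(1)[OF G_C1[OF v]] by (auto simp: weighted_space_def G_def)
qed

lemma eigen_attains_equality:
  assumes p: "eigen l p"
  shows "attains_equality a b l (\<lambda>x. p x + c)"
  unfolding attains_equality_def
proof
  have pG: "p \<in> G" by (rule eigenD(1)[OF p])
  have vG: "(\<lambda>x. p x + c) \<in> G" by (rule G_add[OF pG G_const])
  then show "(\<lambda>x. p x + c) \<in> weighted_space a b" by (rule G_weighted_space)
  have E: "energy a b (\<lambda>x. p x + c) = l * I p p"
    unfolding energy_eq_B B_square_add[OF pG G_const] B_commute[of p "\<lambda>x. c"] B_const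
    using eigenD(2)[OF p pG] by simp
  show "energy a b (\<lambda>x. p x + c) = l * (INF c'. sqint a b (\<lambda>x. p x + c - c'))"
  proof (cases "l = 0")
    case True
    then show ?thesis unfolding E by simp
  next
    case False
    have orth: "I p (\<lambda>x. 1) = 0" by (rule eigen_orthogonal[OF p eigen_const False])
    have "(INF c'. sqint a b (\<lambda>x. p x + c - c')) \<le> I p p"
      using INF_sqint_le[of "\<lambda>x. p x + c" c] by simp
    moreover have "I p p \<le> (INF c'. sqint a b (\<lambda>x. p x + c - c'))"
      using INF_sqint_ge[OF vG] unfolding variance_shift[OF pG orth] .
    ultimately show ?thesis unfolding E by simp
  qed
qed

lemma attains_equality_radial:
  "attains_equality a b (C1 a b) (\<lambda>x :: real ^ 'n. a0 + a1 * norm x powr (1 + b - a))"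
proof -
  let ?c = "(s + \<gamma>) / 2"
  have "attains_equality a b (2 * s) (\<lambda>x. a1 * (radial x - ?c) + (a0 + a1 * ?c))"
    by (intro eigen_attains_equality eigen_cmult eigen_radial)
  moreover have "(\<lambda>x. a1 * (radial x - ?c) + (a0 + a1 * ?c)) = (\<lambda>x :: real ^ 'n. a0 + a1 * norm x powr (1 + b - a))"
    unfolding s_eq[symmetric] by (simp add: radial_def algebra_simps)
  ultimately show ?thesis by (simp only: C1_eq)
qed

lemma attains_equality_linear:
  "attains_equality a b (D1 CARD('n) b) (\<lambda>x :: real ^ 'n. c + norm x powr (D1 CARD('n) b / 2 - 1) * (e \<bullet> x))"
proof -
  have "attains_equality a b (2 * mk 1) (\<lambda>x. linear_mode e x + c)"
    by (intro eigen_attains_equality eigen_linear_mode)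
  then show ?thesis unfolding D1_eq by (simp add: linear_mode_def[abs_def] add.commute)
qed

text \<open>|x| powr s itself is approximated by test functions; it differs from the eigenfunction
  by a constant, which changes neither variance nor energy.\<close>

lemma poincare_le_C1:
  assumes P: "poincare TYPE('n) a b C"
  shows "C \<le> C1 a b"
proof (cases "0 \<le> C")
  case True
  let ?c = "(s + \<gamma>) / 2" and ?p = "\<lambda>x. radial x - (s + \<gamma>) / 2"
  have pG: "?p \<in> G" by (rule eigenD(1)[OF eigen_radial])
  have orth: "I ?p (\<lambda>x. 1) = 0" by (rule eigen_orthogonal[OF eigen_radial eigen_const]) (use s_pos in simp)
  have psi_eq: "psi s (\<lambda>x :: real ^ 'n. 1) = (\<lambda>x. ?p x + ?c)" by (simp add: psi_def radial_def fun_eq_iff)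
  have "C * I ?p ?p \<le> B (\<lambda>x. ?p x + ?c) (\<lambda>x. ?p x + ?c)"
    using poincare_limit[OF P True hom_const[of 1] smooth_const, of s] s_pos
    unfolding psi_eq variance_shift[OF pG orth] by simp
  also have "\<dots> = B ?p ?p"
    unfolding B_square_add[OF pG G_const] B_commute[of ?p "\<lambda>x. ?c"] B_const by simp
  also have "\<dots> = 2 * s * I ?p ?p" by (rule eigenD(2)[OF eigen_radial pG])
  finally have le: "C * I ?p ?p \<le> 2 * s * I ?p ?p" .
  have "0 < I ?p ?p"
  proof -
    \<comment> \<open>Two points at different radii: a strictly increasing radial function cannot
      vanish at both.\<close>
    obtain y :: "real ^ 'n" where y: "norm y = 1" using vector_choose_size[of 1] by auto
    obtain z :: "real ^ 'n" where z: "norm z = 2" using vector_choose_size[of 2] by auto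
    have "radial y = 1" using y by (simp add: radial_def)
    moreover have "1 < radial z" using z s_pos by (simp add: radial_def)
    ultimately have "?p y \<noteq> 0 \<or> ?p z \<noteq> 0" by auto
    moreover have "y \<noteq> 0" "z \<noteq> 0" using y z by auto
    ultimately show ?thesis using I_positive[OF pG] by blast
  qed
  then show ?thesis using le unfolding C1_eq by (simp only: mult_le_cancel_right_pos)
next
  case False
  then show ?thesis using s_pos unfolding C1_eq by linarith
qed

text \<open>For \<beta> > mk 1 the indicial polynomial is nonnegative, so \<open>weak_form\<close>
  bounds the energy of |x| powr (\<beta> - 1) (e . x) by 2 \<beta> times its squared norm. These
  functions are odd, hence orthogonal to constants, and of positive degree, so
  \<open>theta_psi_convergence\<close> applies. Then \<beta> tends to \<open>mk 1\<close>.\<close>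

lemma poincare_le_D1:
  assumes P: "poincare TYPE('n) a b C"
  shows "C \<le> D1 CARD('n) b"
proof (cases "0 \<le> C")
  case True
  have le: "C \<le> 2 * \<beta>" if \<beta>: "mk 1 < \<beta>" for \<beta>
  proof -
    have b0: "0 < \<beta>" using \<beta> mk_nonneg[of 1] by linarith
    define e :: "real ^ 'n" where "e = axis undefined 1"
    define h where "h = (\<lambda>x. e \<bullet> x)"
    define \<psi> where "\<psi> = psi (\<beta> - 1) h"
    have h1: "hom 1 h" "harm 1 h" "smooth h" unfolding h_def by (rule hom_linear harm_linear smooth_linear)+
    have m: "0 < (\<beta> - 1) + real 1" using b0 by simp
    have \<psi>G: "\<psi> \<in> G" unfolding \<psi>_def by (rule psi_G[OF h1(1) m])
    have orth: "I \<psi> (\<lambda>x. 1) = 0"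
    proof -
      have "I \<psi> (\<lambda>x. 1) = (\<integral>x. wt s (s - 2 - 2 * b) x * \<psi> x \<partial>lborel)"
        unfolding I_def using G_measurable(1)[OF \<psi>G] by (subst integral_nu(1)) simp_all
      also have "\<dots> = 0"
        using G_measurable(1)[OF \<psi>G] by (intro integral_odd) (simp_all add: wt_def \<psi>_def psi_def h_def)
      finally show ?thesis .
    qed
    have "C * I \<psi> \<psi> \<le> B \<psi> \<psi>"
      using poincare_limit[OF P True h1(1,3) m] orth unfolding \<psi>_def[symmetric] by simp
    also have "\<dots> \<le> 2 * \<beta> * I \<psi> \<psi>"
    proof -
      have "0 \<le> I \<psi> (psi (\<beta> - 1 - s) h)"
        unfolding I_def
      proof (intro integral_nonneg_AE AE_I2)
        fix x :: "real ^ 'n"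
        have "\<psi> x * psi (\<beta> - 1 - s) h x = (norm x powr (\<beta> - 1) * norm x powr (\<beta> - 1 - s)) * (h x * h x)"
          unfolding \<psi>_def psi_def by (simp only: mult_ac)
        also have "0 \<le> \<dots>" by (intro mult_nonneg_nonneg zero_le_square) simp_all
        finally show "0 \<le> \<psi> x * psi (\<beta> - 1 - s) h x" .
      qed
      moreover have "0 \<le> \<beta>\<^sup>2 + \<gamma> * \<beta> - lam 1"
      proof -
        have "(mk 1)\<^sup>2 + \<gamma> * mk 1 \<le> \<beta>\<^sup>2 + \<gamma> * \<beta>"
          using \<beta> mk_nonneg[of 1] \<gamma>_nonneg by (intro add_mono power_mono mult_left_mono) simp_all
        then show ?thesis using mk_eq[of 1] by simp
      qed
      ultimately have "0 \<le> (\<beta>\<^sup>2 + \<gamma> * \<beta> - lam 1) * I \<psi> (psi (\<beta> - 1 - s) h)" by (rule mult_nonneg_nonneg[rotated])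
      moreover have "B \<psi> \<psi> = 2 * \<beta> * I \<psi> \<psi> - (\<beta>\<^sup>2 + \<gamma> * \<beta> - lam 1) * I \<psi> (psi (\<beta> - 1 - s) h)"
        using weak_form[OF \<psi>G h1(2) m] unfolding \<psi>_def[symmetric] lam_def by simp
      ultimately show ?thesis by linarith
    qed
    finally have le: "C * I \<psi> \<psi> \<le> 2 * \<beta> * I \<psi> \<psi>" .
    have "e \<noteq> 0" by (simp add: e_def)
    moreover from this have "\<psi> e \<noteq> 0" by (simp add: \<psi>_def psi_def h_def)
    ultimately have "0 < I \<psi> \<psi>" by (rule I_positive[OF \<psi>G])
    then show ?thesis using le by (simp only: mult_le_cancel_right_pos)
  qed
  have "C \<le> 2 * mk 1 + \<epsilon>" if "0 < \<epsilon>" for \<epsilon> using le[of "mk 1 + \<epsilon> / 2"] that by simp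
  then show ?thesis unfolding D1_eq by (rule field_le_epsilon)
next
  case False
  then show ?thesis using mk_nonneg[of 1] unfolding D1_eq by linarith
qed

text \<open>Given l2 I w w <= B w w, the difference B w w - l1 I w w is at least (l2 - l1) I w w and
  also at least (1 - l1 / l2) B w w: one spectral bound serves both notions of distance.\<close>

lemma gap_estimates:
  assumes w: "w \<in> G" "appr w" and p: "eigen l1 p" "I w p = 0" and v: "v = (\<lambda>x. w x + p x + c)"
    and l: "0 \<le> l1" "l1 < l2"
    and low: "\<And>k j h. harm k h \<Longrightarrow> 2 * (mk k + s * real j) < l2 \<Longrightarrow> I (ps k j h) w = 0"
  shows "(l2 - l1) * I w w \<le> energy a b v - l1 * (INF c. sqint a b (\<lambda>x. v x - c))"
    "(1 - l1 / l2) * B w w \<le> energy a b v - l1 * (INF c. sqint a b (\<lambda>x. v x - c))"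
proof -
  have l2: "0 < l2" using l by linarith
  have sg: "l2 * I w w \<le> B w w" using l2 by (intro spectral_gap w low) simp_all
  have g: "B w w - l1 * I w w \<le> energy a b v - l1 * (INF c. sqint a b (\<lambda>x. v x - c))"
    by (rule gap[OF w(1) p v l(1)])
  show "(l2 - l1) * I w w \<le> energy a b v - l1 * (INF c. sqint a b (\<lambda>x. v x - c))"
    using sg g by (simp add: left_diff_distrib)
  have "I w w \<le> B w w / l2" using sg l2 by (simp add: le_divide_eq mult.commute)
  then have "l1 * I w w \<le> l1 * (B w w / l2)" using l(1) by (rule mult_left_mono)
  then show "(1 - l1 / l2) * B w w \<le> energy a b v - l1 * (INF c. sqint a b (\<lambda>x. v x - c))"
    using g by (simp add: left_diff_distrib)
qed

text \<open>Passes from one explicit candidate z to the infimum, and from \<kappa> to the possibly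
  smaller constant of the claim.\<close>

lemma stability_transfer:
  fixes F :: "'p \<Rightarrow> real"
  assumes "\<kappa> * x \<le> E" "F z = x" "\<And>z. 0 \<le> F z" "0 \<le> \<kappa>'" "\<kappa>' \<le> \<kappa>"
  shows "\<kappa>' * (INF z. F z) \<le> E"
proof -
  have "(INF z. F z) \<le> F z"
    by (rule cINF_lower[OF bdd_belowI[of _ 0]]) (use assms(3) in auto)
  then have "\<kappa>' * (INF z. F z) \<le> \<kappa>' * x" using assms(2,4) by (simp add: mult_left_mono)
  also have "\<dots> \<le> \<kappa> * x" using assms(2,3,5) by (metis mult_right_mono)
  finally show ?thesis using assms(1) by linarith
qed

lemma energy_add_const: "w \<in> G \<Longrightarrow> energy a b (\<lambda>x. w x + c) = B w w"
  unfolding energy_eq_B B_square_add[OF _ G_const] B_commute[of w "\<lambda>x. c"] B_const by simp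

lemma low_const:
  assumes w: "w \<in> G" "I w (\<lambda>x. 1) = 0" and h: "harm 0 h"
  shows "I (ps 0 0 h) w = 0"
proof -
  obtain c where "h = (\<lambda>x. c)" using h hom_0D unfolding harm_def by blast
  then show ?thesis using I_ps_const[OF w(1)] w(2) by (simp add: I_commute[of w])
qed

lemma low_radial:
  assumes w: "I w radial = 0" and h: "harm 0 h"
  shows "I (ps 0 1 h) w = 0"
proof -
  obtain c where c: "h = (\<lambda>x. c)" using h hom_0D unfolding harm_def by blast
  show ?thesis unfolding c radial_ps I_cmult using w by (simp add: I_commute[of w])
qed

lemma low_linear:
  assumes w: "\<And>e. I w (linear_mode e) = 0" and h: "harm 1 h"
  shows "I (ps 1 0 h) w = 0"
proof -
  obtain e where e: "h = (\<lambda>x. e \<bullet> x)" using h hom_1D unfolding harm_def by blast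
  show ?thesis unfolding e linear_mode_ps using w by (simp add: I_commute[of w])
qed

lemma linear_mode_sum: "(\<Sum>i\<in>UNIV. e i * linear_mode (axis i 1) x) = linear_mode (\<chi> i. e i) x"
proof -
  have "linear_mode (axis i 1) x = norm x powr (mk 1 - 1) * x $ i" for i
    unfolding linear_mode_def inner_axis' by simp
  then show ?thesis by (simp add: linear_mode_def[of "\<chi> i. e i"] inner_vec_def sum_distrib_left mult.left_commute)
qed

section \<open>Projections onto the lowest modes\<close>

lemma projectable_const: "projectable (ext {\<lambda>x. 0} (\<lambda>x. 1))"
  by (rule projectable_ext[OF projectable_zero G_const])

lemma projection_const_radial:
  assumes v: "v \<in> G" "appr v"
  obtains w c d where "w \<in> G" "appr w" "v = (\<lambda>x. w x + d * radial x + c)"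
    "I w (\<lambda>x. 1) = 0" "I w radial = 0"
proof -
  let ?S = "ext (ext {\<lambda>x. 0} (\<lambda>x. 1)) radial"
  have rG: "radial \<in> G" by (rule V_G[OF radial_V])
  have "projectable ?S" by (rule projectable_ext[OF projectable_const rG])
  then obtain q where q: "q \<in> ?S" "\<And>g. g \<in> ?S \<Longrightarrow> I (\<lambda>x. v x - q x) g = 0"
    using v(1) unfolding projectable_def by blast
  then obtain c d where qq: "q = (\<lambda>x. (0 + c * 1) + d * radial x)" unfolding ext_def by auto
  have mem: "(\<lambda>x. (0 + c * 1) + d * radial x) \<in> ?S" for c d
    by (rule extI[where q = "\<lambda>x. 0 + c * 1" and c = d], rule extI[where q = "\<lambda>x. 0" and c = c]) simp_all
  show ?thesis
  proof (rule that[of "\<lambda>x. v x - q x" d c])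
    have qG: "q \<in> G" unfolding qq by (intro G_add G_cmult G_const rG)
    show "(\<lambda>x. v x - q x) \<in> G" by (rule G_diff[OF v(1) qG])
    have "appr (\<lambda>x. v x + (- 1) * ((0 + c * 1) + d * radial x))"
      by (intro appr_add v appr_cmult appr_const appr_V radial_V)
    moreover have "(\<lambda>x. v x - q x) = (\<lambda>x. v x + (- 1) * ((0 + c * 1) + d * radial x))" by (simp add: qq fun_eq_iff)
    ultimately show "appr (\<lambda>x. v x - q x)" by (simp only:)
    show "v = (\<lambda>x. v x - q x + d * radial x + c)" by (simp add: qq)
    show "I (\<lambda>x. v x - q x) (\<lambda>x. 1) = 0" using q(2)[OF mem[of 1 0]] by simp
    show "I (\<lambda>x. v x - q x) radial = 0" using q(2)[OF mem[of 0 1]] by simp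
  qed
qed

text \<open>The linear modes are spanned by those in the coordinate directions, so a finite family
  suffices. S is left open to allow the constants alone, or the constants together with
  \<open>radial\<close>.\<close>

lemma projection_linear:
  assumes S: "projectable S" and Sa: "\<And>q. q \<in> S \<Longrightarrow> appr q" and v: "v \<in> G" "appr v"
  obtains w q e where "w \<in> G" "appr w" "q \<in> S" "v = (\<lambda>x. w x + q x + linear_mode e x)"
    "\<forall>g\<in>S. I w g = 0" "\<forall>e. I w (linear_mode e) = 0"
proof -
  let ?S = "{\<lambda>x. q x + (\<Sum>i\<in>UNIV. e i * linear_mode (axis i 1) x) | q e. q \<in> S}"
  have lG: "linear_mode e \<in> G" for e by (rule V_G[OF linear_mode_V])
  have S0: "(\<lambda>x. 0) \<in> S" and SG: "\<And>q. q \<in> S \<Longrightarrow> q \<in> G" using S by (auto simp: projectable_def lin_def)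
  have "projectable ?S" by (rule projectable_family[OF S lG]) simp
  then obtain q' where q': "q' \<in> ?S" "\<And>g. g \<in> ?S \<Longrightarrow> I (\<lambda>x. v x - q' x) g = 0"
    using v(1) unfolding projectable_def by blast
  then obtain q e0 where q: "q \<in> S" and qq0: "q' = (\<lambda>x. q x + (\<Sum>i\<in>UNIV. e0 i * linear_mode (axis i 1) x))" by blast
  define e where "e = (\<chi> i. e0 i)"
  have qq: "q' = (\<lambda>x. q x + linear_mode e x)" unfolding qq0 linear_mode_sum e_def ..
  have mem: "(\<lambda>x. g x + linear_mode e x) \<in> ?S" if "g \<in> S" for g e
  proof -
    have "(\<lambda>x. g x + (\<Sum>i\<in>UNIV. (($) e) i * linear_mode (axis i 1) x)) \<in> ?S" using that by blast
    then show ?thesis unfolding linear_mode_sum by (simp add: vec_nth_inverse)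
  qed
  show ?thesis
  proof (rule that[of "\<lambda>x. v x - q' x" q e])
    show wG: "(\<lambda>x. v x - q' x) \<in> G" unfolding qq by (intro G_diff G_add v SG q lG)
    have "appr (\<lambda>x. v x + (- 1) * (q x + linear_mode e x))"
      by (intro appr_add v appr_cmult Sa q appr_V linear_mode_V)
    moreover have "(\<lambda>x. v x - q' x) = (\<lambda>x. v x + (- 1) * (q x + linear_mode e x))" by (simp add: qq fun_eq_iff)
    ultimately show "appr (\<lambda>x. v x - q' x)" by (simp only:)
    show "q \<in> S" by (rule q)
    show "v = (\<lambda>x. v x - q' x + q x + linear_mode e x)" by (simp add: qq)
    show "\<forall>g\<in>S. I (\<lambda>x. v x - q' x) g = 0"
    proof
      fix g assume g: "g \<in> S"
      have "linear_mode 0 = (\<lambda>x. 0)" by (simp add: linear_mode_def fun_eq_iff)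
      then show "I (\<lambda>x. v x - q' x) g = 0" using q'(2)[OF mem[OF g, of 0]] by simp
    qed
    show "\<forall>e. I (\<lambda>x. v x - q' x) (linear_mode e) = 0" using q'(2)[OF mem[OF S0]] by simp
  qed
qed


section \<open>Stability\<close>

lemma powr_D1_eq_linear_mode: "norm x powr (D1 CARD('n) b / 2 - 1) * (e \<bullet> x) = linear_mode e x"
  by (simp add: D1_eq linear_mode_def)

lemma powr_eq_radial: "norm x powr (1 + b - a) = radial x"
  unfolding radial_def s_eq[symmetric] ..

lemma ext_const_cases:
  assumes "q \<in> ext {\<lambda>x. 0} (\<lambda>x. 1)"
  shows "\<exists>c. q = (\<lambda>x. c)"
proof -
  obtain q' c where "q' \<in> {\<lambda>x. 0}" "q = (\<lambda>x. q' x + c * 1)" using assms unfolding ext_def by blast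
  then show ?thesis by (intro exI[of _ c]) simp
qed

lemma ext_const_radial_cases:
  assumes "q \<in> ext (ext {\<lambda>x. 0} (\<lambda>x. 1)) radial"
  shows "\<exists>c d. q = (\<lambda>x. c + d * radial x)"
proof -
  obtain q' d where q: "q' \<in> ext {\<lambda>x. 0} (\<lambda>x. 1)" "q = (\<lambda>x. q' x + d * radial x)"
    using assms unfolding ext_def[of _ radial] by blast
  obtain c where "q' = (\<lambda>x. c)" using ext_const_cases[OF q(1)] by blast
  then show ?thesis using q(2) by (intro exI[of _ c] exI[of _ d]) simp
qed

text \<open>Eigenvalues grow with k and with j, so together with \<open>order_less_of_low\<close> a
  threshold leaves finitely many pairs (k, j) to inspect.\<close>

lemma degree_less_of_low:
  assumes "2 * (mk k + s * real j) < l2" "l2 \<le> 2 * mk n"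
  shows "k < n"
proof (rule ccontr)
  assume "\<not> k < n"
  then have "mk n \<le> mk k" by (intro mk_mono) simp
  then have "2 * mk n \<le> 2 * mk k" by simp
  also have "\<dots> \<le> 2 * (mk k + s * real j)" using s_pos by simp
  finally have "l2 \<le> 2 * (mk k + s * real j)" by (rule order_trans[OF assms(2)])
  from leD[OF this] assms(1) show False by (rule notE)
qed

text \<open>Strict because lam 1 = N - 1 and lam 2 = 2 N.\<close>

lemma mk_less: "mk 1 < mk 2"
proof -
  have "lam 1 < lam 2" using card_ge_1 by (simp add: lam_def)
  then have "sqrt (\<gamma>\<^sup>2 + 4 * lam 1) < sqrt (\<gamma>\<^sup>2 + 4 * lam 2)" by (intro real_sqrt_less_mono) simp
  then show ?thesis by (simp add: mk_def)
qed

lemma order_less_of_low: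
  assumes "2 * (mk k + s * real j) < l2" "l2 \<le> 2 * s * real n"
  shows "j < n"
proof (rule ccontr)
  assume "\<not> j < n"
  then have "2 * s * real n \<le> 2 * (s * real j)" using s_pos by simp
  also have "\<dots> \<le> 2 * (mk k + s * real j)" using mk_nonneg[of k] by simp
  finally have "l2 \<le> 2 * (mk k + s * real j)" by (rule order_trans[OF assms(2)])
  from leD[OF this] assms(1) show False by (rule notE)
qed

lemma stability_C1:
  fixes v :: "real ^ 'n \<Rightarrow> real"
  assumes lt: "C1 a b < D1 CARD('n) b" and v: "v \<in> test_functions"
  defines "E \<equiv> energy a b v - C1 a b * (INF c. sqint a b (\<lambda>x. v x - c))"
  shows "min (1 / 2) (1 - C1 a b / D1 CARD('n) b) * (INF d. energy a b (\<lambda>x. v x - d * norm x powr (1 + b - a))) \<le> E"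
    "min (C1 a b) (D1 CARD('n) b - C1 a b) *
      (INF (c, d) \<in> UNIV. sqint a b (\<lambda>x. v x - c - d * norm x powr (1 + b - a))) \<le> E"
    "0 \<le> E"
proof -
  \<comment> \<open>The threshold min{2 C1, D1}: below it only the pairs (k, j) = (0, 0) and (0, 1)
    remain, and l2 - C1 is min{C1, D1 - C1}.\<close>
  define l2 where "l2 = min (2 * s * real 2) (2 * mk 1)"
  obtain w c d where w: "w \<in> G" "appr w" and vw: "v = (\<lambda>x. w x + d * radial x + c)"
    and orth: "I w (\<lambda>x. 1) = 0" "I w radial = 0"
    using projection_const_radial[OF test_function_G[OF v]] by blast
  have rG: "radial \<in> G" by (rule V_G[OF radial_V])
  let ?c0 = "(s + \<gamma>) / 2"
  \<comment> \<open>The projection was onto 1 and \<open>radial\<close>; moving a constant turns the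
    radial part into an eigenfunction.\<close>
  define p where "p = (\<lambda>x. d * (radial x - ?c0))"
  have p: "eigen (2 * s) p" unfolding p_def by (intro eigen_cmult eigen_radial)
  have "I (\<lambda>x. radial x - ?c0) w = 0"
    using I_diff[OF rG G_const w(1), of ?c0] orth(2) orth(1) I_cmult[of ?c0 "\<lambda>x. 1" w]
    by (simp add: I_commute[of w])
  then have wp: "I w p = 0" unfolding p_def I_commute[of w] I_cmult by simp
  have vp: "v = (\<lambda>x. w x + p x + (c + d * ?c0))" unfolding vw p_def by (simp add: fun_eq_iff algebra_simps)
  have lt': "2 * s < 2 * mk 1" using lt by (simp only: C1_eq D1_eq)
  then have l: "2 * s < l2" using s_pos by (simp add: l2_def)
  have low: "I (ps k j h) w = 0" if h: "harm k h" and lo: "2 * (mk k + s * real j) < l2" for k j h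
  proof -
    have "k < 1" by (rule degree_less_of_low[OF lo]) (simp add: l2_def)
    then have k: "k = 0" by simp
    have "j < 2" by (rule order_less_of_low[OF lo]) (simp only: l2_def min.cobounded1)
    then have "j = 0 \<or> j = 1" by linarith
    then show ?thesis using low_const[OF w(1) orth(1)] low_radial[OF orth(2)] h unfolding k by blast
  qed
  note est = gap_estimates[OF w p wp vp _ l low, folded C1_eq E_def]
  have c0: "0 \<le> C1 a b" using s_pos by (simp add: C1_eq)
  have l': "0 < l2" using l s_pos by linarith
  have d1: "0 < D1 CARD('n) b" using lt' s_pos by (simp add: D1_eq)
  have e1: "(l2 - C1 a b) * I w w \<le> E" and e2: "(1 - C1 a b / l2) * B w w \<le> E"
    using est c0 unfolding E_def by simp_all
  have l2': "l2 = min (2 * C1 a b) (D1 CARD('n) b)" by (simp add: l2_def C1_eq D1_eq)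
  show "0 \<le> E" using e1 l I_nonneg[of w] C1_eq by (smt (verit) mult_nonneg_nonneg)
  show "min (1 / 2) (1 - C1 a b / D1 CARD('n) b) * (INF d. energy a b (\<lambda>x. v x - d * norm x powr (1 + b - a))) \<le> E"
  proof (rule stability_transfer[OF e2, where z = d])
    \<comment> \<open>Constants do not affect the energy, hence an infimum over d alone.\<close>
    have "(\<lambda>x. v x - d * radial x) = (\<lambda>x. w x + c)" by (simp add: vw fun_eq_iff)
    then show "energy a b (\<lambda>x. v x - d * norm x powr (1 + b - a)) = B w w"
      unfolding powr_eq_radial using energy_add_const[OF w(1)] by (simp only:)
    show "0 \<le> min (1 / 2) (1 - C1 a b / D1 CARD('n) b)" using lt d1 by simp
    \<comment> \<open>If 2 C1 is the smaller bound, the relative gap is 1 - C1 / (2 C1) = 1 /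
      2.\<close>
    show "min (1 / 2) (1 - C1 a b / D1 CARD('n) b) \<le> 1 - C1 a b / l2"
    proof (cases "2 * C1 a b \<le> D1 CARD('n) b")
      case True
      then have "1 - C1 a b / l2 = 1 / 2" using s_pos by (simp add: l2' C1_eq)
      then show ?thesis by (simp only: min.cobounded1)
    next
      case False
      then show ?thesis by (simp add: l2' min_def)
    qed
  qed (simp add: energy_eq_B B_nonneg)
  show "min (C1 a b) (D1 CARD('n) b - C1 a b) *
      (INF (c, d) \<in> UNIV. sqint a b (\<lambda>x. v x - c - d * norm x powr (1 + b - a))) \<le> E"
  proof (rule stability_transfer[OF e1, where z = "(c, d)"])
    have "(\<lambda>x. v x - c - d * radial x) = w" by (simp add: vw fun_eq_iff)
    then show "(case (c, d) of (c, d) \<Rightarrow> sqint a b (\<lambda>x. v x - c - d * norm x powr (1 + b - a))) = I w w"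
      unfolding powr_eq_radial by (simp add: sqint_eq_I)
    show "0 \<le> min (C1 a b) (D1 CARD('n) b - C1 a b)" using lt c0 by simp
    show "min (C1 a b) (D1 CARD('n) b - C1 a b) \<le> l2 - C1 a b" by (simp add: l2' min_def)
  qed (auto simp: sqint_eq_I I_nonneg split: prod.split)
qed

lemma stability_D1:
  fixes v :: "real ^ 'n \<Rightarrow> real"
  assumes lt: "D1 CARD('n) b < C1 a b" and v: "v \<in> test_functions"
  defines "E \<equiv> energy a b v - D1 CARD('n) b * (INF c. sqint a b (\<lambda>x. v x - c))"
  shows "min (C1 a b - D1 CARD('n) b) (D2 CARD('n) b - D1 CARD('n) b) *
      (INF (c, e) \<in> UNIV. sqint a b (\<lambda>x. v x - c - norm x powr (D1 CARD('n) b / 2 - 1) * (e \<bullet> x))) \<le> E"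
    "min (1 - D1 CARD('n) b / C1 a b) (1 - D1 CARD('n) b / D2 CARD('n) b) *
      (INF (c, e) \<in> UNIV. energy a b (\<lambda>x. v x - c - norm x powr (D1 CARD('n) b / 2 - 1) * (e \<bullet> x))) \<le> E"
    "0 \<le> E"
proof -
  \<comment> \<open>The threshold min{C1, D2} leaves (0, 0) and (1, 0): the pair (0, 1) has
    eigenvalue C1, the pair (1, 1) has D1 + C1 >= C1, and degree 2 starts at D2.\<close>
  define l2 where "l2 = min (2 * s * real 1) (2 * mk 2)"
  let ?S = "ext {\<lambda>x. 0} (\<lambda>x :: real ^ 'n. 1)"
  have Sa: "appr q" if "q \<in> ?S" for q
    using ext_const_cases[OF that] appr_const by auto
  obtain w q e where w: "w \<in> G" "appr w" and q: "q \<in> ?S" and vq: "v = (\<lambda>x. w x + q x + linear_mode e x)"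
    and orthS': "\<forall>g\<in>?S. I w g = 0" and orthL': "\<forall>e. I w (linear_mode e) = 0"
    by (rule projection_linear[OF projectable_const Sa test_function_G[OF v]])
  note orthS = bspec[OF orthS'] and orthL = spec[OF orthL']
  obtain c where c: "q = (\<lambda>x. c)" using ext_const_cases[OF q] by blast
  have "(\<lambda>x. 1) \<in> ?S" by (rule extI[where q = "\<lambda>x. 0" and c = 1]) simp_all
  then have orth1: "I w (\<lambda>x. 1) = 0" by (rule orthS)
  have vp: "v = (\<lambda>x. w x + linear_mode e x + c)" unfolding vq c by (simp add: fun_eq_iff)
  have lt': "2 * mk 1 < 2 * s" using lt by (simp only: C1_eq D1_eq)
  have m12: "mk 1 < mk 2" using mk_less by simp
  then have l: "2 * mk 1 < l2" using lt' by (simp add: l2_def)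
  have low: "I (ps k j h) w = 0" if h: "harm k h" and lo: "2 * (mk k + s * real j) < l2" for k j h
  proof -
    have "k < 2" by (rule degree_less_of_low[OF lo]) (simp add: l2_def)
    then have k: "k = 0 \<or> k = 1" by linarith
    have "j < 1" by (rule order_less_of_low[OF lo]) (simp only: l2_def min.cobounded1)
    then have j: "j = 0" by simp
    show ?thesis using k low_const[OF w(1) orth1] low_linear[OF orthL] h unfolding j by blast
  qed
  note est = gap_estimates[OF w eigen_linear_mode orthL vp _ l low, folded D1_eq E_def]
  have d0: "0 \<le> D1 CARD('n) b" using mk_nonneg[of 1] by (simp add: D1_eq)
  have d2: "D1 CARD('n) b < D2 CARD('n) b" using m12 by (simp add: D1_eq D2_eq)
  have e1: "(l2 - D1 CARD('n) b) * I w w \<le> E" and e2: "(1 - D1 CARD('n) b / l2) * B w w \<le> E"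
    using est d0 unfolding E_def by simp_all
  have l2': "l2 = min (C1 a b) (D2 CARD('n) b)" by (simp add: l2_def C1_eq D2_eq)
  show "0 \<le> E" using e1 l I_nonneg[of w] D1_eq by (smt (verit) mult_nonneg_nonneg)
  show "min (C1 a b - D1 CARD('n) b) (D2 CARD('n) b - D1 CARD('n) b) *
      (INF (c, e) \<in> UNIV. sqint a b (\<lambda>x. v x - c - norm x powr (D1 CARD('n) b / 2 - 1) * (e \<bullet> x))) \<le> E"
  proof (rule stability_transfer[OF e1, where z = "(c, e)"])
    have "(\<lambda>x. v x - c - linear_mode e x) = w" by (simp add: vp fun_eq_iff)
    then show "(case (c, e) of (c, e) \<Rightarrow> sqint a b (\<lambda>x. v x - c - norm x powr (D1 CARD('n) b / 2 - 1) * (e \<bullet> x))) = I w w"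
      unfolding powr_D1_eq_linear_mode by (simp add: sqint_eq_I)
    show "0 \<le> min (C1 a b - D1 CARD('n) b) (D2 CARD('n) b - D1 CARD('n) b)" using lt d2 by simp
    show "min (C1 a b - D1 CARD('n) b) (D2 CARD('n) b - D1 CARD('n) b) \<le> l2 - D1 CARD('n) b" by (simp add: l2' min_def)
  qed (auto simp: sqint_eq_I I_nonneg split: prod.split)
  show "min (1 - D1 CARD('n) b / C1 a b) (1 - D1 CARD('n) b / D2 CARD('n) b) *
      (INF (c, e) \<in> UNIV. energy a b (\<lambda>x. v x - c - norm x powr (D1 CARD('n) b / 2 - 1) * (e \<bullet> x))) \<le> E"
  proof (rule stability_transfer[OF e2, where z = "(c, e)"])
    have "(\<lambda>x. v x - c - linear_mode e x) = w" by (simp add: vp fun_eq_iff)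
    then show "(case (c, e) of (c, e) \<Rightarrow> energy a b (\<lambda>x. v x - c - norm x powr (D1 CARD('n) b / 2 - 1) * (e \<bullet> x))) = B w w"
      unfolding powr_D1_eq_linear_mode by (simp add: energy_eq_B)
    show "0 \<le> min (1 - D1 CARD('n) b / C1 a b) (1 - D1 CARD('n) b / D2 CARD('n) b)" using lt d2 d0 by simp
    show "min (1 - D1 CARD('n) b / C1 a b) (1 - D1 CARD('n) b / D2 CARD('n) b) \<le> 1 - D1 CARD('n) b / l2"
      by (simp add: l2' min_def)
  qed (auto simp: energy_eq_B B_nonneg split: prod.split)
qed

lemma stability_C1_D1:
  fixes v :: "real ^ 'n \<Rightarrow> real"
  assumes eq: "C1 a b = D1 CARD('n) b" and v: "v \<in> test_functions"
  defines "E \<equiv> energy a b v - D1 CARD('n) b * (INF c. sqint a b (\<lambda>x. v x - c))"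
  shows "min (D1 CARD('n) b) (D2 CARD('n) b - D1 CARD('n) b) *
      (INF (c, d, e) \<in> UNIV. sqint a b (\<lambda>x. v x - c - d * norm x powr (1 + b - a)
        - norm x powr (D1 CARD('n) b / 2 - 1) * (e \<bullet> x))) \<le> E"
    "min (1 / 2) (1 - D1 CARD('n) b / D2 CARD('n) b) *
      (INF (c, d, e) \<in> UNIV. energy a b (\<lambda>x. v x - c - d * norm x powr (1 + b - a)
        - norm x powr (D1 CARD('n) b / 2 - 1) * (e \<bullet> x))) \<le> E"
    "0 \<le> E"
proof -
  \<comment> \<open>C1 = D1 belongs to both (0, 1) and (1, 0). The next candidates are 2 C1 for (0,
    2), which is also the value D1 + C1 of (1, 1), and D2.\<close>
  define l2 where "l2 = min (2 * s * real 2) (2 * mk 2)"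
  let ?S = "ext (ext {\<lambda>x. 0} (\<lambda>x. 1)) radial"
  have rG: "radial \<in> G" by (rule V_G[OF radial_V])
  have Sa: "appr q" if qS: "q \<in> ?S" for q
  proof -
    obtain c d where q: "q = (\<lambda>x. c + d * radial x)" using ext_const_radial_cases[OF qS] by blast
    show ?thesis unfolding q by (intro appr_add appr_cmult appr_const appr_V radial_V)
  qed
  have SP: "projectable ?S" by (rule projectable_ext[OF projectable_const rG])
  obtain w q e where w: "w \<in> G" "appr w" and q: "q \<in> ?S" and vq: "v = (\<lambda>x. w x + q x + linear_mode e x)"
    and orthS': "\<forall>g\<in>?S. I w g = 0" and orthL': "\<forall>e. I w (linear_mode e) = 0"
    by (rule projection_linear[OF SP Sa test_function_G[OF v]])
  note orthS = bspec[OF orthS'] and orthL = spec[OF orthL']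
  obtain c d where c: "q = (\<lambda>x. c + d * radial x)" using ext_const_radial_cases[OF q] by blast
  have mem: "(\<lambda>x. (0 + c * 1) + d * radial x) \<in> ?S" for c d
    by (rule extI[where q = "\<lambda>x. 0 + c * 1" and c = d], rule extI[where q = "\<lambda>x. 0" and c = c]) simp_all
  have orth1: "I w (\<lambda>x. 1) = 0" using orthS[OF mem[of 1 0]] by simp
  have orthr: "I w radial = 0" using orthS[OF mem[of 0 1]] by simp
  let ?c0 = "(s + \<gamma>) / 2"
  \<comment> \<open>A sum of eigenfunctions for the same eigenvalue, so that a single
    \<open>p\<close> covers both modes.\<close>
  define p where "p = (\<lambda>x. d * (radial x - ?c0) + linear_mode e x)"
  have eq': "2 * s = 2 * mk 1" using eq by (simp only: C1_eq D1_eq)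
  have rad: "eigen (2 * mk 1) (\<lambda>x. d * (radial x - ?c0))" unfolding eq'[symmetric] by (intro eigen_cmult eigen_radial)
  have p: "eigen (2 * mk 1) p" unfolding p_def by (rule eigen_add[OF rad eigen_linear_mode])
  have wp: "I w p = 0"
  proof -
    have "I (\<lambda>x. radial x - ?c0) w = 0"
      using I_diff[OF rG G_const w(1), of ?c0] orthr orth1 I_cmult[of ?c0 "\<lambda>x. 1" w]
      by (simp add: I_commute[of w])
    then have "I (\<lambda>x. d * (radial x - ?c0)) w = 0" unfolding I_cmult by simp
    then have "I p w = 0"
      unfolding p_def I_add[OF eigenD(1)[OF rad] eigenD(1)[OF eigen_linear_mode] w(1)]
      using orthL[of e] by (simp add: I_commute[of w])
    then show ?thesis by (simp add: I_commute[of w])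
  qed
  have vp: "v = (\<lambda>x. w x + p x + (c + d * ?c0))" unfolding vq c p_def by (simp add: fun_eq_iff algebra_simps)
  have m12: "mk 1 < mk 2" using mk_less by simp
  then have l: "2 * mk 1 < l2" using eq' s_pos by (simp add: l2_def)
  have low: "I (ps k j h) w = 0" if h: "harm k h" and lo: "2 * (mk k + s * real j) < l2" for k j h
  proof -
    have "k < 2" by (rule degree_less_of_low[OF lo]) (simp add: l2_def)
    then have k: "k = 0 \<or> k = 1" by linarith
    have j: "j < 2" by (rule order_less_of_low[OF lo]) (simp only: l2_def min.cobounded1)
    have "2 * (mk k + s * real j) < 4 * s" using lo by (simp add: l2_def)
    \<comment> \<open>The pair (1, 1) has eigenvalue 2 (mk 1 + s) = 4 s, which is not below the
      threshold.\<close>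
    then have "k = 1 \<Longrightarrow> j = 0" using eq' j s_pos by (cases "j = 1") auto
    then consider "k = 0" "j = 0" | "k = 0" "j = 1" | "k = 1" "j = 0" using k j by linarith
    then show ?thesis using low_const[OF w(1) orth1] low_radial[OF orthr] low_linear[OF orthL] h by cases blast+
  qed
  note est = gap_estimates[OF w p wp vp _ l low, folded D1_eq E_def]
  have d0: "0 < D1 CARD('n) b" using eq' s_pos by (simp add: D1_eq)
  have d2: "D1 CARD('n) b < D2 CARD('n) b" using m12 by (simp add: D1_eq D2_eq)
  have e1: "(l2 - D1 CARD('n) b) * I w w \<le> E" and e2: "(1 - D1 CARD('n) b / l2) * B w w \<le> E"
    using est d0 unfolding E_def by simp_all
  have l2': "l2 = min (2 * D1 CARD('n) b) (D2 CARD('n) b)" using eq' by (simp add: l2_def D1_eq D2_eq)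
  show "0 \<le> E" using e1 l I_nonneg[of w] D1_eq by (smt (verit) mult_nonneg_nonneg)
  have vw: "(\<lambda>x. v x - c - d * radial x - linear_mode e x) = w" by (simp add: vq c fun_eq_iff)
  show "min (D1 CARD('n) b) (D2 CARD('n) b - D1 CARD('n) b) *
      (INF (c, d, e) \<in> UNIV. sqint a b (\<lambda>x. v x - c - d * norm x powr (1 + b - a)
        - norm x powr (D1 CARD('n) b / 2 - 1) * (e \<bullet> x))) \<le> E"
  proof (rule stability_transfer[OF e1, where z = "(c, d, e)"])
    show "(case (c, d, e) of (c, d, e) \<Rightarrow> sqint a b (\<lambda>x. v x - c - d * norm x powr (1 + b - a)
        - norm x powr (D1 CARD('n) b / 2 - 1) * (e \<bullet> x))) = I w w"
      unfolding powr_D1_eq_linear_mode powr_eq_radial using vw by (simp add: sqint_eq_I)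
    show "0 \<le> min (D1 CARD('n) b) (D2 CARD('n) b - D1 CARD('n) b)" using d0 d2 by simp
    show "min (D1 CARD('n) b) (D2 CARD('n) b - D1 CARD('n) b) \<le> l2 - D1 CARD('n) b" by (simp add: l2' min_def)
  qed (auto simp: sqint_eq_I I_nonneg split: prod.split)
  show "min (1 / 2) (1 - D1 CARD('n) b / D2 CARD('n) b) *
      (INF (c, d, e) \<in> UNIV. energy a b (\<lambda>x. v x - c - d * norm x powr (1 + b - a)
        - norm x powr (D1 CARD('n) b / 2 - 1) * (e \<bullet> x))) \<le> E"
  proof (rule stability_transfer[OF e2, where z = "(c, d, e)"])
    show "(case (c, d, e) of (c, d, e) \<Rightarrow> energy a b (\<lambda>x. v x - c - d * norm x powr (1 + b - a)
        - norm x powr (D1 CARD('n) b / 2 - 1) * (e \<bullet> x))) = B w w"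
      unfolding powr_D1_eq_linear_mode powr_eq_radial using vw by (simp add: energy_eq_B)
    show "0 \<le> min (1 / 2) (1 - D1 CARD('n) b / D2 CARD('n) b)" using d0 d2 by simp
    show "min (1 / 2) (1 - D1 CARD('n) b / D2 CARD('n) b) \<le> 1 - D1 CARD('n) b / l2"
    proof (cases "2 * D1 CARD('n) b \<le> D2 CARD('n) b")
      case True
      then have "1 - D1 CARD('n) b / l2 = 1 / 2" using d0 by (simp add: l2')
      then show ?thesis by (simp only: min.cobounded1)
    next
      case False
      then show ?thesis by (simp add: l2' min_def)
    qed
  qed (auto simp: energy_eq_B B_nonneg split: prod.split)
qed

lemma poincare_min: "poincare TYPE('n) a b (min (C1 a b) (D1 CARD('n) b))"
  unfolding poincare_def
proof
  fix v :: "real ^ 'n \<Rightarrow> real"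
  assume v: "v \<in> test_functions"
  consider "C1 a b < D1 CARD('n) b" | "D1 CARD('n) b < C1 a b" | "C1 a b = D1 CARD('n) b" by linarith
  then show "min (C1 a b) (D1 CARD('n) b) * (INF c. sqint a b (\<lambda>x. v x - c)) \<le> energy a b v"
  proof cases
    case 1
    then show ?thesis using stability_C1(3)[OF 1 v] by (simp add: min_def)
  next
    case 2
    then show ?thesis using stability_D1(3)[OF 2 v] by (simp add: min_def)
  next
    case 3
    then show ?thesis using stability_C1_D1(3)[OF 3 v] by (simp add: min_def)
  qed
qed

lemma optimal_poincare_min: "optimal_poincare_constant TYPE('n) a b (min (C1 a b) (D1 CARD('n) b))"
  unfolding optimal_poincare_constant_def using poincare_min poincare_le_C1 poincare_le_D1 by simp

end

theorem theorem2p4: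
  fixes a b C_PI :: real and N :: nat
  assumes N: "N = CARD('n::finite)"
    and ab: "1 + b - a > 0"
    and b: "b \<le> (real N - 2) / 2"
    and C_PI: "C_PI = min (C1 a b) (D1 N b)"
  shows
    "(\<forall>v \<in> (test_functions :: (real ^ 'n \<Rightarrow> real) set).
        energy a b v \<ge> C_PI * (INF c. sqint a b (\<lambda>x. v x - c)))
   \<and> optimal_poincare_constant TYPE('n) a b C_PI
   \<and> (C_PI = C1 a b \<longrightarrow>
        (\<forall>a0 a1. attains_equality a b C_PI
           (\<lambda>x :: real ^ 'n. a0 + a1 * norm x powr (1 + b - a))))
   \<and> (C_PI = D1 N b \<longrightarrow>
        (\<forall>c. \<forall>e :: real ^ 'n. attains_equality a b C_PI
           (\<lambda>x. c + norm x powr (D1 N b / 2 - 1) * (e \<bullet> x))))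
   \<and> (C1 a b < D1 N b \<longrightarrow>
        (\<forall>v \<in> (test_functions :: (real ^ 'n \<Rightarrow> real) set).
          energy a b v - C1 a b * (INF c. sqint a b (\<lambda>x. v x - c))
            \<ge> min (1 / 2) (1 - C1 a b / D1 N b)
               * (INF d. energy a b (\<lambda>x. v x - d * norm x powr (1 + b - a)))
        \<and> energy a b v - C1 a b * (INF c. sqint a b (\<lambda>x. v x - c))
            \<ge> min (C1 a b) (D1 N b - C1 a b)
               * (INF (c, d) \<in> UNIV. sqint a b (\<lambda>x. v x - c - d * norm x powr (1 + b - a)))))
   \<and> (C1 a b > D1 N b \<longrightarrow>
        (\<forall>v \<in> (test_functions :: (real ^ 'n \<Rightarrow> real) set).
          energy a b v - D1 N b * (INF c. sqint a b (\<lambda>x. v x - c))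
            \<ge> min (C1 a b - D1 N b) (D2 N b - D1 N b)
               * (INF (c, e) \<in> UNIV.
                    sqint a b (\<lambda>x. v x - c - norm x powr (D1 N b / 2 - 1) * (e \<bullet> x)))
        \<and> energy a b v - D1 N b * (INF c. sqint a b (\<lambda>x. v x - c))
            \<ge> min (1 - D1 N b / C1 a b) (1 - D1 N b / D2 N b)
               * (INF (c, e) \<in> UNIV.
                    energy a b (\<lambda>x. v x - c - norm x powr (D1 N b / 2 - 1) * (e \<bullet> x)))))
   \<and> (C1 a b = D1 N b \<longrightarrow>
        (\<forall>v \<in> (test_functions :: (real ^ 'n \<Rightarrow> real) set).
          energy a b v - D1 N b * (INF c. sqint a b (\<lambda>x. v x - c))
            \<ge> min (D1 N b) (D2 N b - D1 N b)
               * (INF (c, d, e) \<in> UNIV.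
                    sqint a b (\<lambda>x. v x - c - d * norm x powr (1 + b - a)
                      - norm x powr (D1 N b / 2 - 1) * (e \<bullet> x)))
        \<and> energy a b v - D1 N b * (INF c. sqint a b (\<lambda>x. v x - c))
            \<ge> min (1 / 2) (1 - D1 N b / D2 N b)
               * (INF (c, d, e) \<in> UNIV.
                    energy a b (\<lambda>x. v x - c - d * norm x powr (1 + b - a)
                      - norm x powr (D1 N b / 2 - 1) * (e \<bullet> x)))))"
proof -
  \<comment> \<open>The hypothesis on b says exactly that \<gamma> >= 0.\<close>
  interpret ckn a b "1 + b - a" "real CARD('n) - 2 - 2 * b" "TYPE('n)"
    using ab b N by unfold_locales simp_all
  show ?thesis
    unfolding N C_PI
  proof (intro conjI impI ballI allI)
    show "min (C1 a b) (D1 CARD('n) b) * (INF c. sqint a b (\<lambda>x. v x - c)) \<le> energy a b v"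
      if "v \<in> (test_functions :: (real ^ 'n \<Rightarrow> real) set)" for v
      using poincare_min that unfolding poincare_def by blast
    show "optimal_poincare_constant TYPE('n) a b (min (C1 a b) (D1 CARD('n) b))"
      by (rule optimal_poincare_min)
    show "attains_equality a b (min (C1 a b) (D1 CARD('n) b)) (\<lambda>x :: real ^ 'n. a0 + a1 * norm x powr (1 + b - a))"
      if "min (C1 a b) (D1 CARD('n) b) = C1 a b" for a0 a1
      unfolding that by (rule attains_equality_radial)
    show "attains_equality a b (min (C1 a b) (D1 CARD('n) b))
       (\<lambda>x :: real ^ 'n. c + norm x powr (D1 CARD('n) b / 2 - 1) * (e \<bullet> x))"
      if "min (C1 a b) (D1 CARD('n) b) = D1 CARD('n) b" for c e
      unfolding that by (rule attains_equality_linear)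
  qed (rule stability_C1(1) stability_C1(2) stability_D1(1) stability_D1(2) stability_C1_D1(1) stability_C1_D1(2); assumption)+
qed

end
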